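(* Let $d=1$, let $r\ge2$ be an integer, let $V$ be the polynomial of degree $2r$ $$V(x)=-\frac{|V''(0)|}{2}x^2+\sum_{j=2}^{r}\frac{|V^{(2j)}(0)|}{(2j)!}x^{2j},\qquad V''(0)<0,\quad V^{(2r)}(0)\neq 0,$$ and let $\psi(x)=\frac{\alpha}{2}x^2$ with $\alpha>0$. For $\lambda>0$ consider the Vlasov-Fokker-Planck equation $$\partial_t\rho=-\partial_q(\rho p)+\partial_p\big(\rho(V'+\psi'\ast\rho+p)\big)+\lambda\,\partial_p^2\rho .$$ Then there exists $\lambda_c>0$ such that: (i) for all $\lambda\ge\lambda_c$, the equation admits a unique invariant probability, which is symmetric; (ii) for all $\lambda\in(0,\lambda_c)$, the equation admits exactly three invariant probabilities. Moreover, $\lambda_c$ is the unique solution of the following equation, in which $z$ is the unknown: $$\int_0^\infty\Big(4y^2-\frac{1}{2\alpha}\Big)\exp\Big\{(|V''(0)|-\alpha)\,4y^2-\sum_{j=2}^{r}\frac{2z^{j-1}|V^{(2j)}(0)|}{(2j)!}\,2^{2j}y^{2j}\Big\}\,dy=0 .$$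
   Context: Coordinates on $\mathbb{R}^2$ are $(q,p)$, and $V'=V'(q)$. $(\psi'\ast\rho)(q)=\int_{\mathbb{R}^2}\psi'(q-q')\rho(q',p')\,dq'dp'$. An invariant probability is a probability density $\rho\in L^1\cap L^\infty(\mathbb{R}^2)$, with $\psi\ast\rho$ and $\psi'\ast\rho$ well defined, satisfying $-\partial_q(\rho p)+\partial_p(\rho(V'+\psi'\ast\rho+p))+\lambda\partial_p^2\rho=0$. It is symmetric if its density with respect to Lebesgue measure is even: $\rho(-q,-p)=\rho(q,p)$.
   Formalization: The printed equation is solved by z = 2λ_c, not z = λ_c: with diffusion term λ∂_p²ρ the threshold fixed by (i) and (ii) is half its root, so the original identification always fails; uniqueness of the solution is claimed among z > 0, since for odd r negative roots can occur. *)

theory Defs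
  imports "HOL-Analysis.Analysis"
begin

definition partial_q :: "(real \<times> real \<Rightarrow> real) \<Rightarrow> real \<times> real \<Rightarrow> real" where
  "partial_q \<phi> = (\<lambda>(q, p). deriv (\<lambda>x. \<phi> (x, p)) q)"

definition partial_p :: "(real \<times> real \<Rightarrow> real) \<Rightarrow> real \<times> real \<Rightarrow> real" where
  "partial_p \<phi> = (\<lambda>(q, p). deriv (\<lambda>y. \<phi> (q, y)) p)"

text \<open>
  Total differentiability of all these partial derivatives amounts to being infinitely
  differentiable; the order of differentiation is immaterial by Schwarz's theorem.
\<close>

definition test_function :: "(real \<times> real \<Rightarrow> real) \<Rightarrow> bool" where
  "test_function \<phi> \<longleftrightarrow>
     (\<forall>k l x. (partial_q ^^ k) ((partial_p ^^ l) \<phi>) differentiable (at x)) \<and>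
     compact (closure {x. \<phi> x \<noteq> 0})"

definition convolution_defined :: "(real \<Rightarrow> real) \<Rightarrow> (real \<times> real \<Rightarrow> real) \<Rightarrow> bool" where
  "convolution_defined f \<rho> \<longleftrightarrow>
     (\<forall>q. integrable lborel (\<lambda>(q', p'). f (q - q') * \<rho> (q', p')))"

definition convolution :: "(real \<Rightarrow> real) \<Rightarrow> (real \<times> real \<Rightarrow> real) \<Rightarrow> real \<Rightarrow> real" where
  "convolution f \<rho> q = (\<integral>(q', p'). f (q - q') * \<rho> (q', p') \<partial>lborel)"

text \<open>
  The stationary equation
  \<open>- \<partial>\<^sub>q (\<rho> p) + \<partial>\<^sub>p (\<rho> (V' + \<psi>' * \<rho> + p)) + lam \<partial>\<^sub>p\<^sup>2 \<rho> = 0\<close>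
  in the sense of distributions, since \<open>\<rho>\<close> is only an integrable bounded function.
\<close>

definition stationary_vfp ::
  "(real \<Rightarrow> real) \<Rightarrow> (real \<Rightarrow> real) \<Rightarrow> real \<Rightarrow> (real \<times> real \<Rightarrow> real) \<Rightarrow> bool" where
  "stationary_vfp V \<psi> lam \<rho> \<longleftrightarrow>
     (\<forall>\<phi>. test_function \<phi> \<longrightarrow>
        (\<integral>(q, p). \<rho> (q, p) *
            (p * partial_q \<phi> (q, p)
             - (deriv V q + convolution (deriv \<psi>) \<rho> q + p) * partial_p \<phi> (q, p)
             + lam * partial_p (partial_p \<phi>) (q, p)) \<partial>lborel) = 0)"

definition probability_density :: "(real \<times> real \<Rightarrow> real) \<Rightarrow> bool" where
  "probability_density \<rho> \<longleftrightarrow>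
     (\<forall>x. 0 \<le> \<rho> x) \<and> integrable lborel \<rho> \<and> (\<integral>x. \<rho> x \<partial>lborel) = 1"

definition invariant_density ::
  "(real \<Rightarrow> real) \<Rightarrow> (real \<Rightarrow> real) \<Rightarrow> real \<Rightarrow> (real \<times> real \<Rightarrow> real) \<Rightarrow> bool" where
  "invariant_density V \<psi> lam \<rho> \<longleftrightarrow>
     probability_density \<rho> \<and>
     (\<exists>C. AE x in lborel. \<bar>\<rho> x\<bar> \<le> C) \<and>
     convolution_defined \<psi> \<rho> \<and> convolution_defined (deriv \<psi>) \<rho> \<and>
     stationary_vfp V \<psi> lam \<rho>"

text \<open>
  Working with the measure rather than with the function identifies densities that agree
  almost everywhere, so that invariant probabilities can be counted.
\<close>

definition invariant_probability ::
  "(real \<Rightarrow> real) \<Rightarrow> (real \<Rightarrow> real) \<Rightarrow> real \<Rightarrow> (real \<times> real) measure \<Rightarrow> bool" where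
  "invariant_probability V \<psi> lam M \<longleftrightarrow>
     (\<exists>\<rho>. invariant_density V \<psi> lam \<rho> \<and> M = density lborel (\<lambda>x. ennreal (\<rho> x)))"

definition symmetric_probability :: "(real \<times> real) measure \<Rightarrow> bool" where
  "symmetric_probability M \<longleftrightarrow>
     (\<exists>\<rho>. probability_density \<rho> \<and> M = density lborel (\<lambda>x. ennreal (\<rho> x)) \<and>
          (\<forall>q p. \<rho> (- q, - p) = \<rho> (q, p)))"

definition critical_integrand :: "(real \<Rightarrow> real) \<Rightarrow> real \<Rightarrow> nat \<Rightarrow> real \<Rightarrow> real \<Rightarrow> real" where
  "critical_integrand V \<alpha> r z y =
     (4 * y ^ 2 - 1 / (2 * \<alpha>)) *
     exp ((\<bar>(deriv ^^ 2) V 0\<bar> - \<alpha>) * (4 * y ^ 2)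
          - (\<Sum>j = 2..r. 2 * z ^ (j - 1) * \<bar>(deriv ^^ (2 * j)) V 0\<bar> / fact (2 * j)
                        * 2 ^ (2 * j) * y ^ (2 * j)))"

text \<open>
  The unknown \<open>z\<close> is the squared noise intensity of the underlying diffusion, i.e.
  twice the coefficient \<open>lam\<close> of \<open>\<partial>\<^sub>p\<^sup>2\<close>. Indeed, with \<open>q = 2 y sqrt z\<close> and \<open>z = 2 lam\<close> the
  equation says that \<open>q\<^sup>2 - lam / \<alpha>\<close> has mean zero under the density proportional to
  \<open>exp (- (V q + \<alpha> q\<^sup>2 / 2) / lam)\<close>.
\<close>

definition critical_equation :: "(real \<Rightarrow> real) \<Rightarrow> real \<Rightarrow> nat \<Rightarrow> real \<Rightarrow> bool" where
  "critical_equation V \<alpha> r z \<longleftrightarrow>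
     set_integrable lborel {0<..} (critical_integrand V \<alpha> r z) \<and>
     (LINT y:{0<..}|lborel. critical_integrand V \<alpha> r z y) = 0"

end

theory Submission
  imports Defs
begin

text \<open>
  Since \<open>\<psi>'\<close> is linear, \<open>\<psi>' * \<rho>\<close> depends on \<open>\<rho>\<close> only through its mean position \<open>m\<close>, and the
  stationary equation becomes the linear kinetic Fokker-Planck equation with the potential
  \<open>W m q = V q + \<alpha> q\<^sup>2 / 2 - \<alpha> m q\<close>. The proof has three parts.

  First, the only probability densities in \<open>L\<^sup>1 \<inter> L\<^sup>\<infinity>\<close> that solve the linear equation in the sense of
  distributions are the normalized Gibbs densities \<open>mu = exp (- (p\<^sup>2 / 2 + W q) / lam)\<close>
  (\<open>stationary_density_unique\<close>). Formally, \<open>theta = mu / (mu + \<rho>)\<close> is a bounded convex function of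
  \<open>\<rho> / mu\<close>, so that integrating its equation against \<open>mu\<close> leaves the dissipation
  \<open>\<integral> (\<partial>\<^sub>p theta)\<^sup>2 mu / theta = 0\<close>; hence \<open>\<rho> / mu\<close> does not depend on \<open>p\<close>, and then transport makes it
  constant. This is made rigorous for a merely bounded \<open>\<rho>\<close> in two steps. The density is mollified at
  scale \<open>s\<close> in \<open>q\<close> and \<open>s\<^sup>2\<close> in \<open>p\<close>: the transport commutator \<open>(p - p') \<partial>\<^sub>q\<close> is then of size
  \<open>s\<^sup>2 / s\<close>, while the commutators with the drift occur under \<open>\<partial>\<^sub>p\<close> and are absorbed by the dissipation
  (\<open>energy_inequality\<close>, \<open>A_le\<close>, \<open>B_le\<close>). The cutoff is a function of the energy, which the Hamiltonian
  flow preserves, and \<open>theta\<close> is at most 1, so the tail is bounded by an integral of \<open>mu\<close> alone,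
  however slowly \<open>\<rho>\<close> decays.

  Second, invariant probabilities therefore correspond to the zeros of the self-consistency
  function \<open>Psi lam m = \<integral> (q - m) exp (- W m q / lam) dq\<close>. Up to a constant factor, an integration by parts turns it
  into \<open>force lam t = \<integral> V' q exp (- W 0 q / lam) sinh (t q) dq\<close> with \<open>t = \<alpha> m / lam\<close>. As \<open>V'\<close> changes sign on
  the half-line exactly once, at \<open>well\<close>, and \<open>sinh (t q) / sinh (t well)\<close> increases in \<open>t\<close> for
  \<open>q > well\<close> and decreases for \<open>q < well\<close>, the quotient \<open>force lam t / sinh (t well)\<close> is strictly
  increasing. So there is a positive zero, and only one, precisely if \<open>force\<close> has a negative slope at
  \<open>t = 0\<close>.

  Third, up to a negative factor this slope is the integral \<open>J\<close> of the critical equation at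
  \<open>z = 2 lam\<close>. The same single crossing argument, now in the parameter \<open>z\<close> and with the sign change of
  \<open>4 y\<^sup>2 - 1 / (2 \<alpha>)\<close>, shows that \<open>J\<close> times a positive factor is strictly decreasing; it is positive for
  some small and negative for some large \<open>z\<close>, which defines the critical value
  (\<open>J_sign_change\<close>).
\<close>

section \<open>Smooth compactly supported functions on the line\<close>

definition smooth :: "(real \<Rightarrow> real) \<Rightarrow> bool" where
  "smooth f \<longleftrightarrow> (\<forall>k x. (deriv ^^ k) f differentiable (at x))"

text \<open>Finite order versions make closure properties provable by induction: the derivative of a product or
  of an exponential contains the original function, which is only known to be smooth to the
  lower order.\<close>

primrec smooth_upto :: "nat \<Rightarrow> (real \<Rightarrow> real) \<Rightarrow> bool" where
  "smooth_upto 0 f \<longleftrightarrow> (\<forall>x. f differentiable (at x))"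
| "smooth_upto (Suc n) f \<longleftrightarrow> (\<forall>x. f differentiable (at x)) \<and> smooth_upto n (deriv f)"

lemma smooth_upto_iff: "smooth_upto n f \<longleftrightarrow> (\<forall>k\<le>n. \<forall>x. (deriv ^^ k) f differentiable (at x))"
proof (induction n arbitrary: f)
  case (Suc n)
  have "(\<forall>k\<le>Suc n. P k) \<longleftrightarrow> P 0 \<and> (\<forall>k\<le>n. P (Suc k))" for P :: "nat \<Rightarrow> bool"
    by (metis Suc_le_mono bot_nat_0.extremum not0_implies_Suc)
  from this[of "\<lambda>k. \<forall>x. (deriv ^^ k) f differentiable (at x)"] Suc show ?case
    by (simp add: funpow_Suc_right del: funpow.simps)
qed simp

lemma smooth_iff_upto: "smooth f \<longleftrightarrow> (\<forall>n. smooth_upto n f)"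
  unfolding smooth_def smooth_upto_iff by blast

lemma smooth_upto_SucD: "smooth_upto (Suc n) f \<Longrightarrow> smooth_upto n f"
  by (auto simp: smooth_upto_iff)

lemma smooth_upto_diff: "smooth_upto n f \<Longrightarrow> f differentiable (at x)"
  by (cases n) auto

lemma real_differentiable_deriv:
  fixes f :: "real \<Rightarrow> real"
  assumes "f differentiable (at x)" shows "(f has_real_derivative deriv f x) (at x)"
  using assms DERIV_deriv_iff_real_differentiable by blast

lemma deriv_eqI:
  fixes f :: "real \<Rightarrow> real"
  assumes "\<And>x. (f has_real_derivative f' x) (at x)" shows "deriv f = f'"
  using assms DERIV_imp_deriv by blast

lemma smooth_uptoI:
  assumes "\<And>x. (f has_real_derivative f' x) (at x)" "smooth_upto n f'"
  shows "smooth_upto (Suc n) f"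
  using assms deriv_eqI[of f f'] real_differentiable_def by auto

lemma smooth_upto_0I:
  assumes "\<And>x. (f has_real_derivative f' x) (at x)"
  shows "smooth_upto 0 f"
  using assms real_differentiable_def by auto

lemma smooth_upto_add:
  "smooth_upto n f \<Longrightarrow> smooth_upto n g \<Longrightarrow> smooth_upto n (\<lambda>x. f x + g x)"
proof (induction n arbitrary: f g)
  case (Suc n)
  show ?case
  proof (rule smooth_uptoI)
    show "((\<lambda>x. f x + g x) has_real_derivative deriv f x + deriv g x) (at x)" for x
      using Suc.prems by (intro DERIV_add real_differentiable_deriv) auto
  qed (use Suc in auto)
qed auto

lemma smooth_upto_mult:
  "smooth_upto n f \<Longrightarrow> smooth_upto n g \<Longrightarrow> smooth_upto n (\<lambda>x. f x * g x)"
proof (induction n arbitrary: f g)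
  case (Suc n)
  show ?case
  proof (rule smooth_uptoI)
    show "((\<lambda>x. f x * g x) has_real_derivative deriv f x * g x + deriv g x * f x) (at x)" for x
      using Suc.prems by (intro DERIV_mult real_differentiable_deriv) auto
    show "smooth_upto n (\<lambda>x. deriv f x * g x + deriv g x * f x)"
      using Suc.prems smooth_upto_SucD by (intro smooth_upto_add Suc.IH) auto
  qed
qed auto

lemma smooth_upto_const: "smooth_upto n (\<lambda>x. c)"
proof (induction n arbitrary: c)
  case (Suc n)
  show ?case by (rule smooth_uptoI[where f'="\<lambda>x. 0"]) (use Suc in auto)
qed auto

lemma smooth_upto_exp:
  "smooth_upto n P \<Longrightarrow> smooth_upto n (\<lambda>x. exp (P x))"
proof (induction n)
  case 0
  show ?case
    by (rule smooth_upto_0I[where f'="\<lambda>x. exp (P x) * deriv P x"])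
       (use 0 in \<open>auto intro!: derivative_eq_intros real_differentiable_deriv\<close>)
next
  case (Suc n)
  show ?case
  proof (rule smooth_uptoI)
    show "((\<lambda>x. exp (P x)) has_real_derivative exp (P x) * deriv P x) (at x)" for x
      using Suc.prems by (auto intro!: derivative_eq_intros real_differentiable_deriv)
    show "smooth_upto n (\<lambda>x. exp (P x) * deriv P x)"
      using Suc smooth_upto_SucD by (intro smooth_upto_mult) auto
  qed
qed

lemma smooth_upto_affine:
  "smooth_upto n f \<Longrightarrow> smooth_upto n (\<lambda>x. f (a * x + b))"
proof (induction n arbitrary: f)
  case 0
  show ?case
    by (rule smooth_upto_0I[where f'="\<lambda>x. deriv f (a * x + b) * a"])
       (use 0 in \<open>auto intro!: derivative_eq_intros DERIV_chain2[where f=f] real_differentiable_deriv\<close>)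
next
  case (Suc n)
  show ?case
  proof (rule smooth_uptoI)
    show "((\<lambda>x. f (a * x + b)) has_real_derivative deriv f (a * x + b) * a) (at x)" for x
      using Suc.prems
      by (auto intro!: derivative_eq_intros DERIV_chain2[where f=f] real_differentiable_deriv)
    show "smooth_upto n (\<lambda>x. deriv f (a * x + b) * a)"
      using Suc by (intro smooth_upto_mult smooth_upto_const) auto
  qed
qed

lemma smooth_const: "smooth (\<lambda>x. c)"
  and smooth_add: "smooth f \<Longrightarrow> smooth g \<Longrightarrow> smooth (\<lambda>x. f x + g x)"
  and smooth_mult: "smooth f \<Longrightarrow> smooth g \<Longrightarrow> smooth (\<lambda>x. f x * g x)"
  and smooth_exp: "smooth f \<Longrightarrow> smooth (\<lambda>x. exp (f x))"
  and smooth_affine: "smooth f \<Longrightarrow> smooth (\<lambda>x. f (a * x + b))"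
  by (simp_all add: smooth_iff_upto smooth_upto_const smooth_upto_add smooth_upto_mult
      smooth_upto_exp smooth_upto_affine)

lemma smooth_primitive:
  assumes "\<And>x. (f has_real_derivative f' x) (at x)" "smooth f'"
  shows "smooth f"
  unfolding smooth_iff_upto
proof
  fix n show "smooth_upto n f"
    by (cases n) (use assms in \<open>auto simp: smooth_iff_upto simp del: smooth_upto.simps
        intro: smooth_uptoI smooth_upto_0I\<close>)
qed

lemma smooth_ident: "smooth (\<lambda>x. x)"
  by (rule smooth_primitive[where f'="\<lambda>x. 1"]) (auto intro: smooth_const)

lemma smooth_power: "smooth f \<Longrightarrow> smooth (\<lambda>x. f x ^ n)"
  by (induction n) (auto intro: smooth_const smooth_mult)

lemma smooth_cmult: "smooth f \<Longrightarrow> smooth (\<lambda>x. c * f x)"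
  by (intro smooth_mult smooth_const)

lemma smooth_minus: "smooth f \<Longrightarrow> smooth (\<lambda>x. - f x)"
  using smooth_cmult[of f "-1"] by simp

lemma smooth_diff: "smooth f \<Longrightarrow> smooth g \<Longrightarrow> smooth (\<lambda>x. f x - g x)"
  using smooth_add[of f "\<lambda>x. - g x"] smooth_minus[of g] by simp

lemma smooth_sum: "(\<And>i. i \<in> I \<Longrightarrow> smooth (f i)) \<Longrightarrow> smooth (\<lambda>x. \<Sum>i\<in>I. f i x)"
  by (induction I rule: infinite_finite_induct) (auto intro: smooth_const smooth_add)

lemma smooth_divide_const: "smooth f \<Longrightarrow> smooth (\<lambda>x. f x / c)"
  using smooth_cmult[of f "1 / c"] by simp

lemma smooth_deriv: "smooth f \<Longrightarrow> smooth (deriv f)"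
  using smooth_iff_upto smooth_upto.simps(2) by blast

lemma smooth_DERIV: "smooth f \<Longrightarrow> (f has_real_derivative deriv f x) (at x)"
  using smooth_iff_upto smooth_upto_diff real_differentiable_deriv by blast

lemma smooth_isCont: "smooth f \<Longrightarrow> isCont f x"
  using smooth_DERIV DERIV_isCont by blast

lemma smooth_continuous: "smooth f \<Longrightarrow> continuous_on A f"
  by (simp add: continuous_at_imp_continuous_on smooth_isCont)

text \<open>The functions \<open>exp (- 1 / x) / x ^ n\<close>, extended by zero, span a space that is closed under
  differentiation; this is why the classical bump function is smooth.\<close>

definition flat :: "nat \<Rightarrow> real \<Rightarrow> real" where
  "flat n x = (if 0 < x then exp (- (1 / x)) / x ^ n else 0)"

lemma power_div_fact_le_exp:
  fixes x :: real
  assumes "0 \<le> x" shows "x ^ n / fact n \<le> exp x"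
proof -
  have "(\<Sum>k\<in>{n}. x ^ k /\<^sub>R fact k) \<le> (\<Sum>k. x ^ k /\<^sub>R fact k)"
    using assms by (intro sum_le_suminf summable_exp_generic) auto
  then show ?thesis by (simp add: exp_def divide_inverse mult.commute)
qed

text \<open>A quadratic bound suffices for the value and the derivative at the origin to vanish.\<close>

lemma flat_bound: "\<bar>flat n x\<bar> \<le> fact (n + 2) * x\<^sup>2"
proof (cases "0 < x")
  case True
  define F :: real where "F = fact (n + 2)"
  have "0 < F" by (simp add: F_def del: fact_Suc)
  have "(1 / x) ^ (n + 2) / F \<le> exp (1 / x)"
    unfolding F_def using True by (intro power_div_fact_le_exp) auto
  then have "(1 / x) ^ (n + 2) \<le> F * exp (1 / x)"
    using \<open>0 < F\<close> by (metis pos_divide_le_eq mult.commute)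
  then have "(1 / x) ^ (n + 2) * exp (- (1 / x)) \<le> F * exp (1 / x) * exp (- (1 / x))"
    by (rule mult_right_mono) simp
  also have "\<dots> = F"
    by (simp only: mult.assoc exp_minus_inverse mult_1_right)
  finally have "(1 / x) ^ (n + 2) * exp (- (1 / x)) \<le> F" .
  then have "(1 / x) ^ (n + 2) * exp (- (1 / x)) * x\<^sup>2 \<le> F * x\<^sup>2"
    by (intro mult_right_mono) auto
  moreover have "(1 / x) ^ (n + 2) * exp (- (1 / x)) * x\<^sup>2 = flat n x"
    using True by (simp add: flat_def power_one_over power_add power2_eq_square)
  moreover have "0 \<le> flat n x" using True by (simp add: flat_def)
  ultimately show ?thesis by (simp add: F_def del: fact_Suc)
qed (simp add: flat_def)

lemma flat_DERIV: "(flat n has_real_derivative - real n * flat (n + 1) x + flat (n + 2) x) (at x)"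
proof -
  consider "x < 0" | "x = 0" | "0 < x" by linarith
  then show ?thesis
  proof cases
    case 1
    have "((\<lambda>x. 0) has_real_derivative 0) (at x)" by simp
    then have "(flat n has_real_derivative 0) (at x)"
      by (rule has_field_derivative_transform_within_open[where S="{..<0}"]) (use 1 in \<open>auto simp: flat_def\<close>)
    then show ?thesis using 1 by (simp add: flat_def)
  next
    case 2
    have "((\<lambda>h. flat n h / h) \<longlongrightarrow> 0) (at 0)"
    proof (rule Lim_null_comparison)
      show "\<forall>\<^sub>F h in at 0. norm (flat n h / h) \<le> fact (n + 2) * \<bar>h\<bar>"
      proof (rule eventually_at_filter[THEN iffD2], rule always_eventually, intro allI impI)
        fix h :: real assume "h \<noteq> 0"
        have "\<bar>flat n h\<bar> \<le> (fact (n + 2) * \<bar>h\<bar>) * \<bar>h\<bar>"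
          using flat_bound[of n h] by (simp add: power2_eq_square abs_mult_self_eq mult.assoc)
        then show "norm (flat n h / h) \<le> fact (n + 2) * \<bar>h\<bar>"
          using \<open>h \<noteq> 0\<close> by (simp add: abs_divide divide_le_eq del: fact_Suc)
      qed
      have "((\<lambda>h::real. fact (n + 2) * \<bar>h\<bar>) \<longlongrightarrow> fact (n + 2) * \<bar>0\<bar>) (at 0)"
        by (intro tendsto_intros)
      then show "((\<lambda>h::real. fact (n + 2) * \<bar>h\<bar>) \<longlongrightarrow> 0) (at 0)" by simp
    qed
    then show ?thesis using 2 by (simp add: DERIV_def flat_def)
  next
    case 3
    have "((\<lambda>x. exp (- (1 / x)) / x ^ n) has_real_derivative - real n * flat (n + 1) x + flat (n + 2) x) (at x)"
      using 3
      by (auto intro!: derivative_eq_intros simp: flat_def field_simps power_add power2_eq_square)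
        (cases n; simp add: field_simps)
    then show ?thesis
      by (rule has_field_derivative_transform_within_open[where S="{0<..}"]) (use 3 in \<open>auto simp: flat_def\<close>)
  qed
qed

lemma smooth_flat: "smooth (flat n)"
proof -
  have "smooth_upto k (flat n)" for k n
  proof (induction k arbitrary: n)
    case 0 show ?case by (rule smooth_upto_0I[OF flat_DERIV])
  next
    case (Suc k)
    show ?case
      by (rule smooth_uptoI[OF flat_DERIV]) (intro smooth_upto_add smooth_upto_mult smooth_upto_const Suc)
  qed
  then show ?thesis by (simp add: smooth_iff_upto)
qed

definition supp_in :: "(real \<Rightarrow> real) \<Rightarrow> real \<Rightarrow> bool" where
  "supp_in f R \<longleftrightarrow> (\<forall>x. R < \<bar>x\<bar> \<longrightarrow> f x = 0)"

lemma supp_in_mono: "supp_in f R \<Longrightarrow> R \<le> R' \<Longrightarrow> supp_in f R'"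
  by (auto simp: supp_in_def)

lemma supp_in_mult: "supp_in f R \<Longrightarrow> supp_in (\<lambda>x. f x * g x) R"
  "supp_in g R \<Longrightarrow> supp_in (\<lambda>x. f x * g x) R"
  by (auto simp: supp_in_def)

lemma supp_in_deriv:
  assumes "supp_in f R" shows "supp_in (deriv f) R"
  unfolding supp_in_def
proof (intro allI impI)
  fix x assume x: "R < \<bar>x\<bar>"
  have "open {y. R < \<bar>y\<bar>}" by (intro open_Collect_less continuous_intros)
  then have "(f has_real_derivative 0) (at x)"
    by (rule has_field_derivative_transform_within_open[OF DERIV_const, of "{y. R < \<bar>y\<bar>}" _ 0])
      (use x assms in \<open>simp_all add: supp_in_def\<close>)
  then show "deriv f x = 0" by (rule DERIV_imp_deriv)
qed

definition bump_function :: "(real \<Rightarrow> real) \<Rightarrow> real \<Rightarrow> bool" where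
  "bump_function f R \<longleftrightarrow> smooth f \<and> supp_in f R"

lemma continuous_supp_in_bounded:
  assumes "continuous_on UNIV f" "supp_in f R"
  obtains C where "0 < C" "\<And>x. \<bar>f x\<bar> \<le> C"
proof -
  have "compact (f ` {-R..R})"
    using assms by (intro compact_continuous_image) (auto intro: continuous_on_subset)
  then obtain C where C: "\<And>x. x \<in> {-R..R} \<Longrightarrow> \<bar>f x\<bar> \<le> C"
    using compact_imp_bounded bounded_iff by (metis imageI real_norm_def)
  have "\<bar>f x\<bar> \<le> max C 1" for x
    using C[of x] assms(2) by (cases "x \<in> {-R..R}") (auto simp: supp_in_def)
  then show ?thesis by (intro that[of "max C 1"]) auto
qed

lemma integral_deriv_supp_in:
  assumes "\<And>x. (F has_real_derivative f x) (at x)" "continuous_on UNIV f" "supp_in f R" "0 \<le> R"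
  shows "has_bochner_integral lborel f (F R - F (-R))"
proof -
  have "has_bochner_integral lborel (\<lambda>x. f x * indicator {-R..R} x) (F R - F (-R))"
    using assms by (intro has_bochner_integral_FTC_Icc_real) (auto simp: continuous_on_eq_continuous_at)
  moreover have "f x * indicator {-R..R} x = f x" for x
    using assms(3)[unfolded supp_in_def, rule_format, of x] by (cases "x \<in> {-R..R}") auto
  ultimately show ?thesis by simp
qed

lemma continuous_antiderivative:
  fixes f :: "real \<Rightarrow> real"
  assumes "continuous_on UNIV f"
  obtains F where "\<And>x. (F has_real_derivative f x) (at x)"
proof -
  have "\<exists>F. \<forall>x :: real. -\<infinity> < ereal x \<longrightarrow> ereal x < \<infinity> \<longrightarrow> (F has_vector_derivative f x) (at x)"
    using assms by (intro einterval_antiderivative) (auto simp: continuous_on_eq_continuous_at)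
  then show ?thesis
    using that by (auto simp: has_real_derivative_iff_has_vector_derivative)
qed

text \<open>Zero mean is what makes the antiderivative vanish again to the right of the support.\<close>

lemma zero_mean_primitive:
  assumes f: "bump_function f R" "0 \<le> R" and int: "(\<integral>x. f x \<partial>lborel) = 0"
  obtains F where "bump_function F R" "deriv F = f"
proof -
  have cf: "continuous_on UNIV f" using f by (simp add: bump_function_def smooth_continuous)
  then obtain G where G: "\<And>x. (G has_real_derivative f x) (at x)"
    by (rule continuous_antiderivative) blast
  define F where "F x = G x - G R" for x
  have F: "(F has_real_derivative f x) (at x)" for x
    using G unfolding F_def by (auto intro!: derivative_eq_intros)
  have GR: "G R = G (-R)"
    using integral_deriv_supp_in[OF G cf _ f(2)] f int
    by (simp add: bump_function_def has_bochner_integral_iff)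
  have "F x = 0" if "R < \<bar>x\<bar>" for x
  proof (cases "0 \<le> x")
    case True
    then have x: "R < x" using that by simp
    have "\<exists>z. z > R \<and> z < x \<and> F x - F R = (x - R) * f z"
      using F by (intro MVT2[OF x]) auto
    then show ?thesis using f by (auto simp: F_def bump_function_def supp_in_def)
  next
    case False
    then have x: "x < -R" using that by simp
    have "\<exists>z. z > x \<and> z < -R \<and> F (-R) - F x = (-R - x) * f z"
      using F by (intro MVT2[OF x]) auto
    then show ?thesis using f GR by (auto simp: F_def bump_function_def supp_in_def)
  qed
  then have "bump_function F R"
    using f smooth_primitive[OF F] by (auto simp: bump_function_def supp_in_def)
  moreover have "deriv F = f" using F by (rule deriv_eqI)
  ultimately show ?thesis by (rule that)
qed

lemma integral_pos_if_pos_on_interval: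
  fixes f :: "real \<Rightarrow> real"
  assumes i: "integrable lborel f" and nn: "\<And>x. 0 \<le> f x" and ab: "a < b"
    and pos: "\<And>x. a < x \<Longrightarrow> x < b \<Longrightarrow> 0 < f x"
  shows "0 < (\<integral>x. f x \<partial>lborel)"
proof -
  have "(\<integral>x. f x \<partial>lborel) \<noteq> 0"
  proof
    assume "(\<integral>x. f x \<partial>lborel) = 0"
    then have "AE x in lborel. f x = 0"
      using integral_nonneg_eq_0_iff_AE[OF i AE_I2[OF nn]] by simp
    then have "AE x in lborel. x \<notin> {a<..<b}"
      by (rule AE_mp) (use pos in \<open>force intro!: AE_I2\<close>)
    then have "emeasure lborel {x \<in> space lborel. \<not> x \<notin> {a<..<b}} = 0"
      by (subst (asm) AE_iff_measurable[OF _ refl]) auto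
    also have "{x \<in> space lborel. \<not> x \<notin> {a<..<b}} = {a<..<b}" by auto
    finally show False using ab by simp
  qed
  moreover have "0 \<le> (\<integral>x. f x \<partial>lborel)"
    by (rule Bochner_Integration.integral_nonneg[OF nn])
  ultimately show ?thesis by simp
qed

text \<open>The support lies to the right of the origin so that the first moment is positive as well, which is
  what recovers \<open>a'\<close> from the transport term \<open>p a'(q) b(p)\<close> in the uniqueness proof.\<close>

lemma ex_bump:
  obtains \<eta> where "smooth \<eta>" "\<And>x. 0 \<le> \<eta> x" "\<And>x. x \<notin> {0<..<1} \<Longrightarrow> \<eta> x = 0"
    "\<And>x. x \<in> {0<..<1} \<Longrightarrow> 0 < \<eta> x" "has_bochner_integral lborel \<eta> 1"
proof -
  define g where "g x = flat 0 x * flat 0 (-1 * x + 1)" for x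
  have sm: "smooth g" unfolding g_def by (intro smooth_mult smooth_affine smooth_flat)
  have g0: "0 \<le> g x" for x by (simp add: g_def flat_def)
  have gz: "g x = 0" if "x \<notin> {0<..<1}" for x using that by (auto simp: g_def flat_def)
  have gp: "0 < g x" if "x \<in> {0<..<1}" for x using that by (auto simp: g_def flat_def)
  have sup: "supp_in g 1" unfolding supp_in_def
  proof (intro allI impI)
    show "g x = 0" if "1 < \<bar>x\<bar>" for x using that by (intro gz) auto
  qed
  obtain G where "\<And>x. (G has_real_derivative g x) (at x)"
    using continuous_antiderivative[OF smooth_continuous[OF sm]] by blast
  then have int: "integrable lborel g"
    using integral_deriv_supp_in[OF _ smooth_continuous[OF sm] sup] by (auto simp: has_bochner_integral_iff)
  have I: "0 < (\<integral>x. g x \<partial>lborel)" (is "0 < ?I")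
    by (rule integral_pos_if_pos_on_interval[OF int g0, of 0 1]) (auto intro: gp)
  show ?thesis
  proof (rule that[of "\<lambda>x. g x / ?I"])
    show "smooth (\<lambda>x. g x / ?I)" by (intro smooth_divide_const sm)
    show "has_bochner_integral lborel (\<lambda>x. g x / ?I) 1"
      using int I by (simp add: has_bochner_integral_iff)
  qed (use g0 gz gp I in auto)
qed

lemma funpow_partial_q:
  assumes "smooth a"
  shows "(partial_q ^^ k) (\<lambda>(q, p). a q * b p) = (\<lambda>(q, p). (deriv ^^ k) a q * b p)"
  using assms
proof (induction k arbitrary: a)
  case (Suc k)
  have "partial_q (\<lambda>(q, p). a q * b p) = (\<lambda>(q, p). deriv a q * b p)"
    unfolding partial_q_def using smooth_DERIV[OF Suc.prems]
    by (auto intro!: ext DERIV_imp_deriv derivative_eq_intros)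
  then show ?case using Suc smooth_deriv by (simp add: funpow_Suc_right del: funpow.simps)
qed simp

lemma funpow_partial_p:
  assumes "smooth b"
  shows "(partial_p ^^ k) (\<lambda>(q, p). a q * b p) = (\<lambda>(q, p). a q * (deriv ^^ k) b p)"
  using assms
proof (induction k arbitrary: b)
  case (Suc k)
  have "partial_p (\<lambda>(q, p). a q * b p) = (\<lambda>(q, p). a q * deriv b p)"
    unfolding partial_p_def using smooth_DERIV[OF Suc.prems]
    by (auto intro!: ext DERIV_imp_deriv derivative_eq_intros)
  then show ?case using Suc smooth_deriv by (simp add: funpow_Suc_right del: funpow.simps)
qed simp

text \<open>Tensor products are the only test functions from which the uniqueness proof draws information.\<close>

lemma test_function_tensor:
  assumes a: "bump_function a R" and b: "bump_function b R"
  shows "test_function (\<lambda>(q, p). a q * b p)"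
  unfolding test_function_def
proof (intro conjI allI)
  fix k l and x :: "real \<times> real"
  have eq: "(partial_q ^^ k) ((partial_p ^^ l) (\<lambda>(q, p). a q * b p))
    = (\<lambda>x. (deriv ^^ k) a (fst x) * (deriv ^^ l) b (snd x))"
    using funpow_partial_p[of b l a] funpow_partial_q[of a k "(deriv ^^ l) b"] a b
    by (simp only: bump_function_def) (simp only: split_def)
  have "(\<lambda>x. (deriv ^^ k) a (fst x)) differentiable (at x)"
    using a differentiable_chain_at[of fst x "(deriv ^^ k) a"]
      bounded_linear_imp_differentiable[OF bounded_linear_fst, of "at x"]
    by (auto simp: bump_function_def smooth_def o_def)
  moreover have "(\<lambda>x. (deriv ^^ l) b (snd x)) differentiable (at x)"
    using b differentiable_chain_at[of snd x "(deriv ^^ l) b"]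
      bounded_linear_imp_differentiable[OF bounded_linear_snd, of "at x"]
    by (auto simp: bump_function_def smooth_def o_def)
  ultimately show "(partial_q ^^ k) ((partial_p ^^ l) (\<lambda>(q, p). a q * b p)) differentiable (at x)"
    unfolding eq by (rule differentiable_mult)
next
  have "{x. (case x of (q, p) \<Rightarrow> a q * b p) \<noteq> 0} \<subseteq> {-R..R} \<times> {-R..R}"
    using a b by (force simp: bump_function_def supp_in_def)
  then have "bounded {x. (case x of (q, p) \<Rightarrow> a q * b p) \<noteq> 0}"
    by (rule bounded_subset[rotated]) (intro bounded_Times bounded_closed_interval)
  then show "compact (closure {x. (case x of (q, p) \<Rightarrow> a q * b p) \<noteq> 0})"
    by (simp add: compact_closure)
qed

section \<open>Integrals over the plane\<close>

lemma tensor_integral: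
  fixes f :: "'a::euclidean_space \<Rightarrow> real" and g :: "'b::euclidean_space \<Rightarrow> real"
  assumes f: "integrable lborel f" and g: "integrable lborel g"
  shows "integrable lborel (\<lambda>z. f (fst z) * g (snd z))"
    and "(\<integral>z. f (fst z) * g (snd z) \<partial>lborel) = (\<integral>x. f x \<partial>lborel) * (\<integral>x. g x \<partial>lborel)"
proof -
  have [measurable]: "f \<in> borel_measurable borel" "g \<in> borel_measurable borel"
    using f g by auto
  have int: "integrable (lborel \<Otimes>\<^sub>M lborel) (\<lambda>z. f (fst z) * g (snd z))"
  proof (rule lborel_pair.Fubini_integrable)
    show "integrable lborel (\<lambda>x. \<integral>y. norm (f (fst (x, y)) * g (snd (x, y))) \<partial>lborel)"
      using f by (simp add: abs_mult)
  qed (use g in auto)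
  then show "integrable lborel (\<lambda>z. f (fst z) * g (snd z))"
    by (simp add: lborel_prod)
  show "(\<integral>z. f (fst z) * g (snd z) \<partial>lborel) = (\<integral>x. f x \<partial>lborel) * (\<integral>x. g x \<partial>lborel)"
    using lborel_pair.integral_fst'[OF int] by (simp add: lborel_prod)
qed

lemma integral_plane_swap:
  fixes f :: "real \<times> real \<Rightarrow> real"
  assumes "f \<in> borel_measurable borel"
  shows "(\<integral>z. f (snd z, fst z) \<partial>lborel) = (\<integral>z. f z \<partial>lborel)"
proof -
  have "f \<in> borel_measurable (lborel \<Otimes>\<^sub>M lborel)"
    using assms by (simp add: lborel_prod)
  from lborel_pair.integral_product_swap[OF this] show ?thesis
    by (simp add: lborel_prod split_def)
qed

definition supp_box :: "(real \<times> real \<Rightarrow> real) \<Rightarrow> real \<Rightarrow> bool" where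
  "supp_box f R \<longleftrightarrow> (\<forall>z. R < \<bar>fst z\<bar> \<or> R < \<bar>snd z\<bar> \<longrightarrow> f z = 0)"

definition square :: "real \<Rightarrow> (real \<times> real) set" where
  "square R = cbox (-R, -R) (R, R)"

lemma in_square: "z \<in> square R \<longleftrightarrow> \<bar>fst z\<bar> \<le> R \<and> \<bar>snd z\<bar> \<le> R"
  unfolding square_def by (cases z) (auto simp: cbox_Pair_eq)

lemma compact_square: "compact (square R)"
  by (simp add: square_def compact_cbox)

lemma integrable_indicator_square: "integrable lborel (indicator (square R) :: _ \<Rightarrow> real)"
  unfolding square_def by (simp add: integrable_indicator_iff emeasure_lborel_cbox_eq)

lemma continuous_on_square_bounded:
  fixes f :: "real \<times> real \<Rightarrow> real"
  assumes "continuous_on UNIV f"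
  obtains C where "0 < C" "\<And>z. z \<in> square R \<Longrightarrow> \<bar>f z\<bar> \<le> C"
proof -
  have "compact (f ` square R)"
    using assms by (intro compact_continuous_image compact_square) (auto intro: continuous_on_subset)
  then obtain C where C: "\<And>x. x \<in> square R \<Longrightarrow> \<bar>f x\<bar> \<le> C"
    using compact_imp_bounded bounded_iff by (metis imageI real_norm_def)
  show ?thesis by (rule that[of "max C 1"]) (use C in \<open>auto simp: le_max_iff_disj\<close>)
qed

lemma integrable_bounded_on_square:
  fixes f :: "real \<times> real \<Rightarrow> real"
  assumes "f \<in> borel_measurable borel" "\<And>z. \<bar>f z\<bar> \<le> C * indicator (square R) z"
  shows "integrable lborel f"
  by (rule Bochner_Integration.integrable_bound[of lborel "\<lambda>z. C * indicator (square R) z"])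
    (use assms in \<open>auto intro!: integrable_mult_right integrable_indicator_square
       order.trans[OF _ abs_ge_self]\<close>)

lemma continuous_supp_box_bound:
  assumes "continuous_on UNIV f" "supp_box f R"
  obtains C where "0 < C" "\<And>z. \<bar>f z\<bar> \<le> C * indicator (square R) z"
proof -
  obtain C where C: "0 < C" "\<And>z. z \<in> square R \<Longrightarrow> \<bar>f z\<bar> \<le> C"
    using continuous_on_square_bounded[OF assms(1)] by blast
  show ?thesis
    by (rule that[of C]) (use C assms(2) in \<open>auto simp: indicator_def supp_box_def in_square not_le\<close>)
qed

lemma integrable_continuous_supp_box:
  assumes "continuous_on UNIV f" "supp_box f R"
  shows "integrable lborel f"
  using continuous_supp_box_bound[OF assms] integrable_bounded_on_square
    borel_measurable_continuous_onI[OF assms(1)] by metis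

lemma integral_partial_q:
  assumes d: "\<And>q p. ((\<lambda>q. F (q, p)) has_real_derivative F' (q, p)) (at q)"
    and c: "continuous_on UNIV F'" and s: "supp_box F R"
  shows "integrable lborel F'" "(\<integral>z. F' z \<partial>lborel) = 0"
proof -
  define R' where "R' = \<bar>R\<bar>"
  have s': "supp_box F R'" using s by (auto simp: supp_box_def R'_def)
  have slice: "supp_in (\<lambda>q. F (q, p)) R'" for p
    using s' by (auto simp: supp_box_def supp_in_def)
  have F'_eq: "(\<lambda>q. F' (q, p)) = deriv (\<lambda>q. F (q, p))" for p
    using deriv_eqI[OF d] by metis
  have slice': "supp_in (\<lambda>q. F' (q, p)) R'" for p
    using supp_in_deriv[OF slice] by (simp add: F'_eq)
  have zero: "F' (q, p) = 0" if "R' < \<bar>p\<bar>" for q p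
  proof -
    have "(\<lambda>q. F (q, p)) = (\<lambda>q. 0)" using s' that by (auto simp: supp_box_def)
    then show ?thesis using d[of p q] DERIV_unique[of "\<lambda>q. 0" _ q] by auto
  qed
  have sF': "supp_box F' R'"
    using slice' zero by (auto simp: supp_box_def supp_in_def)
  show int: "integrable lborel F'"
    by (rule integrable_continuous_supp_box[OF c sF'])
  have cs: "continuous_on UNIV (\<lambda>q. F' (q, p))" for p
    by (rule continuous_on_compose2[OF c]) (auto intro!: continuous_intros)
  have inner: "(\<integral>q. F' (q, p) \<partial>lborel) = 0" for p
  proof -
    have "F (R', p) = F (- R', p)"
    proof -
      have e: "(\<integral>q. F' (q, p) \<partial>lborel) = F (r, p) - F (-r, p)" if "R' \<le> r" for r
        using integral_deriv_supp_in[OF d[of p] cs[of p] supp_in_mono[OF slice' that]] that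
        by (auto simp: R'_def has_bochner_integral_iff)
      have "F (R' + 1, p) = 0" "F (- (R' + 1), p) = 0"
        using s' by (auto simp: supp_box_def R'_def)
      then show ?thesis using e[of R'] e[of "R' + 1"] by simp
    qed
    then show ?thesis
      using integral_deriv_supp_in[OF d[of p] cs[of p] slice']
      by (auto simp: R'_def has_bochner_integral_iff)
  qed
  have "integrable (lborel \<Otimes>\<^sub>M lborel) (\<lambda>(p, q). F' (q, p))"
    using lborel_pair.integrable_product_swap[of F'] int by (simp add: lborel_prod)
  from lborel_pair.integral_fst'[OF this]
  have "(\<integral>z. F' (snd z, fst z) \<partial>lborel) = 0"
    by (simp add: inner lborel_prod split_def)
  then show "(\<integral>z. F' z \<partial>lborel) = 0"
    using integral_plane_swap[of F'] int by simp
qed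

lemma integral_partial_p:
  assumes d: "\<And>q p. ((\<lambda>p. F (q, p)) has_real_derivative F' (q, p)) (at p)"
    and c: "continuous_on UNIV F'" and s: "supp_box F R"
  shows "integrable lborel F'" "(\<integral>z. F' z \<partial>lborel) = 0"
proof -
  let ?s = "\<lambda>z :: real \<times> real. (snd z, fst z)"
  have cs: "continuous_on UNIV (\<lambda>z. F' (?s z))"
    by (rule continuous_on_compose2[OF c]) (auto intro!: continuous_intros)
  have m: "F' \<in> borel_measurable borel" using c by (rule borel_measurable_continuous_onI)
  have "integrable lborel (\<lambda>z. F' (?s z))" "(\<integral>z. F' (?s z) \<partial>lborel) = 0"
    using integral_partial_q[of "\<lambda>z. F (?s z)" "\<lambda>z. F' (?s z)" R] d cs s
    by (auto simp: supp_box_def)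
  moreover have "integrable lborel (\<lambda>z. F' (?s z)) \<longleftrightarrow> integrable lborel F'"
    using lborel_pair.integrable_product_swap_iff[of F'] by (simp add: lborel_prod split_def)
  ultimately show "integrable lborel F'" "(\<integral>z. F' z \<partial>lborel) = 0"
    using integral_plane_swap[OF m] by simp_all
qed

text \<open>The mean value theorem bounds the difference quotients by the bound on the derivative, so that
  dominated convergence applies along every sequence.\<close>

lemma DERIV_integral_dominated:
  fixes g g' :: "real \<Rightarrow> 'a \<Rightarrow> real"
  assumes d: "\<And>x z. ((\<lambda>x. g x z) has_real_derivative g' x z) (at x)"
    and int: "\<And>x. integrable M (g x)"
    and meas: "g' x0 \<in> borel_measurable M"
    and bound: "\<And>x z. \<bar>x - x0\<bar> \<le> 1 \<Longrightarrow> \<bar>g' x z\<bar> \<le> w z"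
    and w: "integrable M w"
  shows "((\<lambda>x. \<integral>z. g x z \<partial>M) has_real_derivative (\<integral>z. g' x0 z \<partial>M)) (at x0)"
  unfolding DERIV_def tendsto_at_iff_sequentially comp_def
proof (intro allI impI)
  fix X :: "nat \<Rightarrow> real" assume X: "\<forall>i. X i \<in> UNIV - {0}" "X \<longlonglongrightarrow> 0"
  have "eventually (\<lambda>n. \<bar>X n\<bar> < 1) sequentially"
    using order_tendstoD(2)[OF tendsto_rabs[OF X(2)], of 1] by simp
  then obtain N where N: "\<And>n. N \<le> n \<Longrightarrow> \<bar>X n\<bar> < 1" by (auto simp: eventually_sequentially)
  let ?q = "\<lambda>n z. (g (x0 + X (n + N)) z - g x0 z) / X (n + N)"
  have "(\<lambda>n. \<integral>z. ?q n z \<partial>M) \<longlonglongrightarrow> (\<integral>z. g' x0 z \<partial>M)"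
  proof (rule integral_dominated_convergence[where w=w])
    show "AE z in M. (\<lambda>n. ?q n z) \<longlonglongrightarrow> g' x0 z"
    proof (rule AE_I2)
      fix z
      have "((\<lambda>h. (g (x0 + h) z - g x0 z) / h) \<longlongrightarrow> g' x0 z) (at 0)"
        using d by (simp add: DERIV_def)
      then have "(\<lambda>n. (g (x0 + X n) z - g x0 z) / X n) \<longlonglongrightarrow> g' x0 z"
        using X unfolding tendsto_at_iff_sequentially comp_def by blast
      then show "(\<lambda>n. ?q n z) \<longlonglongrightarrow> g' x0 z" by (rule LIMSEQ_ignore_initial_segment)
    qed
    show "AE z in M. norm (?q n z) \<le> w z" for n
    proof (rule AE_I2)
      fix z
      let ?h = "X (n + N)"
      have h: "?h \<noteq> 0" "\<bar>?h\<bar> < 1" using X N by auto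
      have "norm (g (x0 + ?h) z - g x0 z) \<le> w z * norm (x0 + ?h - x0)"
      proof (rule field_differentiable_bound[where S="cball x0 1" and f'="\<lambda>x. g' x z"])
        show "convex (cball x0 1)" by simp
        show "((\<lambda>x. g x z) has_field_derivative g' y z) (at y within cball x0 1)" for y
          using d by (rule has_field_derivative_at_within)
        show "norm (g' y z) \<le> w z" if "y \<in> cball x0 1" for y
          using bound[of y] that by (simp add: dist_real_def abs_minus_commute)
      qed (use h in \<open>auto simp: dist_real_def\<close>)
      then show "norm (?q n z) \<le> w z"
        using h by (simp add: divide_le_eq)
    qed
  qed (use int meas w in \<open>auto intro!: borel_measurable_divide borel_measurable_diff\<close>)
  moreover have "(\<integral>z. ?q n z \<partial>M)
      = ((\<integral>z. g (x0 + X (n + N)) z \<partial>M) - (\<integral>z. g x0 z \<partial>M)) / X (n + N)" for n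
    using int by simp
  ultimately have "(\<lambda>n. ((\<integral>z. g (x0 + X (n + N)) z \<partial>M) - (\<integral>z. g x0 z \<partial>M)) / X (n + N))
      \<longlonglongrightarrow> (\<integral>z. g' x0 z \<partial>M)" by (simp only:)
  then show "(\<lambda>n. ((\<integral>z. g (x0 + X n) z \<partial>M) - (\<integral>z. g x0 z \<partial>M)) / X n) \<longlonglongrightarrow> (\<integral>z. g' x0 z \<partial>M)"
    by (rule LIMSEQ_offset)
qed

section \<open>Convolution with tensor kernels\<close>

text \<open>The convolutions below are taken with \<open>\<rho>\<close> times an unbounded drift, hence only local bounds.\<close>

definition locally_bounded :: "(real \<times> real \<Rightarrow> real) \<Rightarrow> bool" where
  "locally_bounded f \<longleftrightarrow> f \<in> borel_measurable borel \<and> (\<forall>R. \<exists>C. \<forall>z\<in>square R. \<bar>f z\<bar> \<le> C)"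

lemma locally_bounded_mult:
  assumes f: "locally_bounded f" and g: "locally_bounded g"
  shows "locally_bounded (\<lambda>z. f z * g z)"
  unfolding locally_bounded_def
proof (intro conjI allI)
  fix R
  obtain C D where "\<forall>z\<in>square R. \<bar>f z\<bar> \<le> C" "\<forall>z\<in>square R. \<bar>g z\<bar> \<le> D"
    using f g unfolding locally_bounded_def by blast
  then have "\<forall>z\<in>square R. \<bar>f z * g z\<bar> \<le> C * D"
    unfolding abs_mult by (force intro!: mult_mono intro: order.trans[OF abs_ge_zero])
  then show "\<exists>C. \<forall>z\<in>square R. \<bar>f z * g z\<bar> \<le> C" by blast
qed (use assms in \<open>auto simp: locally_bounded_def\<close>)

lemma locally_bounded_continuous:
  assumes "continuous_on UNIV f" shows "locally_bounded f"
  unfolding locally_bounded_def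
  using borel_measurable_continuous_onI[OF assms] continuous_on_square_bounded[OF assms] by metis

definition conv :: "(real \<times> real \<Rightarrow> real) \<Rightarrow> (real \<Rightarrow> real) \<Rightarrow> (real \<Rightarrow> real) \<Rightarrow> real \<times> real \<Rightarrow> real" where
  "conv f k l z = (\<integral>w. f w * (k (fst z - fst w) * l (snd z - snd w)) \<partial>lborel)"

lemma conv_integrand_measurable:
  fixes f :: "real \<times> real \<Rightarrow> real" and k l :: "real \<Rightarrow> real"
  assumes f: "f \<in> borel_measurable borel"
    and k: "continuous_on UNIV k" and l: "continuous_on UNIV l"
  shows "(\<lambda>w. f w * (k (fst z - fst w) * l (snd z - snd w))) \<in> borel_measurable borel"
proof -
  have "continuous_on UNIV (\<lambda>w::real \<times> real. k (fst z - fst w))"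
    by (rule continuous_on_compose2[OF k]) (auto intro!: continuous_intros)
  moreover have "continuous_on UNIV (\<lambda>w::real \<times> real. l (snd z - snd w))"
    by (rule continuous_on_compose2[OF l]) (auto intro!: continuous_intros)
  ultimately have "continuous_on UNIV (\<lambda>w. k (fst z - fst w) * l (snd z - snd w))"
    by (rule continuous_on_mult)
  then show ?thesis by (intro borel_measurable_times[OF f] borel_measurable_continuous_onI)
qed

text \<open>For base points in a fixed square the kernels see only a slightly larger square; this is the
  common dominating function for continuity and for differentiation of a convolution.\<close>

lemma conv_integrand_bound:
  fixes f :: "real \<times> real \<Rightarrow> real" and k l :: "real \<Rightarrow> real"
  assumes f: "locally_bounded f"
    and k: "continuous_on UNIV k" "supp_in k L" and l: "continuous_on UNIV l" "supp_in l L"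
  obtains C where "\<And>z w. z \<in> square R \<Longrightarrow>
    \<bar>f w * (k (fst z - fst w) * l (snd z - snd w))\<bar> \<le> C * indicator (square (R + L)) w"
proof -
  obtain Cf where Cf: "\<And>z. z \<in> square (R + L) \<Longrightarrow> \<bar>f z\<bar> \<le> Cf"
    using f unfolding locally_bounded_def by blast
  obtain Ck Cl where C: "0 < Ck" "\<And>x. \<bar>k x\<bar> \<le> Ck" "0 < Cl" "\<And>x. \<bar>l x\<bar> \<le> Cl"
    using continuous_supp_in_bounded k l by metis
  show ?thesis
  proof (rule that)
    fix z w :: "real \<times> real" assume z: "z \<in> square R"
    show "\<bar>f w * (k (fst z - fst w) * l (snd z - snd w))\<bar>
        \<le> Cf * (Ck * Cl) * indicator (square (R + L)) w"
    proof (cases "w \<in> square (R + L)")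
      case True
      have "0 \<le> Cf" using Cf[OF True] by linarith
      then show ?thesis using True C Cf[OF True] unfolding abs_mult
        by (auto intro!: mult_mono less_imp_le[OF C(1)])
    next
      case False
      then have "L < \<bar>fst z - fst w\<bar> \<or> L < \<bar>snd z - snd w\<bar>"
        using z unfolding in_square by linarith
      then show ?thesis using False k l by (auto simp: supp_in_def)
    qed
  qed
qed

context
  fixes f k l L
  assumes f: "locally_bounded f"
    and k: "continuous_on UNIV k" "supp_in k L" and l: "continuous_on UNIV l" "supp_in l L"
begin

lemma conv_integrable: "integrable lborel (\<lambda>w. f w * (k (fst z - fst w) * l (snd z - snd w)))"
proof -
  let ?R = "max \<bar>fst z\<bar> \<bar>snd z\<bar>"
  obtain C where C: "\<And>z w. z \<in> square ?R \<Longrightarrow>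
      \<bar>f w * (k (fst z - fst w) * l (snd z - snd w))\<bar> \<le> C * indicator (square (?R + L)) w"
    using conv_integrand_bound[OF f k l] by blast
  show ?thesis
  proof (rule integrable_bounded_on_square)
    show "(\<lambda>w. f w * (k (fst z - fst w) * l (snd z - snd w))) \<in> borel_measurable borel"
      by (rule conv_integrand_measurable) (use f k l in \<open>auto simp: locally_bounded_def\<close>)
    show "\<bar>f w * (k (fst z - fst w) * l (snd z - snd w))\<bar> \<le> C * indicator (square (?R + L)) w" for w
      by (rule C) (simp add: in_square)
  qed
qed

lemma conv_continuous: "continuous_on UNIV (conv f k l)"
proof (intro continuous_at_imp_continuous_on ballI)
  fix z :: "real \<times> real"
  show "isCont (conv f k l) z"
    unfolding continuous_at_sequentially comp_def
  proof (intro allI impI)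
    fix x assume x: "x \<longlonglongrightarrow> z"
    then have "bounded (range x)" by (rule convergent_imp_bounded)
    then obtain R where R: "\<And>n. norm (x n) \<le> R" unfolding bounded_iff by blast
    have xR: "x n \<in> square R" for n
      unfolding in_square
      using R[of n] norm_fst_le[of "fst (x n)" "snd (x n)"] norm_snd_le[of "snd (x n)" "fst (x n)"] by simp
    obtain C where C: "\<And>z w. z \<in> square R \<Longrightarrow>
      \<bar>f w * (k (fst z - fst w) * l (snd z - snd w))\<bar> \<le> C * indicator (square (R + L)) w"
      using conv_integrand_bound[OF f k l] by blast
    have kc: "isCont k y" and lc: "isCont l y" for y
      using k l by (auto simp: continuous_on_eq_continuous_at)
    show "(\<lambda>n. conv f k l (x n)) \<longlonglongrightarrow> conv f k l z"
      unfolding conv_def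
    proof (rule integral_dominated_convergence[where w="\<lambda>w. C * indicator (square (R + L)) w"])
      show "AE w in lborel. (\<lambda>n. f w * (k (fst (x n) - fst w) * l (snd (x n) - snd w)))
          \<longlonglongrightarrow> f w * (k (fst z - fst w) * l (snd z - snd w))"
        by (intro AE_I2 tendsto_intros isCont_tendsto_compose[OF kc] isCont_tendsto_compose[OF lc] x)
    qed (use C xR f k l conv_integrand_measurable[of f k l] in \<open>auto simp: locally_bounded_def
          intro!: integrable_mult_right integrable_indicator_square\<close>)
  qed
qed

end

lemma DERIV_shift_one: "((\<lambda>x::real. x - c) has_real_derivative 1) (at x)"
  by (auto intro!: derivative_eq_intros)

lemma conv_DERIV_q:
  assumes f: "locally_bounded f"
    and k: "\<And>x. (k has_real_derivative k' x) (at x)" "continuous_on UNIV k'" "supp_in k L"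
    and l: "continuous_on UNIV l" "supp_in l L"
  shows "((\<lambda>q. conv f k l (q, p)) has_real_derivative conv f k' l (q, p)) (at q)"
proof -
  have kc: "continuous_on UNIV k" using k(1) by (meson DERIV_isCont continuous_at_imp_continuous_on)
  have sk': "supp_in k' L" using supp_in_deriv[OF k(3)] deriv_eqI[OF k(1)] by simp
  define R where "R = max (\<bar>q\<bar> + 1) \<bar>p\<bar>"
  obtain C where C: "\<And>z w. z \<in> square R \<Longrightarrow>
      \<bar>f w * (k' (fst z - fst w) * l (snd z - snd w))\<bar> \<le> C * indicator (square (R + L)) w"
    using conv_integrand_bound[OF f k(2) sk' l] by blast
  show ?thesis
    unfolding conv_def
  proof (rule DERIV_integral_dominated[where w="\<lambda>w. C * indicator (square (R + L)) w"])
    fix x and w :: "real \<times> real"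
    have "((\<lambda>x. k (x - fst w)) has_real_derivative k' (x - fst w)) (at x)"
      using DERIV_chain2[OF k(1), where g="\<lambda>x. x - fst w" and x=x and Db=1 and s=UNIV]
      by (simp add: DERIV_shift_one)
    then show "((\<lambda>x. f w * (k (fst (x, p) - fst w) * l (snd (x, p) - snd w))) has_real_derivative
        f w * (k' (fst (x, p) - fst w) * l (snd (x, p) - snd w))) (at x)"
      by (auto intro!: derivative_eq_intros)
    show "integrable lborel (\<lambda>w. f w * (k (fst (x, p) - fst w) * l (snd (x, p) - snd w)))" for x
      using conv_integrable[OF f kc k(3) l] by blast
    show "\<bar>f w * (k' (fst (x, p) - fst w) * l (snd (x, p) - snd w))\<bar> \<le> C * indicator (square (R + L)) w"
      if "\<bar>x - q\<bar> \<le> 1" for x w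
      by (rule C) (use that in \<open>auto simp: in_square R_def\<close>)
  qed (use conv_integrand_measurable[of f k' l "(q, p)"] f k l in
      \<open>auto simp: locally_bounded_def intro!: integrable_mult_right integrable_indicator_square\<close>)
qed

lemma conv_swap:
  assumes "f \<in> borel_measurable borel" "continuous_on UNIV k" "continuous_on UNIV l"
  shows "conv f k l (q, p) = conv (\<lambda>z. f (snd z, fst z)) l k (p, q)"
  using integral_plane_swap[OF conv_integrand_measurable[OF assms, of "(q, p)"]]
  by (simp add: conv_def mult.commute)

lemma conv_DERIV_p:
  assumes f: "locally_bounded f"
    and l: "\<And>x. (l has_real_derivative l' x) (at x)" "continuous_on UNIV l'" "supp_in l L"
    and k: "continuous_on UNIV k" "supp_in k L"
  shows "((\<lambda>p. conv f k l (q, p)) has_real_derivative conv f k l' (q, p)) (at p)"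
proof -
  have fm: "f \<in> borel_measurable borel" using f by (simp add: locally_bounded_def)
  have lc: "continuous_on UNIV l" using l(1) by (meson DERIV_isCont continuous_at_imp_continuous_on)
  have "(\<lambda>z :: real \<times> real. (snd z, fst z)) \<in> borel_measurable borel"
    by (intro borel_measurable_continuous_onI continuous_intros)
  note m = measurable_compose[OF this fm]
  have "\<exists>C. \<forall>z\<in>square R. \<bar>f (snd z, fst z)\<bar> \<le> C" for R
  proof -
    obtain C where C: "\<And>z. z \<in> square R \<Longrightarrow> \<bar>f z\<bar> \<le> C"
      using f unfolding locally_bounded_def by blast
    have "\<bar>f (snd z, fst z)\<bar> \<le> C" if "z \<in> square R" for z
      using that by (intro C) (simp add: in_square)
    then show ?thesis by blast
  qed
  with m have "locally_bounded (\<lambda>z. f (snd z, fst z))" by (simp add: locally_bounded_def)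
  from conv_DERIV_q[OF this l k] show ?thesis
    unfolding conv_swap[OF fm k(1) lc] conv_swap[OF fm k(1) l(2)] .
qed

section \<open>Confining potentials and energy cutoffs\<close>

lemma integrable_exp_abs:
  fixes c :: real
  assumes c: "0 < c" shows "integrable lborel (\<lambda>x. exp (- (c * \<bar>x\<bar>)))"
proof -
  let ?f = "\<lambda>x. exp (- (c * x)) * indicator {0..} x :: real"
  have "((\<lambda>x. - exp (- (c * x)) / c) \<longlongrightarrow> 0) at_top"
  proof -
    have "filterlim (\<lambda>x. c * x) at_top at_top"
      by (rule filterlim_tendsto_pos_mult_at_top[OF tendsto_const c filterlim_ident])
    then have "((\<lambda>x. exp (- (c * x))) \<longlongrightarrow> 0) at_top"
      by (intro filterlim_compose[OF exp_at_bot]) (simp add: filterlim_uminus_at_bot)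
    then show ?thesis using tendsto_divide[OF tendsto_minus, of _ 0 at_top "\<lambda>x. c" c] c by simp
  qed
  then have "(\<integral>\<^sup>+x. ennreal (exp (- (c * x))) * indicator {0..} x \<partial>lborel) = 0 - - exp (- (c * 0)) / c"
    using c by (intro nn_integral_FTC_atLeast) (auto intro!: derivative_eq_intros)
  moreover have "ennreal (norm (?f x)) = ennreal (exp (- (c * x))) * indicator {0..} x" for x
    by (auto simp: indicator_def)
  ultimately have f: "integrable lborel ?f"
    by (intro integrableI_bounded) auto
  then have "integrable lborel (\<lambda>x. ?f (0 + -1 * x))"
    by (rule lborel_integrable_real_affine) simp
  with f have "integrable lborel (\<lambda>x. ?f x + ?f (0 + -1 * x))"
    by (rule Bochner_Integration.integrable_add)
  then show ?thesis
    by (rule Bochner_Integration.integrable_bound) (auto intro!: AE_I2 simp: indicator_def)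
qed

text \<open>A polynomial is dominated by half of the exponential decay, by one term of the series of
  \<open>exp\<close>.\<close>

lemma integrable_poly_exp_bound:
  fixes f :: "real \<Rightarrow> real"
  assumes m: "f \<in> borel_measurable borel" and c: "0 < c"
    and b: "\<And>x. \<bar>f x\<bar> \<le> C * (1 + \<bar>x\<bar>) ^ n * exp (- (c * \<bar>x\<bar>))"
  shows "integrable lborel f"
proof (rule Bochner_Integration.integrable_bound)
  define K where "K = C * (fact n * (2 / c) ^ n * exp (c / 2))"
  show "integrable lborel (\<lambda>x::real. K * exp (- (c / 2 * \<bar>x\<bar>)))"
    using c by (intro integrable_mult_right integrable_exp_abs) auto
  have C: "0 \<le> C" using b[of 0] by simp
  show "AE x in lborel. norm (f x) \<le> norm (K * exp (- (c / 2 * \<bar>x\<bar>)))"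
  proof (rule AE_I2)
    fix x :: real
    have "(c / 2 * (1 + \<bar>x\<bar>)) ^ n / fact n \<le> exp (c / 2 * (1 + \<bar>x\<bar>))"
      using c by (intro power_div_fact_le_exp) auto
    then have "(c / 2) ^ n * (1 + \<bar>x\<bar>) ^ n \<le> fact n * exp (c / 2 * (1 + \<bar>x\<bar>))"
      by (simp only: pos_divide_le_eq[OF fact_gt_zero] power_mult_distrib mult.commute)
    then have "(2 / c) ^ n * ((c / 2) ^ n * (1 + \<bar>x\<bar>) ^ n)
        \<le> (2 / c) ^ n * (fact n * exp (c / 2 * (1 + \<bar>x\<bar>)))"
      using c by (intro mult_left_mono) auto
    moreover have "(2 / c) ^ n * ((c / 2) ^ n * (1 + \<bar>x\<bar>) ^ n) = (1 + \<bar>x\<bar>) ^ n"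
      using c by (simp only: power_mult_distrib[symmetric] mult.assoc[symmetric]) simp
    ultimately have "(1 + \<bar>x\<bar>) ^ n \<le> (2 / c) ^ n * (fact n * exp (c / 2 * (1 + \<bar>x\<bar>)))"
      by (simp only:)
    then have "C * (1 + \<bar>x\<bar>) ^ n * exp (- (c * \<bar>x\<bar>))
        \<le> C * ((2 / c) ^ n * (fact n * exp (c / 2 * (1 + \<bar>x\<bar>)))) * exp (- (c * \<bar>x\<bar>))"
      using C by (intro mult_right_mono mult_left_mono) auto
    also have "\<dots> = C * ((2 / c) ^ n * (fact n * (exp (c / 2 * (1 + \<bar>x\<bar>)) * exp (- (c * \<bar>x\<bar>)))))"
      by (simp only: mult_ac)
    also have "exp (c / 2 * (1 + \<bar>x\<bar>)) * exp (- (c * \<bar>x\<bar>)) = exp (c / 2) * exp (- (c / 2 * \<bar>x\<bar>))"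
      unfolding exp_add[symmetric] by (simp add: field_simps)
    finally have "\<bar>f x\<bar> \<le> K * exp (- (c / 2 * \<bar>x\<bar>))"
      using b[of x] unfolding K_def by (simp only: mult_ac)
    then show "norm (f x) \<le> norm (K * exp (- (c / 2 * \<bar>x\<bar>)))" by simp
  qed
qed (use m in simp)

text \<open>Powers of the positive part provide cutoffs that are differentiable to the needed order and
  explicit enough to be estimated.\<close>

lemma pos_part_power_DERIV:
  "((\<lambda>x::real. max 0 x ^ (n + 2)) has_real_derivative real (n + 2) * max 0 x ^ (n + 1)) (at x)"
proof -
  consider "x < 0" | "x = 0" | "0 < x" by linarith
  then show ?thesis
  proof cases
    case 1
    have "((\<lambda>x::real. max 0 x ^ (n + 2)) has_real_derivative 0) (at x)"
      by (rule has_field_derivative_transform_within_open[OF DERIV_const, of "{..<0}" _ 0])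
        (use 1 in auto)
    then show ?thesis using 1 by simp
  next
    case 2
    have "((\<lambda>h::real. max 0 h ^ (n + 2) / h) \<longlongrightarrow> 0) (at 0)"
    proof (rule Lim_null_comparison)
      have "norm (max 0 h ^ (n + 2) / h) \<le> \<bar>h\<bar> ^ (n + 1)" if "h \<noteq> 0" for h :: real
      proof -
        have "max 0 h ^ (n + 2) \<le> \<bar>h\<bar> ^ (n + 2)" by (intro power_mono) auto
        then have "max 0 h ^ (n + 2) / \<bar>h\<bar> \<le> \<bar>h\<bar> ^ (n + 2) / \<bar>h\<bar>"
          by (rule divide_right_mono) simp
        then show ?thesis using that by (simp add: abs_divide)
      qed
      then show "\<forall>\<^sub>F h in at (0::real). norm (max 0 h ^ (n + 2) / h) \<le> \<bar>h\<bar> ^ (n + 1)"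
        by (simp add: eventually_at_filter)
      have "((\<lambda>h::real. \<bar>h\<bar> ^ (n + 1)) \<longlongrightarrow> \<bar>0\<bar> ^ (n + 1)) (at 0)"
        by (intro tendsto_intros)
      then show "((\<lambda>h::real. \<bar>h\<bar> ^ (n + 1)) \<longlongrightarrow> 0) (at 0)" by simp
    qed
    then show ?thesis using 2 by (simp add: DERIV_def)
  next
    case 3
    have "((\<lambda>x::real. x ^ (n + 2)) has_real_derivative real (n + 2) * x ^ (n + 1)) (at x)"
      using DERIV_pow[of "n + 2" x UNIV] by simp
    then have "((\<lambda>x::real. max 0 x ^ (n + 2)) has_real_derivative real (n + 2) * x ^ (n + 1)) (at x)"
      by (rule has_field_derivative_transform_within_open[of _ _ _ "{0<..}"])
        (use 3 in auto)
    then show ?thesis using 3 by simp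
  qed
qed

text \<open>Linear growth keeps the sublevel sets of the energy bounded and the Gibbs weight integrable together
  with all its moments.\<close>

locale confining =
  fixes W :: "real \<Rightarrow> real" and lam k0 :: real
  assumes smooth_W: "smooth W" and lam_pos: "0 < lam" and W_ge: "\<And>q. \<bar>q\<bar> - k0 \<le> W q"
begin

definition mu :: "real \<times> real \<Rightarrow> real" where
  "mu z = exp (- (W (fst z) / lam)) * exp (- ((snd z)\<^sup>2 / (2 * lam)))"

definition H :: "real \<times> real \<Rightarrow> real" where
  "H z = (snd z)\<^sup>2 / 2 + W (fst z) + k0"

text \<open>A function of the energy is annihilated by the Hamiltonian part of the generator, see
  \<open>cutoff_transport\<close>. The cube is twice continuously differentiable.\<close>

definition cutoff :: "real \<Rightarrow> real \<times> real \<Rightarrow> real" where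
  "cutoff R z = max 0 (1 - H z / R) ^ 3"

definition cutoff_p :: "real \<Rightarrow> real \<times> real \<Rightarrow> real" where
  "cutoff_p R z = - 3 * max 0 (1 - H z / R) ^ 2 * snd z / R"

definition cutoff_q :: "real \<Rightarrow> real \<times> real \<Rightarrow> real" where
  "cutoff_q R z = - 3 * max 0 (1 - H z / R) ^ 2 * deriv W (fst z) / R"

definition cutoff_pp :: "real \<Rightarrow> real \<times> real \<Rightarrow> real" where
  "cutoff_pp R z = 6 * max 0 (1 - H z / R) * (snd z)\<^sup>2 / R\<^sup>2 - 3 * max 0 (1 - H z / R) ^ 2 / R"

lemma mu_pos: "0 < mu z"
  by (simp add: mu_def)

lemma W_DERIV: "(W has_real_derivative deriv W q) (at q)"
  by (rule smooth_DERIV[OF smooth_W])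

lemma continuous_fst_comp: "smooth f \<Longrightarrow> continuous_on UNIV (\<lambda>z :: real \<times> real. f (fst z))"
  by (rule continuous_on_compose2[OF smooth_continuous[of f UNIV]]) (auto intro!: continuous_intros)

lemma continuous_mu: "continuous_on UNIV mu"
  unfolding mu_def by (intro continuous_intros continuous_fst_comp smooth_W) (use lam_pos in auto)

lemma mu_DERIV_q: "((\<lambda>q. mu (q, p)) has_real_derivative - (deriv W q * mu (q, p) / lam)) (at q)"
  unfolding mu_def using W_DERIV lam_pos
  by (auto intro!: derivative_eq_intros simp: field_simps)

lemma mu_DERIV_p: "((\<lambda>p. mu (q, p)) has_real_derivative - (p * mu (q, p) / lam)) (at p)"
  unfolding mu_def using lam_pos
  by (auto intro!: derivative_eq_intros simp: field_simps)

lemma H_ge: "(snd z)\<^sup>2 / 2 \<le> H z" "\<bar>fst z\<bar> \<le> H z" "0 \<le> H z"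
proof -
  show a: "(snd z)\<^sup>2 / 2 \<le> H z" "\<bar>fst z\<bar> \<le> H z"
    using W_ge[of "fst z"] zero_le_power2[of "snd z"] unfolding H_def by linarith+
  then show "0 \<le> H z" by linarith
qed

lemma continuous_H: "continuous_on UNIV H"
  unfolding H_def by (intro continuous_intros continuous_fst_comp smooth_W) auto

lemma continuous_cutoff:
  assumes "0 < R"
  shows "continuous_on UNIV (cutoff R)" "continuous_on UNIV (cutoff_q R)"
    "continuous_on UNIV (cutoff_p R)" "continuous_on UNIV (cutoff_pp R)"
  unfolding cutoff_def cutoff_q_def cutoff_p_def cutoff_pp_def using assms
  by (auto intro!: continuous_intros continuous_H continuous_fst_comp smooth_deriv smooth_W)

lemma H_DERIV_q: "((\<lambda>q. 1 - H (q, p) / R) has_real_derivative - (deriv W q / R)) (at q)"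
  unfolding H_def using W_DERIV
  by (cases "R = 0") (auto intro!: derivative_eq_intros simp: field_simps)

lemma H_DERIV_p: "((\<lambda>p. 1 - H (q, p) / R) has_real_derivative - (p / R)) (at p)"
  unfolding H_def
  by (cases "R = 0") (auto intro!: derivative_eq_intros simp: field_simps)

lemma cutoff_DERIV_q: "((\<lambda>q. cutoff R (q, p)) has_real_derivative cutoff_q R (q, p)) (at q)"
  using DERIV_chain2[OF pos_part_power_DERIV[of 1] H_DERIV_q]
  unfolding cutoff_def cutoff_q_def by (simp add: numeral_3_eq_3 power2_eq_square)

lemma cutoff_DERIV_p: "((\<lambda>p. cutoff R (q, p)) has_real_derivative cutoff_p R (q, p)) (at p)"
  using DERIV_chain2[OF pos_part_power_DERIV[of 1] H_DERIV_p]
  unfolding cutoff_def cutoff_p_def by (simp add: numeral_3_eq_3 power2_eq_square)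

lemma cutoff_DERIV_pp: "((\<lambda>p. cutoff_p R (q, p)) has_real_derivative cutoff_pp R (q, p)) (at p)"
proof -
  have "((\<lambda>p. max 0 (1 - H (q, p) / R) ^ 2) has_real_derivative
     2 * max 0 (1 - H (q, p) / R) * - (p / R)) (at p)"
    using DERIV_chain2[OF pos_part_power_DERIV[of 0] H_DERIV_p] by (simp add: numeral_2_eq_2)
  from DERIV_mult[OF DERIV_cmult[OF this, of "- 3"] DERIV_cdivide[OF DERIV_ident, of R]]
  have "((\<lambda>p. - 3 * max 0 (1 - H (q, p) / R) ^ 2 * (p / R)) has_real_derivative
      cutoff_pp R (q, p)) (at p)"
    by (rule DERIV_cong) (simp add: cutoff_pp_def power2_eq_square)
  then show ?thesis by (simp add: cutoff_p_def)
qed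

lemma cutoff_nonneg: "0 \<le> cutoff R z"
  by (simp add: cutoff_def)

lemma cutoff_transport: "snd z * cutoff_q R z = deriv W (fst z) * cutoff_p R z"
  by (simp add: cutoff_q_def cutoff_p_def)

lemma cutoff_supp:
  assumes R: "0 < R" shows "supp_box (cutoff R) (R + 1)" "supp_box (cutoff_p R) (R + 1)"
proof -
  have *: "max 0 (1 - H z / R) = 0" if "R + 1 < \<bar>fst z\<bar> \<or> R + 1 < \<bar>snd z\<bar>" for z
  proof -
    have "R \<le> H z"
    proof (cases "R + 1 < \<bar>fst z\<bar>")
      case True then show ?thesis using H_ge(2)[of z] by linarith
    next
      case False
      then have "(R + 1)\<^sup>2 \<le> \<bar>snd z\<bar>\<^sup>2" using that R by (intro power_mono) auto
      then have "R \<le> (snd z)\<^sup>2 / 2" using R by (simp add: power2_sum) (use zero_le_power2[of R] in linarith)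
      then show ?thesis using H_ge(1)[of z] by linarith
    qed
    then show ?thesis using R by (simp add: field_simps max_def)
  qed
  show "supp_box (cutoff R) (R + 1)" "supp_box (cutoff_p R) (R + 1)"
    unfolding supp_box_def cutoff_def cutoff_p_def using * by auto
qed

text \<open>On the support \<open>p\<^sup>2 \<le> 2 R\<close>, so both terms of \<open>lam \<partial>\<^sub>p\<^sup>2 - p \<partial>\<^sub>p\<close> applied to the cutoff gain a
  factor \<open>1 / R\<close>, up to a moment that \<open>mu\<close> integrates.\<close>

lemma cutoff_generator_bound:
  assumes R: "0 < R"
  shows "\<bar>lam * cutoff_pp R z - snd z * cutoff_p R z\<bar> \<le> (15 * lam + 3 * (snd z)\<^sup>2) / R"
proof -
  define s where "s = max 0 (1 - H z / R)"
  define p where "p = snd z"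
  have s: "0 \<le> s" "s \<le> 1" using H_ge(3)[of z] R by (auto simp: s_def)
  have "s * p\<^sup>2 \<le> 2 * R"
  proof (cases "s = 0")
    case False
    then have "H z \<le> R" using R by (auto simp: s_def max_def field_simps split: if_splits)
    then have "p\<^sup>2 \<le> 2 * R" using H_ge(1)[of z] by (simp add: p_def)
    then show ?thesis using s mult_mono[of s 1 "p\<^sup>2" "2 * R"] R by simp
  qed (use R in simp)
  then have a: "6 * s * p\<^sup>2 / R\<^sup>2 \<le> 12 / R" using R by (simp add: field_simps power2_eq_square)
  have s2: "s\<^sup>2 \<le> 1" using s by (simp add: power_le_one)
  then have b: "3 * s\<^sup>2 / R \<le> 3 / R" using R by (simp add: field_simps)
  have c: "3 * s\<^sup>2 * p\<^sup>2 / R \<le> 3 * p\<^sup>2 / R"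
    using R s2 mult_right_mono[OF s2, of "p\<^sup>2"] by (simp add: field_simps)
  have nn: "0 \<le> 6 * s * p\<^sup>2 / R\<^sup>2" "0 \<le> 3 * s\<^sup>2 / R" "0 \<le> 3 * s\<^sup>2 * p\<^sup>2 / R" using s R by auto
  have "\<bar>6 * s * p\<^sup>2 / R\<^sup>2 - 3 * s\<^sup>2 / R\<bar> \<le> 15 / R" using a b nn by (simp add: abs_le_iff)
  then have "lam * \<bar>6 * s * p\<^sup>2 / R\<^sup>2 - 3 * s\<^sup>2 / R\<bar> \<le> lam * (15 / R)"
    using lam_pos by (intro mult_left_mono) auto
  moreover have "lam * cutoff_pp R z - snd z * cutoff_p R z
      = lam * (6 * s * p\<^sup>2 / R\<^sup>2 - 3 * s\<^sup>2 / R) + 3 * s\<^sup>2 * p\<^sup>2 / R"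
    by (simp add: cutoff_pp_def cutoff_p_def s_def p_def power2_eq_square)
  moreover have "\<bar>lam * (6 * s * p\<^sup>2 / R\<^sup>2 - 3 * s\<^sup>2 / R) + 3 * s\<^sup>2 * p\<^sup>2 / R\<bar>
      \<le> lam * \<bar>6 * s * p\<^sup>2 / R\<^sup>2 - 3 * s\<^sup>2 / R\<bar> + 3 * s\<^sup>2 * p\<^sup>2 / R"
    using abs_triangle_ineq[of "lam * (6 * s * p\<^sup>2 / R\<^sup>2 - 3 * s\<^sup>2 / R)" "3 * s\<^sup>2 * p\<^sup>2 / R"] lam_pos nn(3)
    by (simp only: abs_mult abs_of_pos abs_of_nonneg)
  ultimately have "\<bar>lam * cutoff_pp R z - snd z * cutoff_p R z\<bar> \<le> lam * (15 / R) + 3 * p\<^sup>2 / R"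
    using c by (smt (verit))
  then show ?thesis by (simp add: p_def add_divide_distrib mult.commute)
qed

lemma integrable_gauss: "integrable lborel (\<lambda>p. \<bar>p\<bar> ^ n * exp (- (p\<^sup>2 / (2 * lam))))"
proof (rule integrable_poly_exp_bound[where c=1 and n=n and C="exp (lam / 2)"])
  fix p :: real
  have "0 \<le> (\<bar>p\<bar> - lam)\<^sup>2 / (2 * lam)" using lam_pos by simp
  also have "\<dots> = p\<^sup>2 / (2 * lam) - \<bar>p\<bar> + lam / 2"
    using lam_pos by (simp add: power2_diff field_simps power2_eq_square)
  finally have "exp (- (p\<^sup>2 / (2 * lam))) \<le> exp (lam / 2) * exp (- \<bar>p\<bar>)"
    unfolding exp_add[symmetric] by simp
  moreover have "\<bar>p\<bar> ^ n \<le> (1 + \<bar>p\<bar>) ^ n" by (intro power_mono) auto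
  ultimately have "\<bar>p\<bar> ^ n * exp (- (p\<^sup>2 / (2 * lam))) \<le> (1 + \<bar>p\<bar>) ^ n * (exp (lam / 2) * exp (- \<bar>p\<bar>))"
    by (intro mult_mono) auto
  then show "\<bar>\<bar>p\<bar> ^ n * exp (- (p\<^sup>2 / (2 * lam)))\<bar> \<le> exp (lam / 2) * (1 + \<bar>p\<bar>) ^ n * exp (- (1 * \<bar>p\<bar>))"
    by (simp add: abs_mult mult_ac)
qed auto

lemma integrable_weight: "integrable lborel (\<lambda>q. \<bar>q\<bar> ^ n * exp (- (W q / lam)))"
proof (rule integrable_poly_exp_bound[where c="1 / lam" and n=n and C="exp (k0 / lam)"])
  have [measurable]: "W \<in> borel_measurable borel"
    by (intro borel_measurable_continuous_onI smooth_continuous smooth_W)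
  show "(\<lambda>q. \<bar>q\<bar> ^ n * exp (- (W q / lam))) \<in> borel_measurable borel" by measurable
  fix q :: real
  have "- (W q / lam) \<le> k0 / lam + - (1 / lam * \<bar>q\<bar>)"
    using W_ge[of q] lam_pos by (simp add: field_simps)
  then have "exp (- (W q / lam)) \<le> exp (k0 / lam) * exp (- (1 / lam * \<bar>q\<bar>))"
    unfolding exp_add[symmetric] by simp
  moreover have "\<bar>q\<bar> ^ n \<le> (1 + \<bar>q\<bar>) ^ n" by (intro power_mono) auto
  ultimately have "\<bar>q\<bar> ^ n * exp (- (W q / lam)) \<le> (1 + \<bar>q\<bar>) ^ n * (exp (k0 / lam) * exp (- (1 / lam * \<bar>q\<bar>)))"
    by (intro mult_mono) auto
  then show "\<bar>\<bar>q\<bar> ^ n * exp (- (W q / lam))\<bar> \<le> exp (k0 / lam) * (1 + \<bar>q\<bar>) ^ n * exp (- (1 / lam * \<bar>q\<bar>))"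
    by (simp add: abs_mult mult_ac)
qed (use lam_pos in auto)

lemma integrable_mu_moment: "integrable lborel (\<lambda>z. \<bar>fst z\<bar> ^ n * \<bar>snd z\<bar> ^ m * mu z)"
  using tensor_integral(1)[OF integrable_weight[of n] integrable_gauss[of m]]
  by (simp add: mu_def mult_ac)

end

section \<open>The energy estimate\<close>

text \<open>Pointwise form of the energy estimate: the first bracket is the divergence that integrates to zero,
  and the mixed term \<open>D B\<close> is absorbed into half of the dissipation by Young's inequality. Here \<open>m\<close>, \<open>x\<close>, \<open>t\<close> and \<open>c\<close> stand for the values of \<open>mu\<close>, of the
  cutoff, of \<open>theta = mu / (mu + u)\<close> and of the \<open>p\<close>-derivative of the cutoff.\<close>

lemma energy_pointwise:
  fixes m :: real
  assumes m: "0 < m" and x: "0 \<le> x" and t: "0 < t" "t \<le> 1" and l: "0 < l"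
  shows "l * (x * t ^ 3 * D\<^sup>2 / m) \<le>
    (2 * l * x * t ^ 3 * D\<^sup>2 / m - x * t\<^sup>2 * A - m * t * L - 2 * t ^ 3 * D * x * B / m + t\<^sup>2 * c * B)
    + (x * \<bar>A\<bar> + \<bar>c\<bar> * \<bar>B\<bar> + x * B\<^sup>2 / (l * m) + m * \<bar>L\<bar>)"
proof -
  have t2: "t\<^sup>2 \<le> 1" and t3: "t ^ 3 \<le> 1" using t by (auto simp: power_le_one)
  have "x * t\<^sup>2 * A \<le> x * \<bar>A\<bar>"
  proof -
    have "x * t\<^sup>2 * A \<le> x * t\<^sup>2 * \<bar>A\<bar>" using x by (intro mult_left_mono) auto
    also have "\<dots> \<le> x * \<bar>A\<bar>" using x t2 mult_right_mono[OF t2, of "x * \<bar>A\<bar>"] by (simp add: mult_ac)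
    finally show ?thesis .
  qed
  moreover have "m * t * L \<le> m * \<bar>L\<bar>"
  proof -
    have "m * t * L \<le> m * t * \<bar>L\<bar>" using m t by (intro mult_left_mono) auto
    also have "\<dots> \<le> m * \<bar>L\<bar>" using m t mult_right_mono[of t 1 "m * \<bar>L\<bar>"] by (simp add: mult_ac)
    finally show ?thesis .
  qed
  moreover have "- (t\<^sup>2 * c * B) \<le> \<bar>c\<bar> * \<bar>B\<bar>"
  proof -
    have "- (t\<^sup>2 * c * B) \<le> t\<^sup>2 * \<bar>c * B\<bar>"
      using mult_left_mono[of "- (c * B)" "\<bar>c * B\<bar>" "t\<^sup>2"] by (simp add: mult_ac)
    also have "\<dots> \<le> \<bar>c * B\<bar>" using mult_right_mono[OF t2, of "\<bar>c * B\<bar>"] by simp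
    finally show ?thesis by (simp add: abs_mult)
  qed
  moreover have "2 * t ^ 3 * D * x * B / m \<le> l * (x * t ^ 3 * D\<^sup>2 / m) + x * B\<^sup>2 / (l * m)"
  proof -
    have "0 \<le> (x * t ^ 3 / m) * ((l * D - B)\<^sup>2 / l)" using x t l m by simp
    also have "\<dots> = l * (x * t ^ 3 * D\<^sup>2 / m) - 2 * t ^ 3 * D * x * B / m + t ^ 3 * (x * B\<^sup>2 / (l * m))"
      using m l by (simp add: power2_diff field_simps) (simp add: power2_eq_square)
    also have "t ^ 3 * (x * B\<^sup>2 / (l * m)) \<le> x * B\<^sup>2 / (l * m)"
      using mult_right_mono[OF t3, of "x * B\<^sup>2 / (l * m)"] x l m by simp
    finally show ?thesis by simp
  qed
  moreover have "2 * l * x * t ^ 3 * D\<^sup>2 / m = 2 * (l * (x * t ^ 3 * D\<^sup>2 / m))" by simp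
  ultimately show ?thesis by linarith
qed

lemma supp_box_mult: "supp_box f R \<Longrightarrow> supp_box (\<lambda>z. f z * g z) R"
  "supp_box g R \<Longrightarrow> supp_box (\<lambda>z. f z * g z) R"
  by (auto simp: supp_box_def)

lemma quotient_derivative_eq:
  fixes m :: real
  assumes "m \<noteq> 0"
  shows "(- (a * m / l) * (m + u) - m * (- (a * m / l) + v)) / ((m + u) * (m + u))
    = - ((m / (m + u))\<^sup>2 * (v + a * u / l) / m)"
proof -
  have "- (a * m / l) * (m + u) - m * (- (a * m / l) + v) = - (m * (v + a * u / l))"
    by (simp add: algebra_simps add_divide_distrib)
  moreover have "(m / y)\<^sup>2 * w / m = m * w / (y * y)" for y w
    using assms by (simp add: power2_eq_square)
  ultimately show ?thesis by simp
qed

context confining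
begin

text \<open>With \<open>theta = mu / (mu + u)\<close> and \<open>D = u\<^sub>p + p u / lam\<close>, so that \<open>\<partial>\<^sub>p (u / mu) = D / mu\<close>, the equation
  for \<open>u\<close> becomes one for \<open>theta\<close> in which the convexity of \<open>h \<mapsto> 1 / (1 + h)\<close> produces the
  dissipation \<open>theta\<^sup>3 D\<^sup>2 / mu\<close>. Because \<open>theta \<le> 1\<close>, the cutoff error is an integral of \<open>mu\<close>
  without \<open>u\<close>. The right-hand side enters only through \<open>A\<close> and through \<open>B\<close>, never through \<open>\<partial>\<^sub>p B\<close>.\<close>

lemma energy_inequality:
  fixes u u_q u_p u_pp A B B_p :: "real \<times> real \<Rightarrow> real"
  assumes R: "0 < R"
    and uq: "\<And>q p. ((\<lambda>q. u (q, p)) has_real_derivative u_q (q, p)) (at q)"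
    and up: "\<And>q p. ((\<lambda>p. u (q, p)) has_real_derivative u_p (q, p)) (at p)"
    and upp: "\<And>q p. ((\<lambda>p. u_p (q, p)) has_real_derivative u_pp (q, p)) (at p)"
    and Bp: "\<And>q p. ((\<lambda>p. B (q, p)) has_real_derivative B_p (q, p)) (at p)"
    and c: "continuous_on UNIV u" "continuous_on UNIV u_q" "continuous_on UNIV u_p"
      "continuous_on UNIV u_pp" "continuous_on UNIV A" "continuous_on UNIV B" "continuous_on UNIV B_p"
    and u0: "\<And>z. 0 \<le> u z"
    and eq: "\<And>z. - (snd z * u_q z) + (deriv W (fst z) + snd z) * u_p z + u z + lam * u_pp z = A z + B_p z"
  defines "T \<equiv> \<lambda>z. cutoff R z * (mu z / (mu z + u z)) ^ 3 * (u_p z + snd z * u z / lam)\<^sup>2 / mu z"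
  shows "integrable lborel T"
    and "lam * (\<integral>z. T z \<partial>lborel) \<le>
      (\<integral>z. cutoff R z * \<bar>A z\<bar> + \<bar>cutoff_p R z\<bar> * \<bar>B z\<bar> + cutoff R z * (B z)\<^sup>2 / (lam * mu z) \<partial>lborel)
      + (\<integral>z. (15 * lam + 3 * (snd z)\<^sup>2) * mu z \<partial>lborel) / R"
proof -
  define th where "th z = mu z / (mu z + u z)" for z
  define D where "D z = u_p z + snd z * u z / lam" for z
  define D_p where "D_p z = u_pp z + u z / lam + snd z * u_p z / lam" for z
  define th_p where "th_p z = - ((th z)\<^sup>2 * D z / mu z)" for z
  define th_q where "th_q z = - ((th z)\<^sup>2 * (u_q z + deriv W (fst z) * u z / lam) / mu z)" for z
  have mu0: "mu z \<noteq> 0" for z using mu_pos[of z] by simp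
  have y: "0 < mu z + u z" for z using mu_pos[of z] u0[of z] by simp
  then have y0: "mu z + u z \<noteq> 0" for z by (metis less_irrefl)
  have lam0: "lam \<noteq> 0" using lam_pos by simp
  have th: "0 < th z" "th z \<le> 1" for z
    using mu_pos[of z] u0[of z] by (auto simp: th_def)
  have thq: "((\<lambda>q. th (q, p)) has_real_derivative th_q (q, p)) (at q)" for q p
  proof -
    have "((\<lambda>q. th (q, p)) has_real_derivative
        (- (deriv W q * mu (q, p) / lam) * (mu (q, p) + u (q, p))
          - mu (q, p) * (- (deriv W q * mu (q, p) / lam) + u_q (q, p)))
        / ((mu (q, p) + u (q, p)) * (mu (q, p) + u (q, p)))) (at q)"
      unfolding th_def by (intro DERIV_divide DERIV_add mu_DERIV_q uq y0)
    then show ?thesis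
      unfolding quotient_derivative_eq[OF mu0] by (simp add: th_q_def th_def)
  qed
  have thp: "((\<lambda>p. th (q, p)) has_real_derivative th_p (q, p)) (at p)" for q p
  proof -
    have "((\<lambda>p. th (q, p)) has_real_derivative
        (- (p * mu (q, p) / lam) * (mu (q, p) + u (q, p))
          - mu (q, p) * (- (p * mu (q, p) / lam) + u_p (q, p)))
        / ((mu (q, p) + u (q, p)) * (mu (q, p) + u (q, p)))) (at p)"
      unfolding th_def by (intro DERIV_divide DERIV_add mu_DERIV_p up y0)
    then show ?thesis
      unfolding quotient_derivative_eq[OF mu0] by (simp add: th_p_def th_def D_def)
  qed
  have Dp: "((\<lambda>p. D (q, p)) has_real_derivative D_p (q, p)) (at p)" for q p
    unfolding D_def D_p_def using lam0 up[of q p] upp[of q p]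
    by (auto intro!: derivative_eq_intros simp: field_simps)
  note cc = continuous_cutoff[OF R] continuous_mu c continuous_fst_comp[OF smooth_deriv[OF smooth_W]]
  have cth: "continuous_on UNIV th" unfolding th_def
    by (intro continuous_intros cc) (use y0 in auto)
  have cD: "continuous_on UNIV D" unfolding D_def
    by (intro continuous_intros cc) (use lam0 in auto)
  have cDp: "continuous_on UNIV D_p" unfolding D_p_def
    by (intro continuous_intros cc) (use lam0 in auto)
  have cthp: "continuous_on UNIV th_p" unfolding th_p_def
    by (intro continuous_intros cc cth cD) (use mu0 in auto)
  have cthq: "continuous_on UNIV th_q" unfolding th_q_def
    by (intro continuous_intros cc cth cD) (use mu0 lam0 in auto)

  \<comment> \<open>The flux whose divergence is the energy balance; its last term moves the derivative off \<open>B\<close>.\<close>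
  define F1 where "F1 z = - (snd z * (cutoff R z * (mu z * th z)))" for z
  define F2 where "F2 z = deriv W (fst z) * (cutoff R z * (mu z * th z))
    - lam * (cutoff R z * ((th z)\<^sup>2 * D z)) - lam * (mu z * th z * cutoff_p R z)
    + (th z)\<^sup>2 * (cutoff R z * B z)" for z
  define G1 where "G1 z = - (snd z * (cutoff_q R z * (mu z * th z)
    + (- (deriv W (fst z) * mu z / lam) * th z + th_q z * mu z) * cutoff R z))" for z
  define G2 where "G2 z = deriv W (fst z) * (cutoff_p R z * (mu z * th z)
      + (- (snd z * mu z / lam) * th z + th_p z * mu z) * cutoff R z)
    - lam * (cutoff_p R z * ((th z)\<^sup>2 * D z) + (2 * th z * th_p z * D z + D_p z * (th z)\<^sup>2) * cutoff R z)
    - lam * ((- (snd z * mu z / lam) * th z + th_p z * mu z) * cutoff_p R z + cutoff_pp R z * (mu z * th z))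
    + (2 * th z * th_p z * (cutoff R z * B z) + (cutoff_p R z * B z + B_p z * cutoff R z) * (th z)\<^sup>2)" for z
  have d1: "((\<lambda>q. F1 (q, p)) has_real_derivative G1 (q, p)) (at q)" for q p
    unfolding F1_def G1_def fst_conv snd_conv
    by (intro DERIV_minus DERIV_cmult DERIV_mult cutoff_DERIV_q mu_DERIV_q thq)
  have th2: "((\<lambda>p. (th (q, p))\<^sup>2) has_real_derivative 2 * th (q, p) * th_p (q, p)) (at p)" for q p
    using DERIV_power[OF thp[of q p], of 2] by (simp add: mult_ac)
  have d2: "((\<lambda>p. F2 (q, p)) has_real_derivative G2 (q, p)) (at p)" for q p
    unfolding F2_def G2_def fst_conv snd_conv
    by (intro DERIV_add DERIV_diff DERIV_cmult DERIV_mult cutoff_DERIV_p cutoff_DERIV_pp mu_DERIV_p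
        thp th2 Dp Bp)
  have s1: "supp_box F1 (R + 1)" and s2: "supp_box F2 (R + 1)"
    using cutoff_supp[OF R] unfolding F1_def F2_def supp_box_def by auto
  have c1: "continuous_on UNIV G1" unfolding G1_def
    by (intro continuous_intros cc cth cthq) (use lam0 in auto)
  have c2: "continuous_on UNIV G2" unfolding G2_def
    by (intro continuous_intros cc cth cthp cD cDp) (use lam0 in auto)
  have iG: "integrable lborel (\<lambda>z. G1 z + G2 z)" "(\<integral>z. G1 z + G2 z \<partial>lborel) = 0"
    using integral_partial_q[OF d1 c1 s1] integral_partial_p[OF d2 c2 s2] by auto

  define L where "L z = lam * cutoff_pp R z - snd z * cutoff_p R z" for z
  have G_eq: "G1 z + G2 z = 2 * lam * cutoff R z * th z ^ 3 * (D z)\<^sup>2 / mu z - cutoff R z * (th z)\<^sup>2 * A z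
      - mu z * th z * L z - 2 * th z ^ 3 * D z * cutoff R z * B z / mu z + (th z)\<^sup>2 * cutoff_p R z * B z" for z
  proof -
    have A: "A z = - (snd z * u_q z) + (deriv W (fst z) + snd z) * u_p z + u z + lam * u_pp z - B_p z"
      using eq[of z] by simp
    have thmu: "th_p z * mu z = - ((th z)\<^sup>2 * D z)"
      "th_q z * mu z = - ((th z)\<^sup>2 * (u_q z + deriv W (fst z) * u z / lam))"
      using mu0[of z] by (simp_all add: th_p_def th_q_def)
    have e1: "G1 z = - snd z * cutoff_q R z * mu z * th z + snd z * deriv W (fst z) * mu z * th z * cutoff R z / lam
      + cutoff R z * (th z)\<^sup>2 * (snd z * u_q z + deriv W (fst z) * snd z * u z / lam)"
      unfolding G1_def thmu by (simp add: algebra_simps)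
    have e2: "G2 z = deriv W (fst z) * cutoff_p R z * mu z * th z
      - snd z * deriv W (fst z) * mu z * th z * cutoff R z / lam
      - cutoff R z * (th z)\<^sup>2 * deriv W (fst z) * D z
      - 2 * lam * cutoff R z * th z * th_p z * D z - lam * D_p z * (th z)\<^sup>2 * cutoff R z
      + snd z * mu z * th z * cutoff_p R z - lam * cutoff_pp R z * mu z * th z
      + 2 * th z * th_p z * cutoff R z * B z + cutoff_p R z * B z * (th z)\<^sup>2 + B_p z * cutoff R z * (th z)\<^sup>2"
      unfolding G2_def thmu using lam0 by (simp add: algebra_simps)
    have e3: "- snd z * cutoff_q R z * mu z * th z = - (deriv W (fst z) * cutoff_p R z * mu z * th z)"
      using cutoff_transport[of z R] by (simp add: mult.assoc)
    have e4: "lam * D_p z = lam * u_pp z + u z + snd z * u_p z"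
      unfolding D_p_def using lam0 by (simp add: field_simps)
    have e5: "deriv W (fst z) * D z = deriv W (fst z) * u_p z + deriv W (fst z) * snd z * u z / lam"
      unfolding D_def by (simp add: algebra_simps)
    have e6: "2 * lam * cutoff R z * th z * th_p z * D z = - (2 * lam * cutoff R z * th z ^ 3 * (D z)\<^sup>2 / mu z)"
      "2 * th z * th_p z * cutoff R z * B z = - (2 * th z ^ 3 * D z * cutoff R z * B z / mu z)"
      unfolding th_p_def by (simp_all add: power2_eq_square power3_eq_cube)
    have e7: "cutoff R z * (th z)\<^sup>2 * deriv W (fst z) * D z
        = cutoff R z * (th z)\<^sup>2 * (deriv W (fst z) * u_p z + deriv W (fst z) * snd z * u z / lam)"
      unfolding e5[symmetric] by simp
    have e8: "lam * D_p z * (th z)\<^sup>2 * cutoff R z = (lam * u_pp z + u z + snd z * u_p z) * (th z)\<^sup>2 * cutoff R z"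
      unfolding e4 by simp
    show ?thesis
      unfolding e1 e2 e3 e6 e7 e8 A L_def by (simp add: algebra_simps)
  qed

  define N where "N z = cutoff R z * \<bar>A z\<bar> + \<bar>cutoff_p R z\<bar> * \<bar>B z\<bar> + cutoff R z * (B z)\<^sup>2 / (lam * mu z)" for z
  have T_eq: "T z = cutoff R z * th z ^ 3 * (D z)\<^sup>2 / mu z" for z
    by (simp add: T_def th_def D_def)
  have cT: "continuous_on UNIV T"
    unfolding T_eq[abs_def] by (intro continuous_intros cc cth cD) (use mu0 in auto)
  have sT: "supp_box T (R + 1)" and sN: "supp_box N (R + 1)"
    using cutoff_supp[OF R] unfolding T_eq[abs_def] N_def supp_box_def by auto
  have cN: "continuous_on UNIV N"
    unfolding N_def by (intro continuous_intros cc) (use mu0 lam0 in auto)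
  show iT: "integrable lborel T" by (rule integrable_continuous_supp_box[OF cT sT])
  have iN: "integrable lborel N" by (rule integrable_continuous_supp_box[OF cN sN])
  have iE: "integrable lborel (\<lambda>z. (15 * lam + 3 * (snd z)\<^sup>2) * mu z)"
    using Bochner_Integration.integrable_add[OF integrable_mult_right[OF integrable_mu_moment[of 0 0], of "15 * lam"]
        integrable_mult_right[OF integrable_mu_moment[of 0 2], of 3]]
    by (simp add: algebra_simps)
  have "lam * (\<integral>z. T z \<partial>lborel) = (\<integral>z. lam * T z \<partial>lborel)" by simp
  also have "\<dots> \<le> (\<integral>z. (G1 z + G2 z) + (N z + (15 * lam + 3 * (snd z)\<^sup>2) * mu z / R) \<partial>lborel)"
  proof (rule integral_mono)
    show "integrable lborel (\<lambda>z. lam * T z)" using iT by simp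
    show "integrable lborel (\<lambda>z. (G1 z + G2 z) + (N z + (15 * lam + 3 * (snd z)\<^sup>2) * mu z / R))"
      by (intro Bochner_Integration.integrable_add iG iN integrable_divide iE)
    fix z
    have "lam * T z \<le> (G1 z + G2 z) + (cutoff R z * \<bar>A z\<bar> + \<bar>cutoff_p R z\<bar> * \<bar>B z\<bar>
        + cutoff R z * (B z)\<^sup>2 / (lam * mu z) + mu z * \<bar>L z\<bar>)"
      unfolding G_eq T_eq by (rule energy_pointwise[OF mu_pos cutoff_nonneg th lam_pos])
    moreover have "mu z * \<bar>L z\<bar> \<le> mu z * ((15 * lam + 3 * (snd z)\<^sup>2) / R)"
      unfolding L_def using cutoff_generator_bound[OF R, of z] mu_pos[of z] by (intro mult_left_mono) auto
    ultimately show "lam * T z \<le> (G1 z + G2 z) + (N z + (15 * lam + 3 * (snd z)\<^sup>2) * mu z / R)"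
      unfolding N_def by (simp add: mult_ac)
  qed
  also have "\<dots> = (\<integral>z. G1 z + G2 z \<partial>lborel) + ((\<integral>z. N z \<partial>lborel) + (\<integral>z. (15 * lam + 3 * (snd z)\<^sup>2) * mu z / R \<partial>lborel))"
    by (subst Bochner_Integration.integral_add, rule iG, intro Bochner_Integration.integrable_add iN integrable_divide iE,
        subst Bochner_Integration.integral_add, rule iN, rule integrable_divide[OF iE], rule refl)
  also have "\<dots> = (\<integral>z. N z \<partial>lborel) + (\<integral>z. (15 * lam + 3 * (snd z)\<^sup>2) * mu z \<partial>lborel) / R"
    using iG by simp
  finally show "lam * (\<integral>z. T z \<partial>lborel) \<le>
      (\<integral>z. cutoff R z * \<bar>A z\<bar> + \<bar>cutoff_p R z\<bar> * \<bar>B z\<bar> + cutoff R z * (B z)\<^sup>2 / (lam * mu z) \<partial>lborel)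
      + (\<integral>z. (15 * lam + 3 * (snd z)\<^sup>2) * mu z \<partial>lborel) / R"
    by (simp only: N_def)
qed

end

section \<open>Mollification\<close>

definition scaled :: "(real \<Rightarrow> real) \<Rightarrow> real \<Rightarrow> real \<Rightarrow> real" where
  "scaled f s x = f (x / s) / s"

lemma deriv_zero_outside:
  fixes f :: "real \<Rightarrow> real"
  assumes "\<And>x. x \<notin> {0<..<1} \<Longrightarrow> f x = 0" "x \<notin> {0..1}"
  shows "deriv f x = 0"
proof -
  have "(f has_real_derivative 0) (at x)"
  proof (cases "x < 0")
    case True
    then show ?thesis
      by (intro has_field_derivative_transform_within_open[OF DERIV_const, of "{..<0}" x 0 f])
        (auto simp: assms(1))
  next
    case False
    then show ?thesis using assms(2)
      by (intro has_field_derivative_transform_within_open[OF DERIV_const, of "{1<..}" x 0 f])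
        (auto simp: assms(1))
  qed
  then show ?thesis by (rule DERIV_imp_deriv)
qed

locale mollifier =
  fixes \<eta> :: "real \<Rightarrow> real" and K :: real
  assumes smooth_eta: "smooth \<eta>" and eta_nonneg: "\<And>x. 0 \<le> \<eta> x"
    and eta_zero: "\<And>x. x \<notin> {0<..<1} \<Longrightarrow> \<eta> x = 0"
    and eta_int: "has_bochner_integral lborel \<eta> 1"
    and eta_le: "\<And>x. \<eta> x \<le> K" and deta_le: "\<And>x. \<bar>deriv \<eta> x\<bar> \<le> K"
begin

lemma K_nonneg: "0 \<le> K"
  using eta_nonneg[of 0] eta_le[of 0] by linarith

lemma scaled_eq: "scaled \<eta> s = (\<lambda>x. 1 / s * \<eta> (1 / s * x + 0))"
  by (auto simp: scaled_def)

lemma smooth_scaled: "smooth (scaled \<eta> s)"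
  unfolding scaled_eq by (intro smooth_cmult smooth_affine smooth_eta)

lemma deriv_scaled: "deriv (scaled \<eta> s) = (\<lambda>x. deriv \<eta> (x / s) / s\<^sup>2)"
proof (cases "s = 0")
  case True then show ?thesis by (simp add: scaled_def[abs_def])
next
  case False
  show ?thesis
  proof (rule deriv_eqI)
    fix x
    have "((\<lambda>x. x / s) has_real_derivative 1 / s) (at x)"
      using False by (auto intro!: derivative_eq_intros)
    from DERIV_cdivide[OF DERIV_chain2[OF smooth_DERIV[OF smooth_eta] this], of s]
    show "(scaled \<eta> s has_real_derivative deriv \<eta> (x / s) / s\<^sup>2) (at x)"
      by (simp add: scaled_def[abs_def] power2_eq_square)
  qed
qed

lemma scaled_nonneg: "0 < s \<Longrightarrow> 0 \<le> scaled \<eta> s x"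
  by (simp add: scaled_def eta_nonneg)

lemma scaled_bound: "0 < s \<Longrightarrow> \<bar>scaled \<eta> s x\<bar> \<le> K / s * indicator {0..s} x"
  using eta_zero[of "x / s"] eta_le[of "x / s"] eta_nonneg[of "x / s"] K_nonneg
  by (auto simp: scaled_def indicator_def field_simps)

lemma deriv_scaled_bound: "0 < s \<Longrightarrow> \<bar>deriv (scaled \<eta> s) x\<bar> \<le> K / s\<^sup>2 * indicator {0..s} x"
  using deriv_zero_outside[OF eta_zero, where x="x / s"] deta_le[of "x / s"] K_nonneg
  by (auto simp: deriv_scaled indicator_def field_simps)

lemma scaled_zero: "0 < s \<Longrightarrow> x \<notin> {0..s} \<Longrightarrow> scaled \<eta> s x = 0"
  using scaled_bound[of s x] by simp

lemma scaled_supp: "0 < s \<Longrightarrow> s \<le> 1 \<Longrightarrow> supp_in (scaled \<eta> s) 1"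
proof -
  assume s: "0 < s" "s \<le> 1"
  have "scaled \<eta> s x = 0" if "1 < \<bar>x\<bar>" for x
  proof -
    have "x \<notin> {0..s}" using that s by auto
    then show ?thesis using scaled_bound[OF s(1), of x] by simp
  qed
  then show ?thesis by (simp add: supp_in_def)
qed

lemma scaled_shift_int:
  assumes "0 < s" shows "has_bochner_integral lborel (\<lambda>x. scaled \<eta> s (x - c)) 1"
proof -
  have "has_bochner_integral lborel (\<lambda>x. \<eta> (- c / s + 1 / s * x)) (1 /\<^sub>R \<bar>1 / s\<bar>)"
    using eta_int assms by (subst lborel_has_bochner_integral_real_affine_iff[symmetric]) auto
  then have "has_bochner_integral lborel (\<lambda>x. \<eta> (- c / s + 1 / s * x) / s) (1 /\<^sub>R \<bar>1 / s\<bar> / s)"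
    by (rule has_bochner_integral_divide)
  then show ?thesis using assms by (simp add: scaled_def diff_divide_distrib)
qed

end

lemma ex_mollifier: obtains \<eta> K where "mollifier \<eta> K" "\<And>x. x \<in> {0<..<1} \<Longrightarrow> 0 < \<eta> x"
proof -
  obtain \<eta> where e: "smooth \<eta>" "\<And>x. 0 \<le> \<eta> x" "\<And>x. x \<notin> {0<..<1} \<Longrightarrow> \<eta> x = 0"
    "\<And>x. x \<in> {0<..<1} \<Longrightarrow> 0 < \<eta> x" "has_bochner_integral lborel \<eta> 1"
    using ex_bump by blast
  have "\<eta> x = 0" if "1 < \<bar>x\<bar>" for x using that by (intro e(3)) auto
  then have s: "supp_in \<eta> 1" by (simp add: supp_in_def)
  obtain K1 where K1: "\<And>x. \<bar>\<eta> x\<bar> \<le> K1"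
    using continuous_supp_in_bounded[OF smooth_continuous[OF e(1)] s] by blast
  obtain K2 where K2: "\<And>x. \<bar>deriv \<eta> x\<bar> \<le> K2"
    using continuous_supp_in_bounded[OF smooth_continuous[OF smooth_deriv[OF e(1)]] supp_in_deriv[OF s]]
    by blast
  have "mollifier \<eta> (max K1 K2)"
  proof
    show "\<eta> x \<le> max K1 K2" for x using K1[of x] by linarith
    show "\<bar>deriv \<eta> x\<bar> \<le> max K1 K2" for x using K2[of x] by linarith
  qed (use e in auto)
  then show ?thesis using that e(4) by blast
qed

text \<open>Crude commutator bounds: the supremum of the integrand times the area of the support of the
  kernel.\<close>

lemma integral_box_bound:
  fixes g :: "real \<times> real \<Rightarrow> real"
  assumes s: "0 \<le> s" "0 \<le> t" and c: "0 \<le> c"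
    and b: "\<And>w. \<bar>g w\<bar> \<le> c * (indicator {0..s} (fst z - fst w) * indicator {0..t} (snd z - snd w))"
  shows "\<bar>\<integral>w. g w \<partial>lborel\<bar> \<le> c * (s * t)"
proof (cases "integrable lborel g")
  case True
  let ?I = "indicator (cbox (fst z - s, snd z - t) (fst z, snd z)) :: real \<times> real \<Rightarrow> real"
  have I: "indicator {0..s} (fst z - fst w) * indicator {0..t} (snd z - snd w) = ?I w" for w
    by (cases w; cases z) (auto simp: indicator_def cbox_Pair_eq)
  have int: "integrable lborel ?I"
    by (simp add: integrable_indicator_iff emeasure_lborel_cbox_eq)
  have m: "measure lborel (cbox (fst z - s, snd z - t) (fst z, snd z)) = s * t"
    using s by (cases z, subst measure_lborel_cbox_eq) (auto simp: Basis_prod_def prod.union_disjoint image_iff)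
  have "\<bar>\<integral>w. g w \<partial>lborel\<bar> \<le> (\<integral>w. \<bar>g w\<bar> \<partial>lborel)"
    by (rule integral_abs_bound)
  also have "\<dots> \<le> (\<integral>w. c * ?I w \<partial>lborel)"
    using True int b by (intro integral_mono) (auto simp: I)
  also have "\<dots> = c * (s * t)" using m by simp
  finally show ?thesis .
next
  case False
  then show ?thesis using s c by (simp add: not_integrable_integral_eq)
qed

lemma uniformly_continuous_supp_box:
  fixes f :: "real \<times> real \<Rightarrow> real"
  assumes c: "continuous_on UNIV f" and s: "supp_box f r" and e: "0 < e"
  obtains d where "0 < d" "\<And>z w. \<bar>fst z - fst w\<bar> < d \<Longrightarrow> \<bar>snd z - snd w\<bar> < d \<Longrightarrow> \<bar>f z - f w\<bar> < e"
proof -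
  have "uniformly_continuous_on (square (r + 1)) f"
    using c by (intro compact_uniformly_continuous compact_square) (auto intro: continuous_on_subset)
  then obtain d where d: "0 < d"
    "\<And>z w. z \<in> square (r + 1) \<Longrightarrow> w \<in> square (r + 1) \<Longrightarrow> dist w z < d \<Longrightarrow> dist (f w) (f z) < e"
    using e unfolding uniformly_continuous_on_def by metis
  show ?thesis
  proof (rule that[of "min 1 (d / 2)"])
    show "0 < min 1 (d / 2)" using d by simp
    fix z w :: "real \<times> real"
    assume zw: "\<bar>fst z - fst w\<bar> < min 1 (d / 2)" "\<bar>snd z - snd w\<bar> < min 1 (d / 2)"
    show "\<bar>f z - f w\<bar> < e"
    proof (cases "z \<in> square r \<or> w \<in> square r")
      case True
      then have "z \<in> square (r + 1)" "w \<in> square (r + 1)" using zw by (auto simp: in_square)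
      moreover have "dist w z < d"
      proof -
        have "dist w z \<le> dist (fst w) (fst z) + dist (snd w) (snd z)"
          unfolding dist_prod_def by (rule sqrt_sum_squares_le_sum) auto
        then show ?thesis using zw by (simp add: dist_real_def abs_minus_commute)
      qed
      ultimately show ?thesis using d(2)[of z w] by (simp add: dist_real_def abs_minus_commute)
    next
      case False
      then have "f z = 0" "f w = 0" 
        using s[unfolded supp_box_def, rule_format, of z] s[unfolded supp_box_def, rule_format, of w]
        by (simp_all add: in_square) linarith+
      then show ?thesis using e by simp
    qed
  qed
qed

context mollifier
begin

text \<open>Fubini moves the mollification from \<open>\<rho>\<close> to the continuous function, where it changes values by at
  most the modulus of continuity.\<close>

lemma conv_scaled_limit_bound:
  fixes f \<rho> :: "real \<times> real \<Rightarrow> real"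
  assumes s: "0 < s" "s \<le> 1" and t: "0 < t" "t \<le> s"
    and r: "integrable lborel \<rho>" "\<And>z. 0 \<le> \<rho> z"
    and f: "continuous_on UNIV f" "supp_box f R"
    and e: "\<And>z w. \<bar>fst z - fst w\<bar> \<le> s \<Longrightarrow> \<bar>snd z - snd w\<bar> \<le> s \<Longrightarrow> \<bar>f z - f w\<bar> \<le> e"
  shows "\<bar>(\<integral>z. conv \<rho> (scaled \<eta> s) (scaled \<eta> t) z * f z \<partial>lborel) - (\<integral>z. \<rho> z * f z \<partial>lborel)\<bar>
    \<le> e * (\<integral>z. \<rho> z \<partial>lborel)"
proof -
  define k where "k = scaled \<eta> s"
  define l where "l = scaled \<eta> t"
  have kc: "continuous_on UNIV k" and lc: "continuous_on UNIV l"
    by (auto simp: k_def l_def intro: smooth_continuous smooth_scaled)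
  have kb: "\<bar>k x\<bar> \<le> K / s" and lb: "\<bar>l x\<bar> \<le> K / t" for x
    using scaled_bound[of s x] scaled_bound[of t x] s t K_nonneg
    by (auto simp: k_def l_def indicator_def split: if_splits intro: order.trans)
  have kl0: "0 \<le> k x" "0 \<le> l x" for x
    using scaled_nonneg s t by (auto simp: k_def l_def)
  obtain Cf where Cf: "0 < Cf" "\<And>z. \<bar>f z\<bar> \<le> Cf * indicator (square R) z"
    using continuous_supp_box_bound[OF f] by blast
  have fi: "integrable lborel f" by (rule integrable_continuous_supp_box[OF f])
  define \<kappa> where "\<kappa> z w = k (fst z - fst w) * l (snd z - snd w)" for z w :: "real \<times> real"
  have \<kappa>b: "\<bar>\<kappa> z w\<bar> \<le> K / s * (K / t)" for z w
    unfolding \<kappa>_def abs_mult using kb lb K_nonneg s by (intro mult_mono) auto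
  have \<kappa>0: "0 \<le> \<kappa> z w" for z w unfolding \<kappa>_def using kl0 by simp
  have \<kappa>1: "has_bochner_integral lborel (\<lambda>z. \<kappa> z w) 1" for w
  proof -
    have "has_bochner_integral lborel (\<lambda>x. k (x - fst w)) 1" "has_bochner_integral lborel (\<lambda>x. l (x - snd w)) 1"
      using scaled_shift_int s t by (auto simp: k_def l_def)
    then show ?thesis
      using tensor_integral[of "\<lambda>x. k (x - fst w)" "\<lambda>x. l (x - snd w)"]
      by (auto simp: has_bochner_integral_iff \<kappa>_def)
  qed
  have [measurable]: "\<rho> \<in> borel_measurable borel" "f \<in> borel_measurable borel"
    using r fi by auto
  have int2: "integrable (lborel \<Otimes>\<^sub>M lborel) (\<lambda>x. \<rho> (fst x) * (\<kappa> (snd x) (fst x) * f (snd x)))"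
  proof (rule Bochner_Integration.integrable_bound)
    show "integrable (lborel \<Otimes>\<^sub>M lborel) (\<lambda>x. (K / s * (K / t) * \<rho> (fst x)) * f (snd x))"
      using tensor_integral(1)[OF integrable_mult_right[OF r(1)] fi] by (simp add: lborel_prod)
    have "continuous_on UNIV (\<lambda>x. \<kappa> (snd x) (fst x))"
      unfolding \<kappa>_def
      by (intro continuous_on_mult continuous_on_compose2[OF kc] continuous_on_compose2[OF lc])
        (auto intro!: continuous_intros)
    then have [measurable]: "(\<lambda>x. \<kappa> (snd x) (fst x)) \<in> borel_measurable (lborel \<Otimes>\<^sub>M lborel)"
      by (simp add: lborel_prod borel_measurable_continuous_onI)
    show "(\<lambda>x. \<rho> (fst x) * (\<kappa> (snd x) (fst x) * f (snd x))) \<in> borel_measurable (lborel \<Otimes>\<^sub>M lborel)"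
      by measurable
    show "AE x in lborel \<Otimes>\<^sub>M lborel. norm (\<rho> (fst x) * (\<kappa> (snd x) (fst x) * f (snd x)))
        \<le> norm (K / s * (K / t) * \<rho> (fst x) * f (snd x))"
    proof (rule AE_I2)
      fix x :: "(real \<times> real) \<times> real \<times> real"
      have "\<bar>\<rho> (fst x)\<bar> * (\<bar>\<kappa> (snd x) (fst x)\<bar> * \<bar>f (snd x)\<bar>) \<le> \<bar>\<rho> (fst x)\<bar> * (K / s * (K / t) * \<bar>f (snd x)\<bar>)"
        by (intro mult_left_mono mult_right_mono \<kappa>b) auto
      then show "norm (\<rho> (fst x) * (\<kappa> (snd x) (fst x) * f (snd x)))
        \<le> norm (K / s * (K / t) * \<rho> (fst x) * f (snd x))"
        using s t K_nonneg by (simp add: abs_mult mult_ac)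
    qed
  qed
  define g where "g w = (\<integral>z. \<kappa> z w * f z \<partial>lborel)" for w
  have F1: "(\<integral>w. \<rho> w * g w \<partial>lborel) = (\<integral>x. \<rho> (fst x) * (\<kappa> (snd x) (fst x) * f (snd x)) \<partial>(lborel \<Otimes>\<^sub>M lborel))"
    using lborel_pair.integral_fst'[OF int2] by (simp add: g_def)
  have F2: "(\<integral>z. conv \<rho> k l z * f z \<partial>lborel) = (\<integral>x. \<rho> (fst x) * (\<kappa> (snd x) (fst x) * f (snd x)) \<partial>(lborel \<Otimes>\<^sub>M lborel))"
  proof -
    have "(\<integral>z. \<integral>w. \<rho> w * (\<kappa> z w * f z) \<partial>lborel \<partial>lborel)
        = (\<integral>x. \<rho> (fst x) * (\<kappa> (snd x) (fst x) * f (snd x)) \<partial>(lborel \<Otimes>\<^sub>M lborel))"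
      using lborel_pair.integral_snd[of "\<lambda>w z. \<rho> w * (\<kappa> z w * f z)"] int2 by (simp add: split_def)
    moreover have "(\<integral>w. \<rho> w * (\<kappa> z w * f z) \<partial>lborel) = conv \<rho> k l z * f z" for z
      unfolding conv_def \<kappa>_def by (subst integral_mult_left_zero[symmetric]) (simp add: mult_ac)
    ultimately show ?thesis by simp
  qed
  have ig: "integrable lborel (\<lambda>w. \<rho> w * g w)"
    using lborel_pair.integrable_fst'[OF int2] by (simp add: g_def)
  have if': "integrable lborel (\<lambda>w. \<rho> w * f w)"
  proof (rule Bochner_Integration.integrable_bound)
    show "integrable lborel (\<lambda>w. Cf * \<rho> w)" using r by simp
    show "AE w in lborel. norm (\<rho> w * f w) \<le> norm (Cf * \<rho> w)"
    proof (rule AE_I2)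
      fix w
      have "\<bar>f w\<bar> \<le> Cf" using Cf(2)[of w] Cf(1) by (cases "w \<in> square R") auto
      then have "\<bar>f w\<bar> * \<bar>\<rho> w\<bar> \<le> Cf * \<bar>\<rho> w\<bar>" by (rule mult_right_mono) simp
      then show "norm (\<rho> w * f w) \<le> norm (Cf * \<rho> w)" using Cf by (simp add: abs_mult mult.commute)
    qed
  qed simp
  have gf: "\<bar>g w - f w\<bar> \<le> e" for w
  proof -
    have e0: "0 \<le> e" using e[of w w] s by simp
    have i1: "integrable lborel (\<lambda>z. \<kappa> z w * f z)"
    proof (rule Bochner_Integration.integrable_bound)
      show "integrable lborel (\<lambda>z. K / s * (K / t) * f z)" using fi by simp
      show "AE z in lborel. norm (\<kappa> z w * f z) \<le> norm (K / s * (K / t) * f z)"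
      proof (rule AE_I2)
        fix z
        have "\<bar>\<kappa> z w\<bar> * \<bar>f z\<bar> \<le> K / s * (K / t) * \<bar>f z\<bar>" by (intro mult_right_mono \<kappa>b) auto
        then show "norm (\<kappa> z w * f z) \<le> norm (K / s * (K / t) * f z)"
          using s t K_nonneg by (simp add: abs_mult)
      qed
      show "(\<lambda>z. \<kappa> z w * f z) \<in> borel_measurable lborel"
        using \<kappa>1[of w] by (auto simp: has_bochner_integral_iff)
    qed
    have i2: "integrable lborel (\<lambda>z. \<kappa> z w * f w)" "(\<integral>z. \<kappa> z w * f w \<partial>lborel) = f w"
      using \<kappa>1[of w] by (auto simp: has_bochner_integral_iff)
    have "g w - f w = (\<integral>z. \<kappa> z w * f z - \<kappa> z w * f w \<partial>lborel)"
      using i1 i2 by (simp add: g_def)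
    also have "\<bar>\<dots>\<bar> \<le> (\<integral>z. \<bar>\<kappa> z w * f z - \<kappa> z w * f w\<bar> \<partial>lborel)"
      by (rule integral_abs_bound)
    also have "\<dots> \<le> (\<integral>z. \<kappa> z w * e \<partial>lborel)"
    proof (rule integral_mono)
      fix z
      show "\<bar>\<kappa> z w * f z - \<kappa> z w * f w\<bar> \<le> \<kappa> z w * e"
      proof (cases "\<kappa> z w = 0")
        case False
        then have "scaled \<eta> s (fst z - fst w) \<noteq> 0" "scaled \<eta> t (snd z - snd w) \<noteq> 0"
          by (auto simp: \<kappa>_def k_def l_def)
        then have "fst z - fst w \<in> {0..s}" "snd z - snd w \<in> {0..t}"
          using scaled_zero s t by blast+
        then have "\<bar>f z - f w\<bar> \<le> e" using t by (intro e) auto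
        then have "\<kappa> z w * \<bar>f z - f w\<bar> \<le> \<kappa> z w * e" using \<kappa>0 by (intro mult_left_mono)
        then show ?thesis using \<kappa>0[of z w] by (simp add: abs_mult flip: right_diff_distrib)
      qed simp
    qed (use i1 i2 \<kappa>1[of w] in \<open>auto simp: has_bochner_integral_iff\<close>)
    also have "\<dots> = e" using \<kappa>1[of w] by (simp add: has_bochner_integral_iff)
    finally show ?thesis .
  qed
  have "(\<integral>z. conv \<rho> k l z * f z \<partial>lborel) - (\<integral>z. \<rho> z * f z \<partial>lborel) = (\<integral>w. \<rho> w * g w - \<rho> w * f w \<partial>lborel)"
    using ig if' F1 F2 by simp
  also have "\<bar>\<dots>\<bar> \<le> (\<integral>w. \<bar>\<rho> w * g w - \<rho> w * f w\<bar> \<partial>lborel)"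
    by (rule integral_abs_bound)
  also have "\<dots> \<le> (\<integral>w. e * \<rho> w \<partial>lborel)"
  proof (rule integral_mono)
    fix w
    have "\<rho> w * \<bar>g w - f w\<bar> \<le> \<rho> w * e" using gf r by (intro mult_left_mono) auto
    then show "\<bar>\<rho> w * g w - \<rho> w * f w\<bar> \<le> e * \<rho> w"
      using r(2)[of w] by (simp add: abs_mult mult.commute flip: right_diff_distrib)
  qed (use ig if' r in auto)
  also have "\<dots> = e * (\<integral>z. \<rho> z \<partial>lborel)" by simp
  finally show ?thesis by (simp add: k_def l_def)
qed

lemma conv_scaled_tendsto:
  fixes f \<rho> :: "real \<times> real \<Rightarrow> real"
  assumes s: "\<And>n. 0 < s n" "\<And>n. s n \<le> 1" "s \<longlonglongrightarrow> 0"
    and r: "integrable lborel \<rho>" "\<And>z. 0 \<le> \<rho> z"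
    and f: "continuous_on UNIV f" "supp_box f R"
  shows "(\<lambda>n. \<integral>z. conv \<rho> (scaled \<eta> (s n)) (scaled \<eta> ((s n)\<^sup>2)) z * f z \<partial>lborel)
    \<longlonglongrightarrow> (\<integral>z. \<rho> z * f z \<partial>lborel)"
proof (rule LIMSEQ_I)
  fix e :: real assume e: "0 < e"
  have M: "0 \<le> (\<integral>z. \<rho> z \<partial>lborel)" using r by simp
  \<comment> \<open>Adding 1 avoids a case distinction on whether the total mass vanishes.\<close>
  define e' where "e' = e / (2 * ((\<integral>z. \<rho> z \<partial>lborel) + 1))"
  have e': "0 < e'" using e M by (simp add: e'_def)
  have e'M: "e' * (\<integral>z. \<rho> z \<partial>lborel) < e"
  proof -
    have "e' * (\<integral>z. \<rho> z \<partial>lborel) \<le> e' * ((\<integral>z. \<rho> z \<partial>lborel) + 1)" using e' by simp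
    also have "\<dots> = e / 2" using M by (simp add: e'_def field_simps)
    finally show ?thesis using e by simp
  qed
  obtain d where d: "0 < d"
    "\<And>z w. \<bar>fst z - fst w\<bar> < d \<Longrightarrow> \<bar>snd z - snd w\<bar> < d \<Longrightarrow> \<bar>f z - f w\<bar> < e'"
    using uniformly_continuous_supp_box[OF f e'] by blast
  obtain N where N: "\<And>n. N \<le> n \<Longrightarrow> s n < d"
    using order_tendstoD(2)[OF s(3) d(1)] by (auto simp: eventually_sequentially)
  show "\<exists>no. \<forall>n\<ge>no. norm ((\<integral>z. conv \<rho> (scaled \<eta> (s n)) (scaled \<eta> ((s n)\<^sup>2)) z * f z \<partial>lborel)
      - (\<integral>z. \<rho> z * f z \<partial>lborel)) < e"
  proof (intro exI[of _ N] allI impI)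
    fix n assume n: "N \<le> n"
    have "\<bar>(\<integral>z. conv \<rho> (scaled \<eta> (s n)) (scaled \<eta> ((s n)\<^sup>2)) z * f z \<partial>lborel)
      - (\<integral>z. \<rho> z * f z \<partial>lborel)\<bar> \<le> e' * (\<integral>z. \<rho> z \<partial>lborel)"
    proof (rule conv_scaled_limit_bound[OF s(1) s(2) _ _ r f])
      show "0 < (s n)\<^sup>2" using s(1)[of n] by simp
      show "(s n)\<^sup>2 \<le> s n" using s(1)[of n] s(2)[of n]
        by (simp add: power2_eq_square mult_left_le)
      show "\<bar>f z - f w\<bar> \<le> e'" if "\<bar>fst z - fst w\<bar> \<le> s n" "\<bar>snd z - snd w\<bar> \<le> s n" for z w
        using d(2)[of z w] that N[OF n] by fastforce
    qed
    then show "norm ((\<integral>z. conv \<rho> (scaled \<eta> (s n)) (scaled \<eta> ((s n)\<^sup>2)) z * f z \<partial>lborel)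
      - (\<integral>z. \<rho> z * f z \<partial>lborel)) < e" using e'M by simp
  qed
qed

end

section \<open>The mollified equation and its commutators\<close>

lemma le_zero_if_scaled_bound:
  fixes x c d :: real
  assumes "\<And>s. s0 \<le> s \<Longrightarrow> s * x \<le> c"
  shows "x \<le> 0"
proof (rule ccontr)
  assume x: "\<not> x \<le> 0"
  define s where "s = max s0 ((\<bar>c\<bar> + 1) / x)"
  have "(\<bar>c\<bar> + 1) / x * x \<le> s * x" using x by (intro mult_right_mono) (auto simp: s_def)
  then have "\<bar>c\<bar> + 1 \<le> s * x" using x by simp
  moreover have "s * x \<le> c" by (rule assms) (simp add: s_def)
  ultimately show False by linarith
qed

locale linear_stationary = confining W lam k0 + mollifier \<eta> K
  for W :: "real \<Rightarrow> real" and lam k0 :: real and \<eta> :: "real \<Rightarrow> real" and K :: real +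
  fixes \<rho> :: "real \<times> real \<Rightarrow> real" and C :: real
  assumes eta_pos: "\<And>x. x \<in> {0<..<1} \<Longrightarrow> 0 < \<eta> x"
    and rho_nonneg: "\<And>z. 0 \<le> \<rho> z" and rho_le: "\<And>z. \<rho> z \<le> C"
    and rho_int: "integrable lborel \<rho>"
    and weak: "\<And>a b R. bump_function a R \<Longrightarrow> bump_function b R \<Longrightarrow>
      (\<integral>z. \<rho> z * (snd z * (deriv a (fst z) * b (snd z))
        - (deriv W (fst z) + snd z) * (a (fst z) * deriv b (snd z))
        + lam * (a (fst z) * deriv (deriv b) (snd z))) \<partial>lborel) = 0"
begin

lemma C_nonneg: "0 \<le> C"
  using rho_nonneg[of 0] rho_le[of 0] by linarith

lemma rho_measurable [measurable]: "\<rho> \<in> borel_measurable borel"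
  using rho_int by auto

lemma rho_locally_bounded: "locally_bounded \<rho>"
  unfolding locally_bounded_def using rho_measurable rho_nonneg rho_le
  by (auto intro!: exI[of _ C])

definition drift :: "real \<times> real \<Rightarrow> real" where
  "drift z = deriv W (fst z) + snd z"

lemma continuous_drift: "continuous_on UNIV drift"
  unfolding drift_def
  by (intro continuous_intros continuous_fst_comp smooth_deriv smooth_W)

text \<open>The mollified density, and the commutators that mollification produces: \<open>A s\<close> comes from the
  transport term \<open>p \<partial>\<^sub>q\<close> and \<open>\<partial>\<^sub>p (B s)\<close> from the drift.\<close>

definition u :: "real \<Rightarrow> real \<times> real \<Rightarrow> real" where
  "u s = conv \<rho> (scaled \<eta> s) (scaled \<eta> (s\<^sup>2))"

definition u_q :: "real \<Rightarrow> real \<times> real \<Rightarrow> real" where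
  "u_q s = conv \<rho> (deriv (scaled \<eta> s)) (scaled \<eta> (s\<^sup>2))"

definition u_p :: "real \<Rightarrow> real \<times> real \<Rightarrow> real" where
  "u_p s = conv \<rho> (scaled \<eta> s) (deriv (scaled \<eta> (s\<^sup>2)))"

definition u_pp :: "real \<Rightarrow> real \<times> real \<Rightarrow> real" where
  "u_pp s = conv \<rho> (scaled \<eta> s) (deriv (deriv (scaled \<eta> (s\<^sup>2))))"

definition A :: "real \<Rightarrow> real \<times> real \<Rightarrow> real" where
  "A s z = conv (\<lambda>z. \<rho> z * snd z) (deriv (scaled \<eta> s)) (scaled \<eta> (s\<^sup>2)) z - snd z * u_q s z"

definition B :: "real \<Rightarrow> real \<times> real \<Rightarrow> real" where
  "B s z = drift z * u s z - conv (\<lambda>z. \<rho> z * drift z) (scaled \<eta> s) (scaled \<eta> (s\<^sup>2)) z"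

definition B_p :: "real \<Rightarrow> real \<times> real \<Rightarrow> real" where
  "B_p s z = u s z + drift z * u_p s z
    - conv (\<lambda>z. \<rho> z * drift z) (scaled \<eta> s) (deriv (scaled \<eta> (s\<^sup>2))) z"

lemma lb_p: "locally_bounded (\<lambda>z. \<rho> z * snd z)" and lb_drift: "locally_bounded (\<lambda>z. \<rho> z * drift z)"
  by (rule locally_bounded_mult[OF rho_locally_bounded locally_bounded_continuous];
      intro continuous_drift continuous_intros)+

context
  fixes s :: real
  assumes s: "0 < s" "s \<le> 1"
begin

lemma s2: "0 < s\<^sup>2" "s\<^sup>2 \<le> 1" "s\<^sup>2 \<le> s"
  using s mult_left_le[of s s] mult_le_one[of s s] by (auto simp: power2_eq_square)

lemma k_facts: "continuous_on UNIV (scaled \<eta> s)" "supp_in (scaled \<eta> s) 1"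
    "continuous_on UNIV (deriv (scaled \<eta> s))" "supp_in (deriv (scaled \<eta> s)) 1"
  using s by (auto intro: smooth_continuous smooth_deriv smooth_scaled scaled_supp supp_in_deriv)

lemma l_facts: "continuous_on UNIV (scaled \<eta> (s\<^sup>2))" "supp_in (scaled \<eta> (s\<^sup>2)) 1"
    "continuous_on UNIV (deriv (scaled \<eta> (s\<^sup>2)))" "supp_in (deriv (scaled \<eta> (s\<^sup>2))) 1"
    "continuous_on UNIV (deriv (deriv (scaled \<eta> (s\<^sup>2))))" "supp_in (deriv (deriv (scaled \<eta> (s\<^sup>2)))) 1"
  by (intro smooth_continuous smooth_deriv smooth_scaled scaled_supp supp_in_deriv s2)+

lemma u_continuous: "continuous_on UNIV (u s)" "continuous_on UNIV (u_q s)"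
    "continuous_on UNIV (u_p s)" "continuous_on UNIV (u_pp s)"
    "continuous_on UNIV (A s)" "continuous_on UNIV (B s)" "continuous_on UNIV (B_p s)"
proof -
  show c: "continuous_on UNIV (u s)" "continuous_on UNIV (u_q s)"
    "continuous_on UNIV (u_p s)" "continuous_on UNIV (u_pp s)"
    unfolding u_def u_q_def u_p_def u_pp_def
    by (rule conv_continuous[OF rho_locally_bounded]; rule k_facts l_facts)+
  show "continuous_on UNIV (A s)" unfolding A_def
    by (intro continuous_intros c conv_continuous[OF lb_p k_facts(3,4) l_facts(1,2)])
  show "continuous_on UNIV (B s)" unfolding B_def
    by (intro continuous_intros c continuous_drift conv_continuous[OF lb_drift k_facts(1,2) l_facts(1,2)])
  show "continuous_on UNIV (B_p s)" unfolding B_p_def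
    by (intro continuous_intros c continuous_drift conv_continuous[OF lb_drift k_facts(1,2) l_facts(3,4)])
qed

lemma u_DERIV:
  "((\<lambda>q. u s (q, p)) has_real_derivative u_q s (q, p)) (at q)"
  "((\<lambda>p. u s (q, p)) has_real_derivative u_p s (q, p)) (at p)"
  "((\<lambda>p. u_p s (q, p)) has_real_derivative u_pp s (q, p)) (at p)"
  unfolding u_def u_q_def u_p_def u_pp_def
  by (rule conv_DERIV_q[OF rho_locally_bounded smooth_DERIV[OF smooth_scaled] k_facts(3,2) l_facts(1,2)]
      conv_DERIV_p[OF rho_locally_bounded smooth_DERIV[OF smooth_scaled] l_facts(3,2) k_facts(1,2)]
      conv_DERIV_p[OF rho_locally_bounded smooth_DERIV[OF smooth_deriv[OF smooth_scaled]] l_facts(5,4) k_facts(1,2)])+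

lemma B_DERIV: "((\<lambda>p. B s (q, p)) has_real_derivative B_p s (q, p)) (at p)"
proof -
  have d: "((\<lambda>p. drift (q, p)) has_real_derivative 1) (at p)"
    unfolding drift_def by (auto intro!: derivative_eq_intros)
  have "((\<lambda>p. B s (q, p)) has_real_derivative
      (1 * u s (q, p) + u_p s (q, p) * drift (q, p))
      - conv (\<lambda>z. \<rho> z * drift z) (scaled \<eta> s) (deriv (scaled \<eta> (s\<^sup>2))) (q, p)) (at p)"
    unfolding B_def
    by (intro DERIV_diff DERIV_mult d u_DERIV
      conv_DERIV_p[OF lb_drift smooth_DERIV[OF smooth_scaled] l_facts(3,2) k_facts(1,2)])
  then show ?thesis by (simp add: B_p_def mult.commute)
qed

lemma u_nonneg: "0 \<le> u s z"
  unfolding u_def conv_def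
  by (intro Bochner_Integration.integral_nonneg mult_nonneg_nonneg rho_nonneg scaled_nonneg s s2)

text \<open>The weak equation tested against the translated kernel is the convolved equation; the coefficients
  evaluated at the integration variable instead of the base point account for \<open>A\<close> and \<open>B\<close>.\<close>

lemma mollified_equation:
  "- (snd z * u_q s z) + (deriv W (fst z) + snd z) * u_p s z + u s z + lam * u_pp s z = A s z + B_p s z"
proof -
  obtain q p where z: "z = (q, p)" by (cases z)
  define R where "R = max \<bar>q\<bar> \<bar>p\<bar> + 1"
  define a where "a x = scaled \<eta> s (-1 * x + q)" for x
  define b where "b x = scaled \<eta> (s\<^sup>2) (-1 * x + p)" for x
  have ba: "bump_function a R" "bump_function b R"
    unfolding bump_function_def a_def b_def
    using k_facts(2) l_facts(2)
    by (intro conjI smooth_affine smooth_scaled; auto simp: supp_in_def R_def)+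
  have dd: "deriv (\<lambda>x. f (-1 * x + c)) = (\<lambda>x. - deriv f (-1 * x + c))" if "smooth f" for f :: "real \<Rightarrow> real" and c
  proof (rule deriv_eqI)
    fix x
    have "((\<lambda>x. -1 * x + c) has_real_derivative -1) (at x)" by (auto intro!: derivative_eq_intros)
    from DERIV_chain2[OF smooth_DERIV[OF that] this]
    show "((\<lambda>x. f (-1 * x + c)) has_real_derivative - deriv f (-1 * x + c)) (at x)" by simp
  qed
  have da: "deriv a = (\<lambda>x. - deriv (scaled \<eta> s) (q - x))"
    unfolding a_def[abs_def] by (subst dd[OF smooth_scaled]) simp
  have db: "deriv b = (\<lambda>x. - deriv (scaled \<eta> (s\<^sup>2)) (-1 * x + p))"
    unfolding b_def[abs_def] by (subst dd[OF smooth_scaled]) simp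
  have ddb: "deriv (deriv b) = (\<lambda>x. deriv (deriv (scaled \<eta> (s\<^sup>2))) (p - x))"
  proof -
    have "deriv (\<lambda>x. - deriv (scaled \<eta> (s\<^sup>2)) (-1 * x + p))
      = (\<lambda>x. - (- deriv (deriv (scaled \<eta> (s\<^sup>2))) (-1 * x + p)))"
    proof (rule deriv_eqI, rule DERIV_minus)
      fix x
      show "((\<lambda>x. deriv (scaled \<eta> (s\<^sup>2)) (-1 * x + p)) has_real_derivative
        - deriv (deriv (scaled \<eta> (s\<^sup>2))) (-1 * x + p)) (at x)"
        using smooth_DERIV[OF smooth_affine[OF smooth_deriv[OF smooth_scaled]], of "s\<^sup>2" "-1" p x]
        by (subst (asm) dd[OF smooth_deriv[OF smooth_scaled]])
    qed
    then show ?thesis by (simp add: db)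
  qed
  let ?k = "scaled \<eta> s" and ?l = "scaled \<eta> (s\<^sup>2)"
  have i: "integrable lborel (\<lambda>w. (\<rho> w * snd w) * (deriv ?k (fst z - fst w) * ?l (snd z - snd w)))"
    "integrable lborel (\<lambda>w. (\<rho> w * drift w) * (?k (fst z - fst w) * deriv ?l (snd z - snd w)))"
    "integrable lborel (\<lambda>w. \<rho> w * (?k (fst z - fst w) * deriv (deriv ?l) (snd z - snd w)))"
    by (rule conv_integrable[OF lb_p k_facts(3,4) l_facts(1,2)]
        conv_integrable[OF lb_drift k_facts(1,2) l_facts(3,4)]
        conv_integrable[OF rho_locally_bounded k_facts(1,2) l_facts(5,6)])+
  have "0 = (\<integral>w. \<rho> w * (snd w * (deriv a (fst w) * b (snd w))
        - (deriv W (fst w) + snd w) * (a (fst w) * deriv b (snd w))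
        + lam * (a (fst w) * deriv (deriv b) (snd w))) \<partial>lborel)"
    using weak[OF ba] by simp
  also have "\<dots> = (\<integral>w. - ((\<rho> w * snd w) * (deriv ?k (fst z - fst w) * ?l (snd z - snd w)))
      + (\<rho> w * drift w) * (?k (fst z - fst w) * deriv ?l (snd z - snd w))
      + lam * (\<rho> w * (?k (fst z - fst w) * deriv (deriv ?l) (snd z - snd w))) \<partial>lborel)"
    by (rule Bochner_Integration.integral_cong)
      (simp_all add: da ddb, simp add: db z a_def b_def drift_def algebra_simps)
  also have "\<dots> = - conv (\<lambda>z. \<rho> z * snd z) (deriv ?k) ?l z
      + conv (\<lambda>z. \<rho> z * drift z) ?k (deriv ?l) z + lam * u_pp s z"
    unfolding conv_def u_pp_def using i by simp
  finally show ?thesis by (simp add: A_def B_p_def drift_def algebra_simps)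
qed

lemma u_le: "u s z \<le> C * K\<^sup>2"
proof -
  have "\<bar>u s z\<bar> \<le> C * (K / s * (K / s\<^sup>2)) * (s * s\<^sup>2)"
    unfolding u_def conv_def
  proof (rule integral_box_bound)
    fix w
    have "\<bar>\<rho> w\<bar> * (\<bar>scaled \<eta> s (fst z - fst w)\<bar> * \<bar>scaled \<eta> (s\<^sup>2) (snd z - snd w)\<bar>)
      \<le> C * ((K / s * indicator {0..s} (fst z - fst w)) * (K / s\<^sup>2 * indicator {0..s\<^sup>2} (snd z - snd w)))"
      using rho_nonneg[of w] rho_le[of w] C_nonneg K_nonneg s
      by (intro mult_mono scaled_bound[OF s(1)] scaled_bound[OF s2(1)]) auto
    then show "\<bar>\<rho> w * (scaled \<eta> s (fst z - fst w) * scaled \<eta> (s\<^sup>2) (snd z - snd w))\<bar>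
      \<le> C * (K / s * (K / s\<^sup>2)) * (indicator {0..s} (fst z - fst w) * indicator {0..s\<^sup>2} (snd z - snd w))"
      by (simp add: abs_mult mult_ac)
  qed (use s C_nonneg K_nonneg in auto)
  then show ?thesis using s by (simp add: power2_eq_square)
qed

text \<open>On the support \<open>\<bar>p - p'\<bar> \<le> s\<^sup>2\<close>, against a loss of \<open>1 / s\<close> from \<open>\<partial>\<^sub>q\<close> of the kernel.\<close>

lemma A_le: "\<bar>A s z\<bar> \<le> C * K\<^sup>2 * s"
proof -
  let ?k = "scaled \<eta> s" and ?l = "scaled \<eta> (s\<^sup>2)"
  let ?f = "\<lambda>w. \<rho> w * snd w * (deriv ?k (fst z - fst w) * ?l (snd z - snd w))"
  let ?g = "\<lambda>w. \<rho> w * (deriv ?k (fst z - fst w) * ?l (snd z - snd w))"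
  have i: "integrable lborel ?f" "integrable lborel ?g"
    by (rule conv_integrable[OF lb_p k_facts(3,4) l_facts(1,2)]
        conv_integrable[OF rho_locally_bounded k_facts(3,4) l_facts(1,2)])+
  have "A s z = (\<integral>w. ?f w - snd z * ?g w \<partial>lborel)"
    unfolding A_def u_q_def conv_def using i by simp
  also have "\<dots> = (\<integral>w. \<rho> w * (snd w - snd z) * (deriv ?k (fst z - fst w) * ?l (snd z - snd w)) \<partial>lborel)"
    by (rule Bochner_Integration.integral_cong) (simp_all add: right_diff_distrib left_diff_distrib mult_ac)
  also have "\<bar>\<dots>\<bar> \<le> C * s\<^sup>2 * (K / s\<^sup>2 * (K / s\<^sup>2)) * (s * s\<^sup>2)"
  proof (rule integral_box_bound)
    fix w
    let ?I = "indicator {0..s} (fst z - fst w) :: real" and ?J = "indicator {0..s\<^sup>2} (snd z - snd w) :: real"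
    have "\<bar>deriv ?k (fst z - fst w)\<bar> * \<bar>?l (snd z - snd w)\<bar> \<le> (K / s\<^sup>2 * ?I) * (K / s\<^sup>2 * ?J)"
      using s K_nonneg
      by (intro mult_mono scaled_bound[OF s2(1)] deriv_scaled_bound[OF s(1)]) auto
    then have *: "\<bar>deriv ?k (fst z - fst w) * ?l (snd z - snd w)\<bar> \<le> K / s\<^sup>2 * (K / s\<^sup>2) * (?I * ?J)"
      by (simp add: abs_mult mult_ac)
    show "\<bar>\<rho> w * (snd w - snd z) * (deriv ?k (fst z - fst w) * ?l (snd z - snd w))\<bar>
      \<le> C * s\<^sup>2 * (K / s\<^sup>2 * (K / s\<^sup>2)) * (?I * ?J)"
    proof (cases "snd z - snd w \<in> {0..s\<^sup>2}")
      case True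
      then have "\<bar>\<rho> w * (snd w - snd z)\<bar> \<le> C * s\<^sup>2"
        unfolding abs_mult using rho_nonneg[of w] rho_le[of w] C_nonneg by (intro mult_mono) auto
      then have "\<bar>\<rho> w * (snd w - snd z)\<bar> * \<bar>deriv ?k (fst z - fst w) * ?l (snd z - snd w)\<bar>
        \<le> C * s\<^sup>2 * (K / s\<^sup>2 * (K / s\<^sup>2) * (?I * ?J))"
        using * C_nonneg by (intro mult_mono) auto
      then show ?thesis unfolding abs_mult[symmetric] by (simp only: mult.assoc)
    next
      case False
      then have "?l (snd z - snd w) = 0" using scaled_bound[OF s2(1), of "snd z - snd w"] by simp
      then show ?thesis using False by simp
    qed
  qed (use s C_nonneg K_nonneg in auto)
  also have "\<dots> = C * K\<^sup>2 * s" using s by (simp add: power2_eq_square)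
  finally show ?thesis .
qed

text \<open>No derivative hits the kernel, so a Lipschitz bound on the drift gains a full factor \<open>s\<close>.\<close>

lemma B_le:
  assumes L: "\<And>q q'. \<bar>q\<bar> \<le> R + 1 \<Longrightarrow> \<bar>q'\<bar> \<le> R + 1 \<Longrightarrow> \<bar>deriv W q - deriv W q'\<bar> \<le> L * \<bar>q - q'\<bar>"
    and z: "z \<in> square R" and L0: "0 \<le> L"
  shows "\<bar>B s z\<bar> \<le> C * K\<^sup>2 * (L + 1) * s"
proof -
  let ?k = "scaled \<eta> s" and ?l = "scaled \<eta> (s\<^sup>2)"
  let ?f = "\<lambda>w. \<rho> w * drift w * (?k (fst z - fst w) * ?l (snd z - snd w))"
  let ?g = "\<lambda>w. \<rho> w * (?k (fst z - fst w) * ?l (snd z - snd w))"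
  have i: "integrable lborel ?f" "integrable lborel ?g"
    by (rule conv_integrable[OF lb_drift k_facts(1,2) l_facts(1,2)]
        conv_integrable[OF rho_locally_bounded k_facts(1,2) l_facts(1,2)])+
  have "B s z = (\<integral>w. drift z * ?g w - ?f w \<partial>lborel)"
    unfolding B_def u_def conv_def using i by simp
  also have "\<dots> = (\<integral>w. \<rho> w * (drift z - drift w) * (?k (fst z - fst w) * ?l (snd z - snd w)) \<partial>lborel)"
    by (rule Bochner_Integration.integral_cong) (simp_all add: right_diff_distrib left_diff_distrib mult_ac)
  also have "\<bar>\<dots>\<bar> \<le> C * ((L + 1) * s) * (K / s * (K / s\<^sup>2)) * (s * s\<^sup>2)"
  proof (rule integral_box_bound)
    fix w
    let ?I = "indicator {0..s} (fst z - fst w) :: real" and ?J = "indicator {0..s\<^sup>2} (snd z - snd w) :: real"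
    have "\<bar>?k (fst z - fst w)\<bar> * \<bar>?l (snd z - snd w)\<bar> \<le> (K / s * ?I) * (K / s\<^sup>2 * ?J)"
      using s K_nonneg
      by (intro mult_mono scaled_bound[OF s(1)] scaled_bound[OF s2(1)]) auto
    then have *: "\<bar>?k (fst z - fst w) * ?l (snd z - snd w)\<bar> \<le> K / s * (K / s\<^sup>2) * (?I * ?J)"
      by (simp add: abs_mult mult_ac)
    show "\<bar>\<rho> w * (drift z - drift w) * (?k (fst z - fst w) * ?l (snd z - snd w))\<bar>
      \<le> C * ((L + 1) * s) * (K / s * (K / s\<^sup>2)) * (?I * ?J)"
    proof (cases "fst z - fst w \<in> {0..s} \<and> snd z - snd w \<in> {0..s\<^sup>2}")
      case True
      have "\<bar>deriv W (fst z) - deriv W (fst w)\<bar> \<le> L * \<bar>fst z - fst w\<bar>"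
        using z True s by (intro L) (auto simp: in_square)
      also have "\<dots> \<le> L * s" using True L0 by (intro mult_left_mono) auto
      finally have "\<bar>drift z - drift w\<bar> \<le> (L + 1) * s"
        using True s2(3) by (auto simp: drift_def distrib_right)
      then have "\<bar>\<rho> w * (drift z - drift w)\<bar> \<le> C * ((L + 1) * s)"
        unfolding abs_mult using rho_nonneg[of w] rho_le[of w] C_nonneg by (intro mult_mono) auto
      then have "\<bar>\<rho> w * (drift z - drift w)\<bar> * \<bar>?k (fst z - fst w) * ?l (snd z - snd w)\<bar>
        \<le> C * ((L + 1) * s) * (K / s * (K / s\<^sup>2) * (?I * ?J))"
        using * C_nonneg L0 s by (intro mult_mono) auto
      then show ?thesis unfolding abs_mult[symmetric] by (simp only: mult.assoc)
    next
      case False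
      then have "?k (fst z - fst w) * ?l (snd z - snd w) = 0" "?I * ?J = 0"
        using scaled_bound[OF s2(1), of "snd z - snd w"] scaled_bound[OF s(1), of "fst z - fst w"]
        by auto
      then show ?thesis by (simp only: mult_zero_right abs_zero)
    qed
  qed (use s C_nonneg K_nonneg L0 in auto)
  also have "\<dots> = C * K\<^sup>2 * (L + 1) * s" using s by (simp add: power2_eq_square)
  finally show ?thesis .
qed

end

end

section \<open>Vanishing of the dissipation\<close>

lemma smooth_lipschitz:
  assumes f: "smooth f"
  obtains L where "0 \<le> L" "\<And>x y. \<bar>x\<bar> \<le> r \<Longrightarrow> \<bar>y\<bar> \<le> r \<Longrightarrow> \<bar>f x - f y\<bar> \<le> L * \<bar>x - y\<bar>"
proof -
  have "compact (deriv f ` cball 0 r)"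
    by (intro compact_continuous_image smooth_continuous smooth_deriv f compact_cball)
  then obtain L where L: "\<And>x. x \<in> cball 0 r \<Longrightarrow> \<bar>deriv f x\<bar> \<le> L"
    using compact_imp_bounded bounded_iff by (metis imageI real_norm_def)
  show ?thesis
  proof (rule that[of "max L 0"])
    fix x y :: real assume xy: "\<bar>x\<bar> \<le> r" "\<bar>y\<bar> \<le> r"
    have "norm (f x - f y) \<le> max L 0 * norm (x - y)"
    proof (rule field_differentiable_bound[where S="cball 0 r" and f'="deriv f"])
      show "(f has_field_derivative deriv f z) (at z within cball 0 r)" for z
        using smooth_DERIV[OF f] by (rule has_field_derivative_at_within)
      show "norm (deriv f z) \<le> max L 0" if "z \<in> cball 0 r" for z
        using L[OF that] by simp
    qed (use xy in auto)
    then show "\<bar>f x - f y\<bar> \<le> max L 0 * \<bar>x - y\<bar>" by simp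
  qed simp
qed

lemma supp_in_tensor:
  "supp_in a r \<Longrightarrow> supp_in b r \<Longrightarrow> supp_box (\<lambda>z. g z * (a (fst z) * b (snd z))) r"
  by (auto simp: supp_in_def supp_box_def)

lemma continuous_tensor:
  fixes a b :: "real \<Rightarrow> real"
  assumes "continuous_on UNIV a" "continuous_on UNIV b"
  shows "continuous_on UNIV (\<lambda>z :: real \<times> real. a (fst z) * b (snd z))"
  by (intro continuous_on_mult continuous_on_compose2[OF assms(1)] continuous_on_compose2[OF assms(2)])
    (auto intro!: continuous_intros)

lemma (in confining) cutoff_le_1: "0 < R \<Longrightarrow> cutoff R z \<le> 1"
  unfolding cutoff_def using H_ge(3)[of z] by (intro power_le_one) auto

context linear_stationary
begin

definition dissipation :: "real \<Rightarrow> real \<Rightarrow> real \<times> real \<Rightarrow> real" where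
  "dissipation R s z = cutoff R z * (mu z / (mu z + u s z)) ^ 3
    * (u_p s z + snd z * u s z / lam)\<^sup>2 / mu z"

definition tail_mass :: real where
  "tail_mass = (\<integral>z. (15 * lam + 3 * (snd z)\<^sup>2) * mu z \<partial>lborel)"

lemma dissipation_bound:
  assumes R: "0 < R"
  obtains c where "\<And>s. 0 < s \<Longrightarrow> s \<le> 1 \<Longrightarrow>
    integrable lborel (dissipation R s) \<and>
    lam * (\<integral>z. dissipation R s z \<partial>lborel) \<le> c * s + tail_mass / R"
proof -
  obtain L where L: "0 \<le> L" "\<And>q q'. \<bar>q\<bar> \<le> (R + 1) + 1 \<Longrightarrow> \<bar>q'\<bar> \<le> (R + 1) + 1 \<Longrightarrow>
      \<bar>deriv W q - deriv W q'\<bar> \<le> L * \<bar>q - q'\<bar>"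
    using smooth_lipschitz[OF smooth_deriv[OF smooth_W]] by blast
  define cA where "cA = C * K\<^sup>2"
  define cB where "cB = C * K\<^sup>2 * (L + 1)"
  have cA: "0 \<le> cA" and cB: "0 \<le> cB" using C_nonneg L by (auto simp: cA_def cB_def)
  obtain c1 where c1: "0 < c1" "\<And>z. z \<in> square (R + 1) \<Longrightarrow> \<bar>cutoff_p R z\<bar> \<le> c1"
    using continuous_on_square_bounded[OF continuous_cutoff(3)[OF R]] by blast
  have "continuous_on UNIV (\<lambda>z. 1 / (lam * mu z))"
    by (intro continuous_intros continuous_mu) (use mu_pos lam_pos in \<open>auto simp: less_imp_neq[symmetric]\<close>)
  then obtain c2 where c2: "0 < c2" "\<And>z. z \<in> square (R + 1) \<Longrightarrow> \<bar>1 / (lam * mu z)\<bar> \<le> c2"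
    using continuous_on_square_bounded by blast
  define c where "c = (cA + c1 * cB + c2 * cB\<^sup>2) * (\<integral>z. indicator (square (R + 1)) z \<partial>lborel)"
  show ?thesis
  proof (rule that[of c])
    fix s :: real assume s: "0 < s" "s \<le> 1"
    note e = energy_inequality[OF R u_DERIV[OF s] B_DERIV[OF s] u_continuous[OF s] u_nonneg[OF s]
        mollified_equation[OF s]]
    define N where "N z = cutoff R z * \<bar>A s z\<bar> + \<bar>cutoff_p R z\<bar> * \<bar>B s z\<bar>
        + cutoff R z * (B s z)\<^sup>2 / (lam * mu z)" for z
    have N: "N z \<le> (cA + c1 * cB + c2 * cB\<^sup>2) * s * indicator (square (R + 1)) z" for z
    proof (cases "z \<in> square (R + 1)")
      case True
      have A1: "\<bar>A s z\<bar> \<le> cA * s" using A_le[OF s] by (simp add: cA_def)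
      have B1: "\<bar>B s z\<bar> \<le> cB * s" using B_le[OF s L(2) True L(1)] by (simp add: cB_def)
      have "cutoff R z * \<bar>A s z\<bar> \<le> 1 * (cA * s)"
        using A1 cutoff_nonneg cutoff_le_1[OF R] by (intro mult_mono) auto
      moreover have "\<bar>cutoff_p R z\<bar> * \<bar>B s z\<bar> \<le> c1 * (cB * s)"
        using B1 c1 True by (intro mult_mono) auto
      moreover have "cutoff R z * (B s z)\<^sup>2 / (lam * mu z) \<le> c2 * (cB\<^sup>2 * s)"
      proof -
        have "(B s z)\<^sup>2 \<le> (cB * s)\<^sup>2" using B1 by (intro abs_le_square_iff[THEN iffD1]) auto
        also have "\<dots> = cB\<^sup>2 * (s * s)" by (simp add: power2_eq_square)
        also have "\<dots> \<le> cB\<^sup>2 * s" using s by (intro mult_left_mono mult_left_le) auto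
        finally have B2: "(B s z)\<^sup>2 \<le> cB\<^sup>2 * s" .
        have m0: "0 \<le> 1 / (lam * mu z)"
          using mult_pos_pos[OF lam_pos mu_pos[of z]] by simp
        have "cutoff R z * (B s z)\<^sup>2 \<le> 1 * (cB\<^sup>2 * s)"
          by (rule mult_mono[OF cutoff_le_1[OF R] B2]) auto
        moreover have "1 / (lam * mu z) \<le> c2" by (rule abs_le_D1[OF c2(2)[OF True]])
        ultimately have "(cutoff R z * (B s z)\<^sup>2) * (1 / (lam * mu z)) \<le> (1 * (cB\<^sup>2 * s)) * c2"
          by (rule mult_mono[OF _ _ _ m0]) (use s in simp)
        then show ?thesis by (simp add: mult_ac)
      qed
      ultimately have "N z \<le> 1 * (cA * s) + c1 * (cB * s) + c2 * (cB\<^sup>2 * s)"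
        unfolding N_def by linarith
      then show ?thesis using True by (simp add: algebra_simps)
    next
      case False
      then have "cutoff R z = 0" "cutoff_p R z = 0"
        using cutoff_supp[OF R, unfolded supp_box_def, THEN spec, of z] by (auto simp: in_square not_le)
      then show ?thesis using False by (simp add: N_def)
    qed
    have "(\<integral>z. N z \<partial>lborel) \<le> (\<integral>z. (cA + c1 * cB + c2 * cB\<^sup>2) * s * indicator (square (R + 1)) z \<partial>lborel)"
    proof (rule integral_mono')
      show "integrable lborel (\<lambda>z. (cA + c1 * cB + c2 * cB\<^sup>2) * s * indicator (square (R + 1)) z)"
        by (intro integrable_mult_right integrable_indicator_square)
      show "0 \<le> (cA + c1 * cB + c2 * cB\<^sup>2) * s * indicator (square (R + 1)) z" for z
        using cA cB c1 c2 s by simp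
    qed (rule N)
    also have "\<dots> = c * s" by (simp add: c_def)
    finally have "(\<integral>z. N z \<partial>lborel) \<le> c * s" .
    then show "integrable lborel (dissipation R s) \<and>
      lam * (\<integral>z. dissipation R s z \<partial>lborel) \<le> c * s + tail_mass / R"
      using e unfolding dissipation_def[abs_def] N_def tail_mass_def by auto
  qed
qed

text \<open>The distribution \<open>\<rho> / mu\<close> on tensor products. It is constant, see \<open>pairing_product\<close>.\<close>

definition pairing :: "(real \<Rightarrow> real) \<Rightarrow> (real \<Rightarrow> real) \<Rightarrow> real" where
  "pairing a b = (\<integral>z. \<rho> z / mu z * (a (fst z) * b (snd z)) \<partial>lborel)"

lemma continuous_inv_mu: "continuous_on UNIV (\<lambda>z. 1 / mu z)"
  by (intro continuous_intros continuous_mu) (use mu_pos in \<open>auto simp: less_imp_neq[symmetric]\<close>)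

text \<open>The \<open>p\<close>-gradient of \<open>u / mu\<close> is controlled by the dissipation, which vanishes when first the
  mollification parameter tends to zero and then the cutoff radius to infinity.\<close>

lemma pairing_p_derivative:
  assumes a: "continuous_on UNIV a" "supp_in a r"
    and b: "\<And>x. (b has_real_derivative b' x) (at x)" "continuous_on UNIV b'" "supp_in b r"
  shows "pairing a b' = 0"
proof -
  have b'_supp: "supp_in b' r" using supp_in_deriv[OF b(3)] deriv_eqI[OF b(1)] by simp
  have bc: "continuous_on UNIV b" using b(1) by (meson DERIV_isCont continuous_at_imp_continuous_on)
  define f where "f z = 1 / mu z * (a (fst z) * b' (snd z))" for z
  have fc: "continuous_on UNIV f"
    unfolding f_def by (intro continuous_on_mult continuous_inv_mu continuous_tensor a b)
  have fs: "supp_box f r" unfolding f_def by (rule supp_in_tensor[OF a(2) b'_supp])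
  have I: "pairing a b' = (\<integral>z. \<rho> z * f z \<partial>lborel)"
    unfolding pairing_def f_def by (rule Bochner_Integration.integral_cong) auto
  define sn where "sn n = 1 / (real n + 1)" for n
  have sn: "0 < sn n" "sn n \<le> 1" "sn \<longlonglongrightarrow> 0" for n
    using LIMSEQ_inverse_real_of_nat
    by (simp_all add: sn_def[abs_def] divide_le_eq) (simp add: divide_inverse add.commute)
  have lim: "(\<lambda>n. \<integral>z. u (sn n) z * f z \<partial>lborel) \<longlonglongrightarrow> pairing a b'"
    unfolding I u_def by (rule conv_scaled_tendsto[OF sn rho_int rho_nonneg fc fs])

  define D where "D s z = u_p s z + snd z * u s z / lam" for s z
  define g where "g z = 1 / mu z * (a (fst z) * b (snd z))" for z
  have gc: "continuous_on UNIV g"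
    unfolding g_def by (intro continuous_on_mult continuous_inv_mu continuous_tensor a bc)
  have gs: "supp_box g r" unfolding g_def by (rule supp_in_tensor[OF a(2) b(3)])
  obtain cg where cg: "0 < cg" "\<And>z. \<bar>g z\<bar> \<le> cg * indicator (square r) z"
    using continuous_supp_box_bound[OF gc gs] by blast
  have parts: "(\<integral>z. u s z * f z \<partial>lborel) = - (\<integral>z. D s z * g z \<partial>lborel)"
    and iDg: "integrable lborel (\<lambda>z. D s z * g z)" if s: "0 < s" "s \<le> 1" for s
  proof -
    have cD: "continuous_on UNIV (D s)" unfolding D_def
      by (intro continuous_intros u_continuous[OF s]) (use lam_pos in auto)
    have d: "((\<lambda>p. u s (q, p) * g (q, p)) has_real_derivative D s (q, p) * g (q, p) + u s (q, p) * f (q, p)) (at p)"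
      for q p
    proof -
      have m0: "mu (q, p) \<noteq> 0" using mu_pos[of "(q, p)"] by simp
      have "((\<lambda>p. 1 / mu (q, p)) has_real_derivative
         (0 * mu (q, p) - 1 * - (p * mu (q, p) / lam)) / (mu (q, p) * mu (q, p))) (at p)"
        by (intro DERIV_divide DERIV_const mu_DERIV_p m0)
      then have i: "((\<lambda>p. 1 / mu (q, p)) has_real_derivative p / lam * (1 / mu (q, p))) (at p)"
        by (rule DERIV_cong) (use m0 lam_pos in \<open>simp add: field_simps\<close>)
      have "((\<lambda>p. u s (q, p) * (1 / mu (q, p) * (a q * b p))) has_real_derivative
        u_p s (q, p) * (1 / mu (q, p) * (a q * b p)) +
        (p / lam * (1 / mu (q, p)) * (a q * b p) + a q * b' p * (1 / mu (q, p))) * u s (q, p)) (at p)"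
        by (intro DERIV_mult u_DERIV[OF s] i DERIV_cmult b)
      then show ?thesis
        unfolding g_def f_def D_def fst_conv snd_conv
        by (rule DERIV_cong) (simp add: algebra_simps)
    qed
    have iD: "integrable lborel (\<lambda>z. D s z * g z)" and iu: "integrable lborel (\<lambda>z. u s z * f z)"
      by (rule integrable_continuous_supp_box[OF continuous_on_mult[OF cD gc] supp_box_mult(2)[OF gs]]
          integrable_continuous_supp_box[OF continuous_on_mult[OF u_continuous(1)[OF s] fc] supp_box_mult(2)[OF fs]])+
    have "(\<integral>z. D s z * g z + u s z * f z \<partial>lborel) = 0"
      by (rule integral_partial_p(2)[of "\<lambda>z. u s z * g z", OF d _ supp_box_mult(2)[OF gs]])
        (intro continuous_on_add continuous_on_mult cD gc fc u_continuous[OF s])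
    then show "(\<integral>z. u s z * f z \<partial>lborel) = - (\<integral>z. D s z * g z \<partial>lborel)"
      using iD iu by simp
    show "integrable lborel (\<lambda>z. D s z * g z)" by (rule iD)
  qed

  \<comment> \<open>Converts the weighted dissipation into \<open>D\<^sup>2\<close>; the factor 8 bounds the reciprocal of the cutoff, which is at least \<open>(1 / 2) ^ 3\<close> where the energy is at most half the cutoff radius.\<close>
  define h where "h z = 8 * ((mu z + C * K\<^sup>2) ^ 3 / (mu z)\<^sup>2)" for z
  have "continuous_on UNIV h" unfolding h_def
    by (intro continuous_intros continuous_mu) (use mu_pos in \<open>auto simp: less_imp_neq[symmetric]\<close>)
  then obtain ch where ch: "0 < ch" "\<And>z. z \<in> square r \<Longrightarrow> \<bar>h z\<bar> \<le> ch"
    using continuous_on_square_bounded by blast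
  obtain cH where cH: "0 < cH" "\<And>z. z \<in> square r \<Longrightarrow> \<bar>H z\<bar> \<le> cH"
    using continuous_on_square_bounded[OF continuous_H] by blast
  define vol where "vol = (\<integral>z. indicator (square r) z \<partial>lborel :: real)"

  have D2: "(D s z)\<^sup>2 \<le> ch * dissipation R s z"
    if s: "0 < s" "s \<le> 1" and R: "2 * cH \<le> R" and z: "z \<in> square r" for s R z
  proof -
    have "0 < R" using R cH by linarith
    have "H z \<le> cH" using cH(2)[OF z] by linarith
    then have "1 / 2 \<le> max 0 (1 - H z / R)" using R \<open>0 < R\<close> by (simp add: field_simps le_max_iff_disj)
    then have "(1 / 2) ^ 3 \<le> cutoff R z" unfolding cutoff_def by (rule power_mono) simp
    then have c8: "1 / 8 \<le> cutoff R z" by (simp add: power_divide)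
    have m: "0 < mu z" by (rule mu_pos)
    have y: "0 < mu z + u s z" "mu z + u s z \<le> mu z + C * K\<^sup>2"
      using m u_nonneg[OF s, of z] u_le[OF s, of z] by auto
    have h0: "0 < h z" unfolding h_def using m y by (intro mult_pos_pos divide_pos_pos zero_less_power) auto
    have "(D s z)\<^sup>2 = h z * (1 / 8 * (mu z / (mu z + C * K\<^sup>2)) ^ 3 * (D s z)\<^sup>2 / mu z)"
      using m y by (simp add: h_def power_divide power2_eq_square power3_eq_cube)
    also have "\<dots> \<le> h z * (cutoff R z * (mu z / (mu z + u s z)) ^ 3 * (D s z)\<^sup>2 / mu z)"
      using c8 m y h0
      by (intro mult_left_mono divide_right_mono mult_right_mono mult_mono power_mono divide_left_mono) auto
    also have "\<dots> = h z * dissipation R s z" by (simp add: dissipation_def D_def)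
    also have "\<dots> \<le> ch * dissipation R s z"
    proof (rule mult_right_mono)
      show "h z \<le> ch" using ch(2)[OF z] by simp
      show "0 \<le> dissipation R s z" unfolding dissipation_def
        using cutoff_nonneg m y by (auto intro!: divide_nonneg_pos mult_nonneg_nonneg zero_le_power)
    qed
    finally show ?thesis .
  qed

  \<comment> \<open>Young's inequality \<open>2 \<bar>D\<bar> \<le> 1 / t + t D\<^sup>2\<close> with cutoff radius \<open>t\<^sup>2\<close> balances both contributions at order \<open>1 / t\<close>.\<close>
  have main: "t * \<bar>pairing a b'\<bar> \<le> cg * vol + cg * ch * (tail_mass / lam)"
    if t: "max 1 (2 * cH) \<le> t" for t
  proof -
    have t0: "0 < t" "1 \<le> t" "2 * cH \<le> t" using t by auto
    define R where "R = t\<^sup>2"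
    have "t * 1 \<le> t * t" using t0 by (intro mult_left_mono) auto
    then have R: "0 < R" "2 * cH \<le> R" using t0 unfolding R_def power2_eq_square by linarith+
    obtain c where c: "\<And>s. 0 < s \<Longrightarrow> s \<le> 1 \<Longrightarrow> integrable lborel (dissipation R s) \<and>
      lam * (\<integral>z. dissipation R s z \<partial>lborel) \<le> c * s + tail_mass / R"
      using dissipation_bound[OF R(1)] by blast
    have bound: "\<bar>\<integral>z. u s z * f z \<partial>lborel\<bar> \<le> cg * (vol / t + t * (ch * ((c * s + tail_mass / R) / lam)))"
      if s: "0 < s" "s \<le> 1" for s
    proof -
      note cs = c[OF s]
      have "\<bar>\<integral>z. u s z * f z \<partial>lborel\<bar> \<le> (\<integral>z. \<bar>D s z * g z\<bar> \<partial>lborel)"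
        unfolding parts[OF s] abs_minus_cancel by (rule integral_abs_bound)
      also have "\<dots> \<le> (\<integral>z. cg * (1 / t * indicator (square r) z + t * (ch * dissipation R s z)) \<partial>lborel)"
      proof (rule integral_mono)
        show "integrable lborel (\<lambda>z. \<bar>D s z * g z\<bar>)" using iDg[OF s] by (rule integrable_abs)
        show "integrable lborel (\<lambda>z. cg * (1 / t * indicator (square r) z + t * (ch * dissipation R s z)))"
          using cs by (intro integrable_mult_right Bochner_Integration.integrable_add integrable_indicator_square) auto
        fix z
        have d0: "0 \<le> dissipation R s z" unfolding dissipation_def
          using cutoff_nonneg mu_pos[of z] u_nonneg[OF s, of z]
          by (auto intro!: divide_nonneg_pos mult_nonneg_nonneg zero_le_power)
        show "\<bar>D s z * g z\<bar> \<le> cg * (1 / t * indicator (square r) z + t * (ch * dissipation R s z))"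
        proof (cases "z \<in> square r")
          case True
          have "0 \<le> (1 - t * \<bar>D s z\<bar>)\<^sup>2 / t" using t0 by simp
          also have "\<dots> = 1 / t - 2 * \<bar>D s z\<bar> + t * (D s z)\<^sup>2"
            using t0 by (simp add: power2_diff power_mult_distrib diff_divide_distrib add_divide_distrib)
              (simp add: power2_eq_square)
          finally have "2 * \<bar>D s z\<bar> \<le> 1 / t + t * (D s z)\<^sup>2" by simp
          moreover have "t * (D s z)\<^sup>2 \<le> t * (ch * dissipation R s z)"
            using D2[OF s R(2) True] t0 by (intro mult_left_mono) auto
          ultimately have "\<bar>D s z\<bar> \<le> 1 / t + t * (ch * dissipation R s z)" by linarith
          then have "\<bar>D s z\<bar> * \<bar>g z\<bar> \<le> (1 / t + t * (ch * dissipation R s z)) * cg"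
            using cg(2)[of z] True t0 ch d0 by (intro mult_mono) auto
          then show ?thesis using True by (simp add: abs_mult mult.commute)
        next
          case False
          then have "g z = 0" using cg(2)[of z] by simp
          then show ?thesis using cg ch t0 d0 False by simp
        qed
      qed
      also have "\<dots> = cg * (1 / t * vol + t * (ch * (\<integral>z. dissipation R s z \<partial>lborel)))"
        using cs integrable_indicator_square by (simp add: vol_def)
      also have "\<dots> \<le> cg * (vol / t + t * (ch * ((c * s + tail_mass / R) / lam)))"
      proof -
        have "(\<integral>z. dissipation R s z \<partial>lborel) \<le> (c * s + tail_mass / R) / lam"
          using cs lam_pos by (simp add: pos_le_divide_eq mult.commute)
        then have "t * (ch * (\<integral>z. dissipation R s z \<partial>lborel)) \<le> t * (ch * ((c * s + tail_mass / R) / lam))"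
          using t0 ch by (intro mult_left_mono) auto
        then show ?thesis using cg by simp
      qed
      finally show ?thesis .
    qed
    have "(\<lambda>n. cg * (vol / t + t * (ch * ((c * sn n + tail_mass / R) / lam))))
        \<longlonglongrightarrow> cg * (vol / t + t * (ch * ((c * 0 + tail_mass / R) / lam)))"
      by (intro tendsto_intros sn) (use lam_pos in auto)
    moreover have "(\<lambda>n. \<bar>\<integral>z. u (sn n) z * f z \<partial>lborel\<bar>) \<longlonglongrightarrow> \<bar>pairing a b'\<bar>"
      using lim by (rule tendsto_rabs)
    moreover note bounds = bound[OF sn(1,2)]
    ultimately have "\<bar>pairing a b'\<bar> \<le> cg * (vol / t + t * (ch * ((c * 0 + tail_mass / R) / lam)))"
      using LIMSEQ_le by blast
    then have "t * \<bar>pairing a b'\<bar> \<le> t * (cg * (vol / t + t * (ch * ((c * 0 + tail_mass / R) / lam))))"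
      using t0 by (intro mult_left_mono) auto
    also have "\<dots> = cg * vol + cg * ch * (tail_mass / lam)"
      using t0 by (simp add: R_def field_simps power2_eq_square)
    finally show ?thesis .
  qed
  have "\<bar>pairing a b'\<bar> \<le> 0"
    by (rule le_zero_if_scaled_bound[OF main])
  then show ?thesis by simp
qed

end

section \<open>Uniqueness for the linear equation\<close>

lemma integral_diff_cmult:
  fixes f g :: "'a \<Rightarrow> real"
  assumes "integrable M f" "integrable M g"
  shows "(\<integral>x. f x - c * g x \<partial>M) = (\<integral>x. f x \<partial>M) - c * (\<integral>x. g x \<partial>M)"
  using assms by simp

lemma box_real_pair: "box (a, b) (c, d) = {a<..<c} \<times> {b<..<d}" for a b c d :: real
  by (auto simp: box_def Basis_prod_def)

context linear_stationary
begin

lemma nu_locally_bounded: "locally_bounded (\<lambda>z. \<rho> z / mu z)"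
  using locally_bounded_mult[OF rho_locally_bounded locally_bounded_continuous[OF continuous_inv_mu]]
  by simp

lemma pairing_integrable:
  assumes a: "continuous_on UNIV a" "supp_in a r" and b: "continuous_on UNIV b" "supp_in b r'"
  shows "integrable lborel (\<lambda>z. \<rho> z / mu z * (a (fst z) * b (snd z)))"
proof -
  define R where "R = max r r'"
  have s: "supp_in a R" "supp_in b R"
    using a b by (auto intro: supp_in_mono simp: R_def)
  obtain c where c: "0 < c" "\<And>z. \<bar>1 * (a (fst z) * b (snd z))\<bar> \<le> c * indicator (square R) z"
    using continuous_supp_box_bound[OF _ supp_in_tensor[OF s, of "\<lambda>z. 1"]] continuous_tensor[OF a(1) b(1)]
    by auto
  obtain d where d: "\<And>z. z \<in> square R \<Longrightarrow> \<bar>\<rho> z / mu z\<bar> \<le> d"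
    using nu_locally_bounded unfolding locally_bounded_def by blast
  have "\<bar>\<rho> z / mu z * (a (fst z) * b (snd z))\<bar> \<le> d * c * indicator (square R) z" for z
  proof (cases "z \<in> square R")
    case True
    have "\<bar>\<rho> z / mu z\<bar> * \<bar>a (fst z) * b (snd z)\<bar> \<le> d * c"
      using c(2)[of z] d[OF True] True order.trans[OF abs_ge_zero d[OF True]] by (intro mult_mono) auto
    then show ?thesis using True by (simp add: abs_mult)
  qed (use c(2)[of z] in simp)
  moreover have "(\<lambda>z. \<rho> z / mu z * (a (fst z) * b (snd z))) \<in> borel_measurable borel"
    using nu_locally_bounded borel_measurable_continuous_onI[OF continuous_tensor[OF a(1) b(1)]]
    unfolding locally_bounded_def by (elim conjE) (rule borel_measurable_times)
  ultimately show ?thesis by (rule integrable_bounded_on_square[rotated])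
qed

lemma bump_supp_in: "bump_function a r \<Longrightarrow> supp_in a r"
  and bump_continuous: "bump_function a r \<Longrightarrow> continuous_on X a"
  by (auto simp: bump_function_def smooth_continuous)

lemma bump_mono: "bump_function a r \<Longrightarrow> r \<le> r' \<Longrightarrow> bump_function a r'"
  by (auto simp: bump_function_def intro: supp_in_mono)

lemma eta_supp: "supp_in \<eta> 1"
proof -
  have "\<eta> x = 0" if "1 < \<bar>x\<bar>" for x using that by (intro eta_zero) auto
  then show ?thesis by (simp add: supp_in_def)
qed

lemma eta_bump: "bump_function \<eta> 1"
  by (simp add: bump_function_def smooth_eta eta_supp)

lemma bump_integrable: "bump_function a r \<Longrightarrow> integrable lborel a"
proof -
  assume a: "bump_function a r"
  obtain F where "\<And>x. (F has_real_derivative a x) (at x)"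
    using continuous_antiderivative[OF bump_continuous[OF a]] by blast
  moreover have "supp_in a (max r 0)" using a by (auto simp: bump_function_def intro: supp_in_mono)
  ultimately show ?thesis
    using integral_deriv_supp_in[of F a "max r 0"] bump_continuous[OF a] by (auto simp: has_bochner_integral_iff)
qed

text \<open>Subtracting the multiple of \<open>\<eta>\<close> with the same mean leaves a derivative of a bump function, on which
  the pairing vanishes. This reduces the pairing to its value at \<open>\<eta>\<close>.\<close>

lemma bump_diff_mean:
  assumes b: "bump_function b r"
  obtains F r' where "bump_function F r'" "r \<le> r'" "deriv F = (\<lambda>x. b x - (\<integral>x. b x \<partial>lborel) * \<eta> x)"
proof -
  let ?m = "\<integral>x. b x \<partial>lborel" and ?r = "max r 1"
  have bu: "bump_function (\<lambda>x. b x - ?m * \<eta> x) ?r"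
    using bump_mono[OF b, of ?r] bump_mono[OF eta_bump, of ?r]
    by (auto simp: bump_function_def supp_in_def intro: smooth_diff smooth_cmult)
  have "(\<integral>x. b x - ?m * \<eta> x \<partial>lborel) = 0"
    using bump_integrable[OF b] eta_int by (simp add: has_bochner_integral_iff)
  from zero_mean_primitive[OF bu _ this] that show ?thesis by (metis max.cobounded1 max.cobounded2 zero_le_one order.trans)
qed

lemma pairing_diff_left:
  assumes a: "continuous_on UNIV a" "supp_in a r" "continuous_on UNIV a'" "supp_in a' r'"
    and b: "continuous_on UNIV b" "supp_in b r''"
  shows "pairing (\<lambda>x. a x - c * a' x) b = pairing a b - c * pairing a' b"
proof -
  have "pairing (\<lambda>x. a x - c * a' x) b = (\<integral>z. \<rho> z / mu z * (a (fst z) * b (snd z))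
      - c * (\<rho> z / mu z * (a' (fst z) * b (snd z))) \<partial>lborel)"
    unfolding pairing_def by (rule Bochner_Integration.integral_cong) (auto simp: algebra_simps)
  also have "\<dots> = pairing a b - c * pairing a' b"
    unfolding pairing_def
    by (rule integral_diff_cmult[OF pairing_integrable[OF a(1,2) b] pairing_integrable[OF a(3,4) b]])
  finally show ?thesis .
qed

lemma pairing_diff_right:
  assumes b: "continuous_on UNIV b" "supp_in b r" "continuous_on UNIV b'" "supp_in b' r'"
    and a: "continuous_on UNIV a" "supp_in a r''"
  shows "pairing a (\<lambda>x. b x - c * b' x) = pairing a b - c * pairing a b'"
proof -
  have "pairing a (\<lambda>x. b x - c * b' x) = (\<integral>z. \<rho> z / mu z * (a (fst z) * b (snd z))
      - c * (\<rho> z / mu z * (a (fst z) * b' (snd z))) \<partial>lborel)"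
    unfolding pairing_def by (rule Bochner_Integration.integral_cong) (auto simp: algebra_simps)
  also have "\<dots> = pairing a b - c * pairing a b'"
    unfolding pairing_def
    by (rule integral_diff_cmult[OF pairing_integrable[OF a b(1,2)] pairing_integrable[OF a b(3,4)]])
  finally show ?thesis .
qed

lemma pairing_deriv_right:
  assumes a: "continuous_on UNIV a" "supp_in a r" and b: "bump_function b r'"
  shows "pairing a (deriv b) = 0"
proof (rule pairing_p_derivative)
  show "supp_in a (max r r')" "supp_in b (max r r')"
    using a b by (auto intro: supp_in_mono simp: bump_function_def)
qed (use a b in \<open>auto simp: bump_function_def intro: smooth_DERIV smooth_continuous smooth_deriv\<close>)

lemma pairing_mean_right:
  assumes a: "continuous_on UNIV a" "supp_in a r" and b: "bump_function b r'"
  shows "pairing a b = (\<integral>x. b x \<partial>lborel) * pairing a \<eta>"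
proof -
  obtain F s where F: "bump_function F s" "deriv F = (\<lambda>x. b x - (\<integral>x. b x \<partial>lborel) * \<eta> x)"
    using bump_diff_mean[OF b] by metis
  have "0 = pairing a (deriv F)" using pairing_deriv_right[OF a F(1)] by simp
  also have "\<dots> = pairing a b - (\<integral>x. b x \<partial>lborel) * pairing a \<eta>"
    unfolding F(2)
    by (rule pairing_diff_right[OF bump_continuous[OF b] bump_supp_in[OF b]
          bump_continuous[OF eta_bump] bump_supp_in[OF eta_bump] a])
  finally show ?thesis by simp
qed

text \<open>With \<open>p\<close>-derivatives out of the way, the weak equation tested against
  \<open>a(q) exp (W / lam) b(p) exp (p\<^sup>2 / (2 lam))\<close> leaves only the transport term \<open>p a'(q) b(p)\<close>.\<close>

lemma pairing_transport:
  assumes a: "bump_function a r" and b: "bump_function b r"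
  shows "pairing (deriv a) (\<lambda>p. p * b p) = 0"
proof -
  define Eq where "Eq q = exp (W q / lam)" for q
  define Ep where "Ep p = exp (1 / (2 * lam) * p\<^sup>2)" for p
  define \<phi> where "\<phi> q = a q * Eq q" for q
  define \<xi> where "\<xi> p = b p * Ep p" for p
  have sEq: "smooth Eq" unfolding Eq_def by (intro smooth_exp smooth_divide_const smooth_W)
  have sEp: "smooth Ep" unfolding Ep_def by (intro smooth_exp smooth_cmult smooth_power smooth_ident)
  have sa: "smooth a" and sb: "smooth b" using a b by (auto simp: bump_function_def)
  have bump: "bump_function \<phi> r" "bump_function \<xi> r"
    using a b sEq sEp unfolding \<phi>_def[abs_def] \<xi>_def[abs_def]
    by (auto simp: bump_function_def intro: smooth_mult supp_in_mult)
  have dEq: "(Eq has_real_derivative Eq q * (deriv W q / lam)) (at q)" for q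
    unfolding Eq_def by (rule DERIV_fun_exp) (rule DERIV_cdivide[OF W_DERIV])
  have dEp: "(Ep has_real_derivative Ep p * (p / lam)) (at p)" for p
  proof -
    have "((\<lambda>p. 1 / (2 * lam) * p\<^sup>2) has_real_derivative p / lam) (at p)"
      using lam_pos by (auto intro!: derivative_eq_intros)
    then show ?thesis unfolding Ep_def by (rule DERIV_fun_exp)
  qed
  have d\<phi>: "deriv \<phi> = (\<lambda>q. (deriv a q + deriv W q / lam * a q) * Eq q)"
  proof (rule deriv_eqI)
    fix q
    have "(\<phi> has_real_derivative deriv a q * Eq q + Eq q * (deriv W q / lam) * a q) (at q)"
      unfolding \<phi>_def[abs_def] by (intro DERIV_mult smooth_DERIV sa dEq)
    then show "(\<phi> has_real_derivative (deriv a q + deriv W q / lam * a q) * Eq q) (at q)"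
      by (rule DERIV_cong) (simp add: algebra_simps)
  qed
  have d\<xi>: "deriv \<xi> = (\<lambda>p. (deriv b p + p / lam * b p) * Ep p)"
  proof (rule deriv_eqI)
    fix p
    have "(\<xi> has_real_derivative deriv b p * Ep p + Ep p * (p / lam) * b p) (at p)"
      unfolding \<xi>_def[abs_def] by (intro DERIV_mult smooth_DERIV sb dEp)
    then show "(\<xi> has_real_derivative (deriv b p + p / lam * b p) * Ep p) (at p)"
      by (rule DERIV_cong) (simp add: algebra_simps)
  qed
  have d1: "((\<lambda>p. p / lam * b p) has_real_derivative 1 / lam * b p + deriv b p * (p / lam)) (at p)" for p
    by (intro DERIV_mult DERIV_cdivide DERIV_ident smooth_DERIV sb)
  have d2\<xi>: "deriv (deriv \<xi>) = (\<lambda>p. (deriv (deriv b) p + (1 / lam * b p + deriv b p * (p / lam))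
      + p / lam * (deriv b p + p / lam * b p)) * Ep p)"
    unfolding d\<xi>
  proof (rule deriv_eqI)
    fix p
    have "((\<lambda>p. (deriv b p + p / lam * b p) * Ep p) has_real_derivative
       (deriv (deriv b) p + (1 / lam * b p + deriv b p * (p / lam))) * Ep p
        + Ep p * (p / lam) * (deriv b p + p / lam * b p)) (at p)"
      by (intro DERIV_mult DERIV_add d1 dEp smooth_DERIV smooth_deriv sb)
    then show "((\<lambda>p. (deriv b p + p / lam * b p) * Ep p) has_real_derivative
       (deriv (deriv b) p + (1 / lam * b p + deriv b p * (p / lam))
      + p / lam * (deriv b p + p / lam * b p)) * Ep p) (at p)"
      by (rule DERIV_cong) (simp add: algebra_simps)
  qed
  define b2 where "b2 p = lam * deriv b p + p * b p" for p
  have b2: "bump_function b2 r"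
    using b supp_in_deriv[of b r] unfolding b2_def[abs_def]
    by (auto simp: bump_function_def supp_in_def intro!: smooth_add smooth_cmult smooth_mult smooth_ident smooth_deriv)
  have db2: "deriv b2 = (\<lambda>p. lam * deriv (deriv b) p + (1 * b p + deriv b p * p))"
    unfolding b2_def[abs_def]
    by (rule deriv_eqI) (intro DERIV_add DERIV_cmult DERIV_mult DERIV_ident smooth_DERIV smooth_deriv sb)
  have mu_eq: "1 / mu z = Eq (fst z) * Ep (snd z)" for z
  proof -
    have "mu z * (Eq (fst z) * Ep (snd z)) = 1"
      unfolding mu_def Eq_def Ep_def exp_add[symmetric] by simp
    then show ?thesis using mu_pos[of z] by (simp add: divide_eq_eq mult.commute)
  qed
  have lam0: "lam \<noteq> 0" using lam_pos by simp
  let ?T = "\<lambda>a b z. \<rho> z / mu z * (a (fst z) * b (snd z))"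
  \<comment> \<open>The second-order and the friction terms combine into the derivative of \<open>b2\<close>.\<close>
  have point: "\<rho> z * (snd z * (deriv \<phi> (fst z) * \<xi> (snd z))
        - (deriv W (fst z) + snd z) * (\<phi> (fst z) * deriv \<xi> (snd z))
        + lam * (\<phi> (fst z) * deriv (deriv \<xi>) (snd z)))
     = ?T (deriv a) (\<lambda>p. p * b p) z - ?T (\<lambda>q. deriv W q * a q) (deriv b) z + ?T a (deriv b2) z" for z
  proof -
    obtain q p where z: "z = (q, p)" by (cases z)
    have "p * ((deriv a q + deriv W q / lam * a q) * b p) - (deriv W q + p) * (a q * (deriv b p + p / lam * b p))
        + lam * (a q * (deriv (deriv b) p + (1 / lam * b p + deriv b p * (p / lam)) + p / lam * (deriv b p + p / lam * b p)))
      = deriv a q * (p * b p) - deriv W q * a q * deriv b p + a q * (lam * deriv (deriv b) p + (1 * b p + deriv b p * p))"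
      using lam0 by (simp add: field_simps)
    then have "\<rho> z * (1 / mu z) * (p * ((deriv a q + deriv W q / lam * a q) * b p) - (deriv W q + p) * (a q * (deriv b p + p / lam * b p))
        + lam * (a q * (deriv (deriv b) p + (1 / lam * b p + deriv b p * (p / lam)) + p / lam * (deriv b p + p / lam * b p))))
      = \<rho> z * (1 / mu z) * (deriv a q * (p * b p) - deriv W q * a q * deriv b p + a q * (lam * deriv (deriv b) p + (1 * b p + deriv b p * p)))"
      by simp
    moreover have "\<rho> z * (snd z * (deriv \<phi> (fst z) * \<xi> (snd z))
        - (deriv W (fst z) + snd z) * (\<phi> (fst z) * deriv \<xi> (snd z))
        + lam * (\<phi> (fst z) * deriv (deriv \<xi>) (snd z)))
      = \<rho> z * (1 / mu z) * (p * ((deriv a q + deriv W q / lam * a q) * b p) - (deriv W q + p) * (a q * (deriv b p + p / lam * b p))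
        + lam * (a q * (deriv (deriv b) p + (1 / lam * b p + deriv b p * (p / lam)) + p / lam * (deriv b p + p / lam * b p))))"
      unfolding mu_eq d\<phi> d2\<xi> unfolding d\<xi> \<phi>_def \<xi>_def z fst_conv snd_conv by (simp only: algebra_simps)
    ultimately show ?thesis unfolding db2 z fst_conv snd_conv by (simp add: algebra_simps)
  qed
  have ca: "continuous_on UNIV a" "supp_in a r" "continuous_on UNIV (deriv a)" "supp_in (deriv a) r"
    using a sa by (auto simp: bump_function_def intro: smooth_continuous smooth_deriv supp_in_deriv)
  have cWa: "continuous_on UNIV (\<lambda>q. deriv W q * a q)" "supp_in (\<lambda>q. deriv W q * a q) r"
    by (rule continuous_on_mult[OF smooth_continuous[OF smooth_deriv[OF smooth_W]] ca(1)],
        rule supp_in_mult(2)[OF ca(2)])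
  have cpb: "continuous_on UNIV (\<lambda>p. p * b p)" "supp_in (\<lambda>p. p * b p) r"
    by (rule continuous_on_mult[OF continuous_on_id bump_continuous[OF b]],
        rule supp_in_mult(2)[OF bump_supp_in[OF b]])
  have cb: "continuous_on UNIV (deriv b)" "supp_in (deriv b) r" "continuous_on UNIV (deriv b2)" "supp_in (deriv b2) r"
    using b b2 by (auto simp: bump_function_def intro: smooth_continuous smooth_deriv supp_in_deriv)
  have "0 = (\<integral>z. ?T (deriv a) (\<lambda>p. p * b p) z - ?T (\<lambda>q. deriv W q * a q) (deriv b) z + ?T a (deriv b2) z \<partial>lborel)"
    using weak[OF bump] unfolding point by simp
  also have "\<dots> = pairing (deriv a) (\<lambda>p. p * b p) - pairing (\<lambda>q. deriv W q * a q) (deriv b) + pairing a (deriv b2)"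
    unfolding pairing_def
    by (subst Bochner_Integration.integral_add Bochner_Integration.integral_diff;
        (intro Bochner_Integration.integrable_diff)?;
        (rule pairing_integrable[OF ca(3,4) cpb] pairing_integrable[OF cWa cb(1,2)]
           pairing_integrable[OF ca(1,2) cb(3,4)] refl)?)+
  also have "pairing (\<lambda>q. deriv W q * a q) (deriv b) = 0" by (rule pairing_deriv_right[OF cWa b])
  also have "pairing a (deriv b2) = 0" by (rule pairing_deriv_right[OF ca(1,2) b2])
  finally show ?thesis by simp
qed

text \<open>A distribution with vanishing derivatives in both variables is a multiple of Lebesgue measure. The
  transport identity carries the weight \<open>p\<close>, which is removed by choosing a function of \<open>p\<close> with
  nonzero first moment.\<close>

lemma pairing_product:
  assumes a: "bump_function a r" and b: "bump_function b r"
  shows "pairing a b = (\<integral>x. a x \<partial>lborel) * (\<integral>x. b x \<partial>lborel) * pairing \<eta> \<eta>"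
proof -
  have pe: "bump_function (\<lambda>p. p * \<eta> p) 1"
    using eta_bump by (auto simp: bump_function_def intro: smooth_mult smooth_ident supp_in_mult)
  have nn: "0 \<le> p * \<eta> p" for p
    using eta_nonneg[of p] eta_zero[of p] by (cases "p \<in> {0<..<1}") auto
  have kpos: "0 < (\<integral>p. p * \<eta> p \<partial>lborel)"
    by (rule integral_pos_if_pos_on_interval[OF bump_integrable[OF pe] nn, of 0 1])
      (auto intro!: mult_pos_pos eta_pos)
  obtain F s where F: "bump_function F s" "r \<le> s" "deriv F = (\<lambda>x. a x - (\<integral>x. a x \<partial>lborel) * \<eta> x)"
    using bump_diff_mean[OF a] by metis
  have dF: "continuous_on UNIV (deriv F)" "supp_in (deriv F) s"
    using F(1) by (auto simp: bump_function_def intro: smooth_continuous smooth_deriv supp_in_deriv)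
  have "pairing (deriv F) (\<lambda>p. p * \<eta> p) = 0"
    using bump_mono[OF F(1), of "max s 1"] bump_mono[OF eta_bump, of "max s 1"]
    by (intro pairing_transport) auto
  then have "pairing (deriv F) \<eta> = 0"
    using pairing_mean_right[OF dF pe] kpos by simp
  moreover have "pairing (deriv F) \<eta> = pairing a \<eta> - (\<integral>x. a x \<partial>lborel) * pairing \<eta> \<eta>"
    unfolding F(3)
    by (rule pairing_diff_left[OF bump_continuous[OF a] bump_supp_in[OF a]
          bump_continuous[OF eta_bump] bump_supp_in[OF eta_bump]
          bump_continuous[OF eta_bump] bump_supp_in[OF eta_bump]])
  ultimately have "pairing a \<eta> = (\<integral>x. a x \<partial>lborel) * pairing \<eta> \<eta>" by simp
  then show ?thesis
    using pairing_mean_right[OF bump_continuous[OF a] bump_supp_in[OF a] b] by simp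
qed

text \<open>Products of steeper and steeper smooth steps at the two end points.\<close>

lemma ex_plateaus:
  obtains P :: "real \<Rightarrow> real \<Rightarrow> nat \<Rightarrow> real \<Rightarrow> real"
  where "\<And>x y n. bump_function (P x y n) (max \<bar>x\<bar> \<bar>y\<bar>)" "\<And>x y n t. 0 \<le> P x y n t" "\<And>x y n t. P x y n t \<le> 1"
    "\<And>x y t. (\<lambda>n. P x y n t) \<longlonglongrightarrow> indicator {x<..<y} t"
    "\<And>x y n t. t \<notin> {x<..<y} \<Longrightarrow> P x y n t = 0"
proof -
  obtain G where G: "\<And>x. (G has_real_derivative \<eta> x) (at x)"
    using continuous_antiderivative[OF smooth_continuous[OF smooth_eta]] by blast
  define S where "S x = G x - G 0" for x
  have S: "(S has_real_derivative \<eta> x) (at x)" for x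
    using G unfolding S_def by (auto intro!: derivative_eq_intros)
  have sS: "smooth S" by (rule smooth_primitive[OF S smooth_eta])
  have mono: "S x \<le> S y" if "x \<le> y" for x y
    using that S eta_nonneg by (intro DERIV_nonneg_imp_nondecreasing[OF that]) blast
  have const: "S x = S y" if "x \<le> y" "\<And>t. x < t \<Longrightarrow> t < y \<Longrightarrow> \<eta> t = 0" for x y
  proof (cases "x = y")
    case False
    then have "x < y" using that by simp
    from MVT2[OF this S] that show ?thesis by force
  qed simp
  have S0: "S x = 0" if "x \<le> 0" for x
    using const[of x 0] that eta_zero by (simp add: S_def)
  have S11: "S 1 = 1"
    using integral_deriv_supp_in[OF S smooth_continuous[OF smooth_eta] eta_supp] S0[of "-1"] eta_int
    by (auto simp: has_bochner_integral_iff)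
  have S1: "S x = 1" if "1 \<le> x" for x
    using const[of 1 x] that eta_zero S11 by simp
  have S01: "0 \<le> S x" "S x \<le> 1" for x
    using mono[of 0 x] mono[of x 1] S0[of 0] S0[of x] S1[of x] S11 by (cases "x \<le> 0"; cases "1 \<le> x"; simp)+
  define P where "P x y n t = S (real n * t + - (real n * x)) * S (- real n * t + real n * y)" for x y n t
  have zero: "P x y n t = 0" if "t \<notin> {x<..<y}" for x y n t
  proof -
    have "real n * t + - (real n * x) \<le> 0 \<or> - real n * t + real n * y \<le> 0"
      using that by (auto simp: mult_left_mono)
    then show ?thesis using S0 by (auto simp: P_def)
  qed
  show ?thesis
  proof (rule that[of P])
    fix x y n
    have "P x y n t = 0" if "max \<bar>x\<bar> \<bar>y\<bar> < \<bar>t\<bar>" for t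
      using that by (intro zero) auto
    moreover have "smooth (P x y n)"
      unfolding P_def[abs_def] by (intro smooth_mult smooth_affine sS)
    ultimately show "bump_function (P x y n) (max \<bar>x\<bar> \<bar>y\<bar>)"
      by (simp add: bump_function_def supp_in_def)
  next
    fix x y t
    show "(\<lambda>n. P x y n t) \<longlonglongrightarrow> indicator {x<..<y} t"
    proof (cases "t \<in> {x<..<y}")
      case True
      define d where "d = min (t - x) (y - t)"
      have d: "0 < d" using True by (simp add: d_def)
      obtain N where N: "1 / d < real N" using reals_Archimedean2 by blast
      have "P x y n t = 1" if "N \<le> n" for n
      proof -
        have "1 \<le> real n * d" using N that d by (simp add: divide_less_eq) (smt (verit) mult_right_mono of_nat_mono)
        moreover have "real n * d \<le> real n * (t - x)" "real n * d \<le> real n * (y - t)"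
          by (auto intro!: mult_left_mono simp: d_def)
        ultimately show ?thesis by (simp add: P_def S1 algebra_simps)
      qed
      then have "eventually (\<lambda>n. P x y n t = 1) sequentially"
        by (auto simp: eventually_sequentially)
      then show ?thesis using True by (simp add: tendsto_eventually)
    qed (simp add: zero)
  qed (use S01 zero in \<open>auto simp: P_def intro: mult_le_one\<close>)
qed

text \<open>The identity \<open>pairing_product\<close> passes from bump functions to open boxes, and boxes determine a
  measure.\<close>

theorem stationary_density_unique:
  obtains c where "AE z in lborel. \<rho> z = c * mu z"
proof -
  obtain P where P: "\<And>x y n. bump_function (P x y n) (max \<bar>x\<bar> \<bar>y\<bar>)" "\<And>x y n t. 0 \<le> P x y n t"
    "\<And>x y n t. P x y n t \<le> 1" "\<And>x y t. (\<lambda>n. P x y n t) \<longlonglongrightarrow> indicator {x<..<y} t"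
    "\<And>x y n t. t \<notin> {x<..<y} \<Longrightarrow> P x y n t = (0::real)"
    using ex_plateaus by blast
  define c where "c = pairing \<eta> \<eta>"
  have c0: "0 \<le> c" unfolding c_def pairing_def
    by (intro Bochner_Integration.integral_nonneg mult_nonneg_nonneg divide_nonneg_pos eta_nonneg rho_nonneg mu_pos)
  have nu_m: "(\<lambda>z. \<rho> z / mu z) \<in> borel_measurable borel"
    using nu_locally_bounded by (simp add: locally_bounded_def)
  have nu0: "0 \<le> \<rho> z / mu z" for z using rho_nonneg mu_pos by (simp add: divide_nonneg_pos)
  have P_le: "P x y n t \<le> indicator {x<..<y} t" for x y n t
    using P(3)[of x y n t] P(5)[of t x y n] by (cases "t \<in> {x<..<y}") auto
  have len: "(\<lambda>n. \<integral>t. P x y n t \<partial>lborel) \<longlonglongrightarrow> y - x" if "x \<le> y" for x y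
  proof -
    have "(\<lambda>n. \<integral>t. P x y n t \<partial>lborel) \<longlonglongrightarrow> (\<integral>t. indicator {x<..<y} t \<partial>lborel)"
    proof (rule integral_dominated_convergence[where w="indicator {x<..<y}"])
      show "P x y n \<in> borel_measurable lborel" for n
        using bump_continuous[OF P(1)] by (simp add: borel_measurable_continuous_onI)
    qed (use P P_le that in \<open>auto simp: integrable_indicator_iff\<close>)
    then show ?thesis using that by simp
  qed
  have box: "emeasure (density lborel (\<lambda>z. ennreal (\<rho> z / mu z))) (box (x, x') (y, y'))
      = ennreal c * emeasure lborel (box (x, x') (y, y'))" if le: "x \<le> y" "x' \<le> y'" for x y x' y'
  proof -
    let ?B = "box (x, x') (y, y')"
    define R where "R = max (max \<bar>x\<bar> \<bar>y\<bar>) (max \<bar>x'\<bar> \<bar>y'\<bar>)"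
    have bP: "bump_function (P x y n) R" "bump_function (P x' y' n) R" for n
      using P(1) by (auto intro!: bump_mono[OF P(1)] simp: R_def)
    have ind: "indicator {x<..<y} (fst z) * indicator {x'<..<y'} (snd z) = (indicator ?B z :: real)" for z
      by (cases z) (auto simp: indicator_def box_real_pair)
    obtain d where d: "\<And>z. z \<in> square R \<Longrightarrow> \<bar>\<rho> z / mu z\<bar> \<le> d"
      using nu_locally_bounded unfolding locally_bounded_def by blast
    have sub: "?B \<subseteq> square R"
      by (auto simp: box_real_pair in_square R_def abs_real_def max_def)
    have dom: "integrable lborel (\<lambda>z. \<rho> z / mu z * indicator ?B z)"
    proof (rule integrable_bounded_on_square)
      show "\<bar>\<rho> z / mu z * indicator ?B z\<bar> \<le> d * indicator (square R) z" for z
        using d[of z] sub nu0[of z] order.trans[OF abs_ge_zero d[of z]] by (cases "z \<in> ?B"; cases "z \<in> square R") auto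
      show "(\<lambda>z. \<rho> z / mu z * indicator ?B z) \<in> borel_measurable borel"
        by (intro borel_measurable_times nu_m borel_measurable_indicator) auto
    qed
    have "(\<lambda>n. pairing (P x y n) (P x' y' n)) \<longlonglongrightarrow> (\<integral>z. \<rho> z / mu z * indicator ?B z \<partial>lborel)"
      unfolding pairing_def
    proof (rule integral_dominated_convergence[OF _ _ dom])
      show "AE z in lborel. (\<lambda>n. \<rho> z / mu z * (P x y n (fst z) * P x' y' n (snd z)))
          \<longlonglongrightarrow> \<rho> z / mu z * indicator ?B z"
        unfolding ind[symmetric] by (intro AE_I2 tendsto_intros P)
      show "AE z in lborel. norm (\<rho> z / mu z * (P x y n (fst z) * P x' y' n (snd z)))
          \<le> \<rho> z / mu z * indicator ?B z" for n
      proof (rule AE_I2)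
        fix z
        have "P x y n (fst z) * P x' y' n (snd z) \<le> indicator {x<..<y} (fst z) * indicator {x'<..<y'} (snd z)"
          by (intro mult_mono P_le P) auto
        then have "\<rho> z / mu z * (P x y n (fst z) * P x' y' n (snd z)) \<le> \<rho> z / mu z * indicator ?B z"
          unfolding ind using nu0 by (intro mult_left_mono) auto
        moreover have "0 \<le> \<rho> z / mu z * (P x y n (fst z) * P x' y' n (snd z))"
          by (intro mult_nonneg_nonneg nu0 P)
        ultimately show "norm (\<rho> z / mu z * (P x y n (fst z) * P x' y' n (snd z)))
          \<le> \<rho> z / mu z * indicator ?B z" by (simp only: real_norm_def abs_of_nonneg)
      qed
      show "(\<lambda>z. \<rho> z / mu z * (P x y n (fst z) * P x' y' n (snd z))) \<in> borel_measurable lborel" for n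
        using pairing_integrable[OF bump_continuous[OF bP(1)] bump_supp_in[OF bP(1)]
            bump_continuous[OF bP(2)] bump_supp_in[OF bP(2)]] by auto
    qed (use dom in auto)
    moreover have "(\<lambda>n. pairing (P x y n) (P x' y' n)) \<longlonglongrightarrow> (y - x) * (y' - x') * c"
      unfolding c_def pairing_product[OF bP] by (intro tendsto_intros len le)
    ultimately have eq: "(\<integral>z. \<rho> z / mu z * indicator ?B z \<partial>lborel) = (y - x) * (y' - x') * c"
      by (rule LIMSEQ_unique)
    have "emeasure (density lborel (\<lambda>z. ennreal (\<rho> z / mu z))) ?B
        = (\<integral>\<^sup>+z. ennreal (\<rho> z / mu z) * indicator ?B z \<partial>lborel)"
      using nu_m by (subst emeasure_density) auto
    also have "\<dots> = (\<integral>\<^sup>+z. ennreal (\<rho> z / mu z * indicator ?B z) \<partial>lborel)"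
      by (intro nn_integral_cong) (auto simp: indicator_def)
    also have "\<dots> = ennreal ((y - x) * (y' - x') * c)"
      unfolding eq[symmetric]
      by (rule nn_integral_eq_integral[OF dom]) (intro AE_I2 mult_nonneg_nonneg nu0 indicator_pos_le)
    also have "\<dots> = ennreal c * ennreal ((y - x) * (y' - x'))"
      using c0 le by (subst ennreal_mult[symmetric]) (auto simp: mult.commute)
    also have "ennreal ((y - x) * (y' - x')) = emeasure lborel ?B"
      using le by (subst emeasure_lborel_box_eq)
        (auto simp: Basis_prod_def prod.union_disjoint image_iff mult.commute)
    finally show ?thesis .
  qed
  have meq: "density lborel (\<lambda>z. ennreal (\<rho> z / mu z)) = density lborel (\<lambda>z. ennreal c)"
  proof (rule measure_eqI_generator_eq)
    let ?E = "range (\<lambda>(a, b). box a b :: (real \<times> real) set)"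
    show "Int_stable ?E" by (auto simp: Int_stable_def box_Int_box)
    show "?E \<subseteq> Pow UNIV" "sets (density lborel (\<lambda>z. ennreal (\<rho> z / mu z))) = sigma_sets UNIV ?E"
      "sets (density lborel (\<lambda>z::real\<times>real. ennreal c)) = sigma_sets UNIV ?E"
      by (simp_all add: borel_eq_box)
    let ?A = "\<lambda>n::nat. box (- real n, - real n) (real n, real n)"
    show "range ?A \<subseteq> ?E" by auto
    show "(\<Union>i. ?A i) = UNIV"
    proof (intro equalityI subsetI UNIV_I)
      fix z :: "real \<times> real"
      obtain n where "max \<bar>fst z\<bar> \<bar>snd z\<bar> < real n" using reals_Archimedean2 by blast
      then have "z \<in> ?A n" by (cases z) (auto simp: box_real_pair abs_less_iff)
      then show "z \<in> (\<Union>i. ?A i)" by blast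
    qed
    have cE: "emeasure (density lborel (\<lambda>z::real\<times>real. ennreal c)) X = ennreal c * emeasure lborel X"
      if "X \<in> sets borel" for X
      using that by (simp add: emeasure_density nn_integral_cmult)
    show "emeasure (density lborel (\<lambda>z. ennreal (\<rho> z / mu z))) X = emeasure (density lborel (\<lambda>z. ennreal c)) X"
      if "X \<in> ?E" for X
    proof -
      obtain x x' y y' where X: "X = box (x, x') (y, y')" using \<open>X \<in> ?E\<close> by auto
      show ?thesis
      proof (cases "x \<le> y \<and> x' \<le> y'")
        case True
        then show ?thesis unfolding X using box cE by simp
      next
        case False
        then have "X = {}" by (auto simp: X box_real_pair)
        then show ?thesis by simp
      qed
    qed
    show "emeasure (density lborel (\<lambda>z. ennreal (\<rho> z / mu z))) (?A i) \<noteq> \<infinity>" for i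
      by (subst box) (auto simp: ennreal_mult_eq_top_iff emeasure_lborel_box_eq)
  qed
  have "AE z in lborel. ennreal (\<rho> z / mu z) = ennreal c"
    by (rule sigma_finite_measure.density_unique_iff[OF sigma_finite_lborel, THEN iffD1, OF _ _ meq]) (use nu_m in auto)
  then have "AE z in lborel. \<rho> z = c * mu z"
  proof eventually_elim
    fix z assume "ennreal (\<rho> z / mu z) = ennreal c"
    then have "\<rho> z / mu z = c" using nu0 c0 by simp
    then show "\<rho> z = c * mu z" using mu_pos[of z] by (simp add: divide_eq_eq)
  qed
  then show ?thesis by (rule that)
qed

end

section \<open>Integrals over the line\<close>

lemma integral_deriv_line:
  fixes F f :: "real \<Rightarrow> real"
  assumes d: "\<And>x. (F has_real_derivative f x) (at x)" and c: "continuous_on UNIV f"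
    and i: "integrable lborel f"
    and lim: "(\<lambda>n. F (real n)) \<longlonglongrightarrow> 0" "(\<lambda>n. F (- real n)) \<longlonglongrightarrow> 0"
  shows "(\<integral>x. f x \<partial>lborel) = 0"
proof -
  let ?s = "\<lambda>n x. f x * indicator {- real n..real n} x"
  have "(\<lambda>n. \<integral>x. ?s n x \<partial>lborel) \<longlonglongrightarrow> (\<integral>x. f x \<partial>lborel)"
  proof (rule integral_dominated_convergence[where w="\<lambda>x. \<bar>f x\<bar>"])
    show "AE x in lborel. (\<lambda>n. ?s n x) \<longlonglongrightarrow> f x"
    proof (rule AE_I2)
      fix x
      obtain N where N: "\<bar>x\<bar> < real N" using reals_Archimedean2 by blast
      have "eventually (\<lambda>n. ?s n x = f x) sequentially"
        unfolding eventually_sequentially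
      proof (intro exI[of _ N] allI impI)
        fix n assume "N \<le> n"
        then have "\<bar>x\<bar> < real n" using N by (meson less_le_trans of_nat_le_iff)
        then have "x \<in> {- real n..real n}" by auto
        then show "?s n x = f x" by simp
      qed
      then show "(\<lambda>n. ?s n x) \<longlonglongrightarrow> f x" by (rule tendsto_eventually)
    qed
  qed (use i in \<open>auto simp: indicator_def\<close>)
  moreover have "(\<integral>x. ?s n x \<partial>lborel) = F (real n) - F (- real n)" for n
    using c by (intro integral_FTC_Icc_real) (auto intro: d simp: continuous_on_eq_continuous_at)
  moreover have "(\<lambda>n. F (real n) - F (- real n)) \<longlonglongrightarrow> 0 - 0"
    using lim by (rule tendsto_diff)
  ultimately show ?thesis using LIMSEQ_unique by fastforce
qed

lemma integral_pos_except_finite: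
  fixes f :: "real \<Rightarrow> real"
  assumes i: "integrable lborel f" and nn: "\<And>x. 0 \<le> f x" and X: "finite X"
    and pos: "\<And>x. x \<notin> X \<Longrightarrow> 0 < f x"
  shows "0 < (\<integral>x. f x \<partial>lborel)"
proof -
  obtain M where M: "\<And>x. x \<in> X \<Longrightarrow> x \<le> M"
    using bdd_above_finite[OF X] unfolding bdd_above_def by blast
  show ?thesis
    by (rule integral_pos_if_pos_on_interval[OF i nn, of M "M + 1"]) (auto intro!: pos dest: M)
qed

lemma integral_reflect: "(\<integral>x. f (- x) \<partial>lborel) = (\<integral>x. f x \<partial>lborel)" for f :: "real \<Rightarrow> real"
  using lborel_integral_real_affine[of "-1" f 0] by simp

lemma integrable_reflect: "integrable lborel (\<lambda>x. f (- x)) \<longleftrightarrow> integrable lborel f" for f :: "real \<Rightarrow> real"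
  using lborel_integrable_real_affine_iff[of "-1" f 0] by simp

context confining
begin

lemma weight_continuous: "continuous_on UNIV (\<lambda>q. exp (- (W q / lam)))"
  by (intro continuous_intros smooth_continuous smooth_W) (use lam_pos in auto)

lemma weight_moment_integrable: "integrable lborel (\<lambda>q. q ^ n * exp (- (W q / lam)))"
proof (rule Bochner_Integration.integrable_bound[OF integrable_weight[of n]])
  show "(\<lambda>q. q ^ n * exp (- (W q / lam))) \<in> borel_measurable lborel"
    using weight_continuous by (auto intro!: borel_measurable_continuous_onI continuous_intros
        borel_measurable_times)
qed (auto simp: power_abs abs_mult)

lemma weight_moment_tendsto:
  assumes x: "filterlim (\<lambda>n. \<bar>x n\<bar>) at_top sequentially"
  shows "(\<lambda>n::nat. x n ^ k * exp (- (W (x n) / lam))) \<longlonglongrightarrow> 0"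
proof (rule Lim_null_comparison)
  have b: "norm (q ^ k * exp (- (W q / lam))) \<le> exp (k0 / lam) * (\<bar>q\<bar> ^ k * exp (- (\<bar>q\<bar> / lam)))" for q
  proof -
    have "- (W q / lam) \<le> k0 / lam + - (\<bar>q\<bar> / lam)"
      using W_ge[of q] lam_pos by (simp add: field_simps)
    then have "exp (- (W q / lam)) \<le> exp (k0 / lam) * exp (- (\<bar>q\<bar> / lam))"
      unfolding exp_add[symmetric] by simp
    then have "\<bar>q\<bar> ^ k * exp (- (W q / lam)) \<le> \<bar>q\<bar> ^ k * (exp (k0 / lam) * exp (- (\<bar>q\<bar> / lam)))"
      by (rule mult_left_mono) simp
    then show ?thesis by (simp add: abs_mult power_abs mult_ac)
  qed
  then show "\<forall>\<^sub>F n in sequentially. norm (x n ^ k * exp (- (W (x n) / lam)))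
      \<le> exp (k0 / lam) * (\<bar>x n\<bar> ^ k * exp (- (\<bar>x n\<bar> / lam)))" by simp
  have "((\<lambda>y. lam ^ k * (y ^ k / exp y)) \<longlongrightarrow> lam ^ k * 0) at_top"
    by (intro tendsto_intros tendsto_power_div_exp_0)
  moreover have "filterlim (\<lambda>n. \<bar>x n\<bar> / lam) at_top sequentially"
    using lam_pos filterlim_tendsto_pos_mult_at_top[OF tendsto_const[of "1 / lam"] _ x] by simp
  ultimately have "(\<lambda>n. lam ^ k * ((\<bar>x n\<bar> / lam) ^ k / exp (\<bar>x n\<bar> / lam))) \<longlonglongrightarrow> lam ^ k * 0"
    by (rule filterlim_compose)
  moreover have "lam ^ k * ((y / lam) ^ k / exp (y / lam)) = y ^ k * exp (- (y / lam))" for y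
    using lam_pos by (simp add: power_divide exp_minus inverse_eq_divide)
  ultimately have "(\<lambda>n. \<bar>x n\<bar> ^ k * exp (- (\<bar>x n\<bar> / lam))) \<longlonglongrightarrow> 0" by simp
  then show "(\<lambda>n. exp (k0 / lam) * (\<bar>x n\<bar> ^ k * exp (- (\<bar>x n\<bar> / lam)))) \<longlonglongrightarrow> 0"
    by (rule tendsto_mult_right_zero)
qed

text \<open>Integration by parts against the Gibbs weight: there are no boundary terms at infinity.\<close>

lemma weight_moment_deriv_integral:
  assumes d: "\<And>q. ((\<lambda>q. q ^ k * exp (- (W q / lam))) has_real_derivative f q) (at q)"
    and c: "continuous_on UNIV f" and i: "integrable lborel f"
  shows "(\<integral>q. f q \<partial>lborel) = 0"
proof (rule integral_deriv_line[OF d c i])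
  have f: "filterlim real at_top sequentially" by (rule filterlim_real_sequentially)
  show "(\<lambda>n. real n ^ k * exp (- (W (real n) / lam))) \<longlonglongrightarrow> 0"
    "(\<lambda>n. (- real n) ^ k * exp (- (W (- real n) / lam))) \<longlonglongrightarrow> 0"
    by (rule weight_moment_tendsto; use f in simp)+
qed

end

text \<open>The derivative of \<open>f / g\<close> is the Wronskian divided by \<open>g\<^sup>2\<close>.\<close>

lemma quotient_less_if_wronskian_pos:
  fixes f g f' g' :: "real \<Rightarrow> real"
  assumes f: "\<And>x. (f has_real_derivative f' x) (at x)" and g: "\<And>x. (g has_real_derivative g' x) (at x)"
    and gp: "\<And>x. 0 < x \<Longrightarrow> 0 < g x" and w: "\<And>x. 0 < x \<Longrightarrow> 0 < f' x * g x - f x * g' x"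
    and ab: "0 < a" "a < b"
  shows "f a / g a < f b / g b"
proof (rule DERIV_pos_imp_increasing[OF ab(2)])
  fix x assume x: "a \<le> x" "x \<le> b"
  then have x0: "0 < x" using ab by simp
  have "((\<lambda>x. f x / g x) has_real_derivative (f' x * g x - f x * g' x) / (g x * g x)) (at x)"
    using gp[OF x0] by (intro DERIV_divide f g) auto
  moreover have "0 < (f' x * g x - f x * g' x) / (g x * g x)"
    using w[OF x0] gp[OF x0] by simp
  ultimately show "\<exists>y. ((\<lambda>x. f x / g x) has_real_derivative y) (at x) \<and> 0 < y" by blast
qed

lemma pos_if_deriv_pos:
  fixes f f' :: "real \<Rightarrow> real"
  assumes "\<And>x. (f has_real_derivative f' x) (at x)" "f 0 = 0" "\<And>x. 0 < x \<Longrightarrow> 0 < f' x" "0 < x"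
  shows "0 < f x"
proof -
  obtain z where "0 < z" "z < x" "f x - f 0 = (x - 0) * f' z"
    using MVT2[OF assms(4), of f f'] assms(1) by blast
  then show ?thesis using assms by simp
qed

lemma sinh_DERIV: "((\<lambda>x. sinh (t * x)) has_real_derivative t * cosh (t * x)) (at x)"
  and cosh_DERIV: "((\<lambda>x. cosh (t * x)) has_real_derivative t * sinh (t * x)) (at x)" for t x :: real
  by (auto intro!: derivative_eq_intros)

lemma sinh_sinh_ratio:
  fixes s t :: real
  assumes st: "0 < s" "s < t" and ab: "0 < a" "a < b"
  shows "sinh (t * a) / sinh (s * a) < sinh (t * b) / sinh (s * b)"
proof (rule quotient_less_if_wronskian_pos[OF sinh_DERIV sinh_DERIV _ _ ab])
  fix x :: real assume x: "0 < x"
  show "0 < sinh (s * x)" using st x by simp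
  show "0 < t * cosh (t * x) * sinh (s * x) - sinh (t * x) * (s * cosh (s * x))"
  proof (rule pos_if_deriv_pos[OF _ _ _ x, where f="\<lambda>x. t * cosh (t * x) * sinh (s * x) - sinh (t * x) * (s * cosh (s * x))"])
    show "((\<lambda>x. t * cosh (t * x) * sinh (s * x) - sinh (t * x) * (s * cosh (s * x))) has_real_derivative
      (t\<^sup>2 - s\<^sup>2) * (sinh (t * y) * sinh (s * y))) (at y)" for y
    proof -
      have "((\<lambda>x. t * cosh (t * x) * sinh (s * x) - sinh (t * x) * (s * cosh (s * x))) has_real_derivative
        (t * (t * sinh (t * y)) * sinh (s * y) + s * cosh (s * y) * (t * cosh (t * y)))
        - (t * cosh (t * y) * (s * cosh (s * y)) + s * (s * sinh (s * y)) * sinh (t * y))) (at y)"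
        by (intro DERIV_diff DERIV_mult DERIV_cmult sinh_DERIV cosh_DERIV)
      then show ?thesis by (rule DERIV_cong) (simp add: algebra_simps power2_eq_square)
    qed
    show "0 < (t\<^sup>2 - s\<^sup>2) * (sinh (t * y) * sinh (s * y))" if "0 < y" for y
      using st that by (intro mult_pos_pos) (auto simp: power2_eq_square intro: mult_strict_mono)
  qed simp
qed

lemma sinh_linear_ratio:
  fixes t :: real
  assumes t: "0 < t" and ab: "0 < a" "a < b"
  shows "sinh (t * a) / a < sinh (t * b) / b"
proof (rule quotient_less_if_wronskian_pos[OF sinh_DERIV DERIV_ident _ _ ab])
  fix x :: real assume x: "0 < x"
  show "0 < t * cosh (t * x) * x - sinh (t * x) * 1"
  proof (rule pos_if_deriv_pos[OF _ _ _ x, where f="\<lambda>x. t * cosh (t * x) * x - sinh (t * x) * 1"])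
    show "((\<lambda>x. t * cosh (t * x) * x - sinh (t * x) * 1) has_real_derivative t\<^sup>2 * (sinh (t * y) * y)) (at y)" for y
    proof -
      have "((\<lambda>x. t * cosh (t * x) * x - sinh (t * x) * 1) has_real_derivative
        (t * (t * sinh (t * y)) * y + 1 * (t * cosh (t * y))) - (t * cosh (t * y) * 1)) (at y)"
        by (intro DERIV_diff DERIV_mult DERIV_cmult DERIV_cmult_right sinh_DERIV cosh_DERIV DERIV_ident)
      then show ?thesis by (rule DERIV_cong) (simp add: algebra_simps power2_eq_square)
    qed
    show "0 < t\<^sup>2 * (sinh (t * y) * y)" if "0 < y" for y using t that by simp
  qed simp
qed simp

section \<open>Double-well potentials and the self-consistency function\<close>

locale double_well =
  fixes v \<alpha> :: real and c :: "nat \<Rightarrow> real" and r :: nat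
  assumes v_pos: "0 < v" and alpha_pos: "0 < \<alpha>" and r_ge: "2 \<le> r"
    and c_nonneg: "\<And>j. 0 \<le> c j" and c_r: "0 < c r"
begin

definition V :: "real \<Rightarrow> real" where
  "V x = - v / 2 * x\<^sup>2 + (\<Sum>j=2..r. c j * x ^ (2 * j))"

text \<open>The factor in \<open>V'(x) = x P(x)\<close>; it is even and increasing in \<open>\<bar>x\<bar>\<close>.\<close>

definition P :: "real \<Rightarrow> real" where
  "P x = (\<Sum>j=2..r. 2 * real j * c j * x ^ (2 * j - 2)) - v"

text \<open>The effective potential seen by a particle when the mean position is \<open>m\<close>.\<close>

definition W :: "real \<Rightarrow> real \<Rightarrow> real" where
  "W m q = V q + \<alpha> / 2 * q\<^sup>2 - \<alpha> * m * q"

lemma V_DERIV: "(V has_real_derivative x * P x) (at x)"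
proof -
  have "(V has_real_derivative - v / 2 * (2 * x) + (\<Sum>j=2..r. c j * (real (2 * j) * x ^ (2 * j - 1)))) (at x)"
    unfolding V_def using DERIV_pow[of 2 x UNIV] DERIV_pow[of "2 * _" x UNIV]
    by (intro DERIV_add DERIV_sum DERIV_cmult) (simp_all only: One_nat_def, simp)
  moreover have "c j * (real (2 * j) * x ^ (2 * j - 1)) = x * (2 * real j * c j * x ^ (2 * j - 2))"
    if "j \<in> {2..r}" for j
  proof -
    have "x ^ (2 * j - 1) = x * x ^ (2 * j - 2)"
      using that by (cases j) auto
    then show ?thesis by simp
  qed
  then have "(\<Sum>j=2..r. c j * (real (2 * j) * x ^ (2 * j - 1)))
      = (\<Sum>j=2..r. x * (2 * real j * c j * x ^ (2 * j - 2)))"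
    by (rule sum.cong[OF refl])
  ultimately show ?thesis
    by (simp add: P_def right_diff_distrib sum_distrib_left mult.commute)
qed

lemma smooth_V: "smooth V"
  unfolding V_def by (intro smooth_add smooth_cmult smooth_sum smooth_power smooth_ident)

lemma smooth_Wm: "smooth (W m)"
  unfolding W_def[abs_def] by (intro smooth_add smooth_diff smooth_cmult smooth_power smooth_ident smooth_V)

lemma W_DERIV_q: "(W m has_real_derivative q * P q + \<alpha> * (q - m)) (at q)"
proof -
  have "(W m has_real_derivative q * P q + \<alpha> / 2 * (2 * q) - \<alpha> * m * 1) (at q)"
    unfolding W_def[abs_def] using DERIV_pow[of 2 q UNIV]
    by (intro DERIV_add DERIV_diff DERIV_cmult V_DERIV DERIV_ident) auto
  then show ?thesis by (rule DERIV_cong) (simp add: algebra_simps)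
qed

lemma deriv_Wm: "deriv (W m) q = q * P q + \<alpha> * (q - m)"
  using W_DERIV_q by (rule DERIV_imp_deriv)

lemma V_ge: obtains k where "\<And>q. q\<^sup>2 - k \<le> V q"
proof
  fix q :: real
  define T where "T = (v / 2 + 1) / c r"
  define k where "k = c r * (T\<^sup>2 / 4 + 1)"
  let ?t = "q\<^sup>2"
  have t0: "0 \<le> ?t" by simp
  \<comment> \<open>The term of degree \<open>2 r\<close> dominates \<open>q\<^sup>4\<close> up to a constant, and \<open>q\<^sup>4\<close> dominates any multiple \<open>T\<close> of \<open>q\<^sup>2\<close>; \<open>T\<close> is chosen to beat the concave quadratic part of \<open>V\<close> by \<open>q\<^sup>2\<close>.\<close>
  have "?t\<^sup>2 - 1 \<le> ?t ^ r"
  proof (cases "1 \<le> ?t")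
    case True
    then have "?t\<^sup>2 \<le> ?t ^ r" using r_ge by (rule power_increasing[rotated])
    then show ?thesis by simp
  next
    case False
    then have "?t\<^sup>2 \<le> 1" using power_le_one[of ?t 2] by simp
    moreover have "0 \<le> ?t ^ r" by simp
    ultimately show ?thesis by linarith
  qed
  moreover have "T * ?t - T\<^sup>2 / 4 \<le> ?t\<^sup>2"
    using zero_le_power2[of "?t - T / 2"] by (simp add: power2_diff power_divide mult.commute)
  ultimately have "c r * (T * ?t - T\<^sup>2 / 4 - 1) \<le> c r * ?t ^ r"
    using c_r by (intro mult_left_mono) auto
  moreover have "c r * (T * ?t - T\<^sup>2 / 4 - 1) = (v / 2 + 1) * ?t - k"
    using c_r by (simp add: k_def T_def field_simps)
  moreover have "c r * ?t ^ r \<le> (\<Sum>j=2..r. c j * q ^ (2 * j))"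
  proof -
    have "c r * q ^ (2 * r) \<le> (\<Sum>j=2..r. c j * q ^ (2 * j))"
      by (rule member_le_sum) (use r_ge c_nonneg in \<open>auto simp: power_mult\<close>)
    then show ?thesis by (simp add: power_mult)
  qed
  ultimately show "q\<^sup>2 - c r * (((v / 2 + 1) / c r)\<^sup>2 / 4 + 1) \<le> V q"
    unfolding V_def k_def T_def by (simp add: algebra_simps)
qed

lemma W_confining: assumes "0 < lam" obtains k0 where "confining (W m) lam k0"
proof -
  obtain k where k: "\<And>q. q\<^sup>2 - k \<le> V q" using V_ge by blast
  define B where "B = (\<alpha> * \<bar>m\<bar> + 1) / 2"
  have "confining (W m) lam (k + B\<^sup>2)"
  proof
    fix q :: real
    have "0 \<le> (\<bar>q\<bar> - B)\<^sup>2" by simp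
    then have "2 * B * \<bar>q\<bar> - B\<^sup>2 \<le> q\<^sup>2" by (simp add: power2_diff mult_ac)
    moreover have "2 * B * \<bar>q\<bar> = \<alpha> * \<bar>m\<bar> * \<bar>q\<bar> + \<bar>q\<bar>" by (simp add: B_def algebra_simps)
    moreover have "\<alpha> * m * q \<le> \<alpha> * \<bar>m\<bar> * \<bar>q\<bar>"
      using alpha_pos abs_ge_self[of "m * q"] by (simp add: abs_mult mult.assoc)
    moreover have "0 \<le> \<alpha> / 2 * q\<^sup>2" using alpha_pos by simp
    ultimately show "\<bar>q\<bar> - (k + B\<^sup>2) \<le> W m q" using k[of q] unfolding W_def by linarith
  qed (use smooth_Wm assms in auto)
  then show ?thesis by (rule that)
qed

definition weight :: "real \<Rightarrow> real \<Rightarrow> real \<Rightarrow> real" where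
  "weight lam m q = exp (- (W m q / lam))"

lemma weight_pos: "0 < weight lam m q"
  by (simp add: weight_def)

lemma weight_cont: "continuous_on UNIV (weight lam m)"
proof (cases "lam = 0")
  case False
  then show ?thesis unfolding weight_def[abs_def]
    by (intro continuous_intros smooth_continuous smooth_Wm) auto
qed (simp add: weight_def[abs_def])

lemma weight_int: assumes "0 < lam" shows "integrable lborel (\<lambda>q. q ^ n * weight lam m q)"
proof -
  obtain k0 where "confining (W m) lam k0" using W_confining[OF assms] .
  then interpret confining "W m" lam k0 .
  show ?thesis using weight_moment_integrable by (simp add: weight_def)
qed

lemma weight_P_int: assumes "0 < lam" shows "integrable lborel (\<lambda>q. q ^ n * P q * weight lam m q)"
proof -
  have w: "integrable lborel (\<lambda>q. q ^ n * q ^ k * weight lam m q)" for k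
    using weight_int[OF assms, of "n + k" m] by (simp only: power_add)
  have "integrable lborel (\<lambda>q. (\<Sum>j=2..r. 2 * real j * c j * (q ^ n * q ^ (2 * j - 2) * weight lam m q))
      - v * (q ^ n * weight lam m q))"
    by (intro Bochner_Integration.integrable_diff Bochner_Integration.integrable_sum
        integrable_mult_right weight_int w assms)
  moreover have "q ^ n * P q * weight lam m q = (\<Sum>j=2..r. 2 * real j * c j * (q ^ n * q ^ (2 * j - 2) * weight lam m q))
      - v * (q ^ n * weight lam m q)" for q
    by (simp add: P_def left_diff_distrib right_diff_distrib sum_distrib_left sum_distrib_right mult_ac)
  ultimately show ?thesis by simp
qed

lemma P_cont: "continuous_on UNIV P"
  unfolding P_def by (intro continuous_intros)

lemma weight_DERIV: assumes "0 < lam"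
  shows "(weight lam m has_real_derivative - ((q * P q + \<alpha> * (q - m)) / lam) * weight lam m q) (at q)"
proof -
  have "((\<lambda>q. - (W m q / lam)) has_real_derivative - ((q * P q + \<alpha> * (q - m)) / lam)) (at q)"
    by (intro DERIV_minus DERIV_cdivide W_DERIV_q)
  from DERIV_fun_exp[OF this] show ?thesis
    unfolding weight_def[abs_def] by (simp add: mult.commute)
qed

text \<open>Up to a positive factor, the difference between the mean of the Gibbs density with parameter \<open>m\<close>
  and \<open>m\<close> itself.\<close>

definition Psi :: "real \<Rightarrow> real \<Rightarrow> real" where
  "Psi lam m = (\<integral>q. (q - m) * weight lam m q \<partial>lborel)"

text \<open>Integrate the derivative of the weight, \<open>W' = V' + \<alpha> (q - m)\<close>.\<close>

lemma Psi_eq: assumes lam: "0 < lam"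
  shows "\<alpha> * Psi lam m = - (\<integral>q. q * P q * weight lam m q \<partial>lborel)"
proof -
  obtain k0 where "confining (W m) lam k0" using W_confining[OF lam] .
  then interpret confining "W m" lam k0 .
  let ?f = "\<lambda>q. - ((q * P q + \<alpha> * (q - m)) / lam) * weight lam m q"
  have i1: "integrable lborel (\<lambda>q. q * P q * weight lam m q)" using weight_P_int[OF lam, of 1] by simp
  have i2: "integrable lborel (\<lambda>q. (q - m) * weight lam m q)"
    using Bochner_Integration.integrable_diff[OF weight_int[OF lam, of 1] integrable_mult_right[OF weight_int[OF lam, of 0], of m]]
    by (simp add: algebra_simps)
  have eq: "?f = (\<lambda>q. - (1 / lam) * (q * P q * weight lam m q + \<alpha> * ((q - m) * weight lam m q)))"
    using lam by (auto simp: field_simps)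
  have "(\<integral>q. ?f q \<partial>lborel) = 0"
  proof (rule weight_moment_deriv_integral[where k=0])
    show "((\<lambda>q. q ^ 0 * exp (- (W m q / lam))) has_real_derivative ?f q) (at q)" for q
      using weight_DERIV[OF lam, of m q] by (simp add: weight_def[abs_def])
    show "continuous_on UNIV ?f" by (intro continuous_intros P_cont weight_cont) (use lam in auto)
    show "integrable lborel ?f" unfolding eq
      by (intro integrable_mult_right Bochner_Integration.integrable_add i1 i2)
  qed
  then have "(\<integral>q. q * P q * weight lam m q \<partial>lborel) + \<alpha> * Psi lam m = 0"
    unfolding eq Psi_def using i1 i2 lam by simp
  then show ?thesis by simp
qed

text \<open>Integrate the derivative of \<open>q\<close> times the weight; this links the slope of the force at the origin
  with the integrand of the critical equation.\<close>

lemma second_moment_eq: assumes lam: "0 < lam"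
  shows "(\<integral>q. q\<^sup>2 * P q * weight lam 0 q \<partial>lborel) = (\<integral>q. (lam - \<alpha> * q\<^sup>2) * weight lam 0 q \<partial>lborel)"
proof -
  obtain k0 where "confining (W 0) lam k0" using W_confining[OF lam] .
  then interpret confining "W 0" lam k0 .
  let ?f = "\<lambda>q. weight lam 0 q + q * (- ((q * P q + \<alpha> * (q - 0)) / lam) * weight lam 0 q)"
  have i1: "integrable lborel (\<lambda>q. q\<^sup>2 * P q * weight lam 0 q)" using weight_P_int[OF lam, of 2] by simp
  have i2: "integrable lborel (\<lambda>q. (lam - \<alpha> * q\<^sup>2) * weight lam 0 q)"
    using Bochner_Integration.integrable_diff[OF integrable_mult_right[OF weight_int[OF lam, of 0], of lam] integrable_mult_right[OF weight_int[OF lam, of 2], of \<alpha>]]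
    by (simp add: algebra_simps)
  have eq: "?f = (\<lambda>q. 1 / lam * ((lam - \<alpha> * q\<^sup>2) * weight lam 0 q - q\<^sup>2 * P q * weight lam 0 q))"
    using lam by (auto simp: field_simps power2_eq_square)
  have "(\<integral>q. ?f q \<partial>lborel) = 0"
  proof (rule weight_moment_deriv_integral[where k=1])
    show "((\<lambda>q. q ^ 1 * exp (- (W 0 q / lam))) has_real_derivative ?f q) (at q)" for q
      using DERIV_mult[OF DERIV_ident weight_DERIV[OF lam, of 0 q]] by (simp add: weight_def[abs_def] mult_ac)
    show "continuous_on UNIV ?f" by (intro continuous_intros P_cont weight_cont) (use lam in auto)
    show "integrable lborel ?f" unfolding eq
      by (intro integrable_mult_right Bochner_Integration.integrable_diff i1 i2)
  qed
  then show ?thesis unfolding eq using i1 i2 lam by simp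
qed

end

section \<open>Counting the fixed points of the mean\<close>

context double_well
begin

lemma V_even: "V (- x) = V x"
  by (simp add: V_def power_mult)

lemma P_even: "P (- x) = P x"
proof -
  have "(- x) ^ (2 * j - 2) = x ^ (2 * j - 2)" for j
  proof -
    have "even (2 * j - 2)" by simp
    then show ?thesis by (rule power_minus_even)
  qed
  then show ?thesis by (simp add: P_def)
qed

lemma weight_even: "weight lam 0 (- q) = weight lam 0 q"
  by (simp add: weight_def W_def V_even)

lemma weight_tilt: assumes "0 < lam" shows "weight lam m q = weight lam 0 q * exp (\<alpha> * m / lam * q)"
  unfolding weight_def W_def exp_add[symmetric] using assms by (simp add: field_simps)

lemma P_strict_mono: assumes "0 \<le> x" "x < y" shows "P x < P y"
proof -
  have "(\<Sum>j=2..r. 2 * real j * c j * x ^ (2 * j - 2)) < (\<Sum>j=2..r. 2 * real j * c j * y ^ (2 * j - 2))"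
  proof (rule sum_strict_mono_ex1)
    show "\<forall>j\<in>{2..r}. 2 * real j * c j * x ^ (2 * j - 2) \<le> 2 * real j * c j * y ^ (2 * j - 2)"
      using assms c_nonneg by (auto intro!: mult_left_mono power_mono)
    have "x ^ (2 * r - 2) < y ^ (2 * r - 2)" using assms r_ge by (intro power_strict_mono) auto
    then show "\<exists>j\<in>{2..r}. 2 * real j * c j * x ^ (2 * j - 2) < 2 * real j * c j * y ^ (2 * j - 2)"
      using r_ge c_r by (intro bexI[of _ r]) auto
  qed simp
  then show ?thesis by (simp add: P_def)
qed

lemma ex_well: obtains q where "0 < q" "P q = 0"
proof -
  have P0: "P 0 = - v"
    unfolding P_def by (auto intro!: sum.neutral)
  define x where "x = v / (2 * real r * c r) + 1"
  have x1: "1 \<le> x" using v_pos c_r by (simp add: x_def)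
  have "2 * real r * c r * x ^ (2 * r - 2) \<le> (\<Sum>j=2..r. 2 * real j * c j * x ^ (2 * j - 2))"
    by (rule member_le_sum[of r "{2..r}" "\<lambda>j. 2 * real j * c j * x ^ (2 * j - 2)"])
      (use r_ge c_nonneg x1 in auto)
  moreover have "x ^ 1 \<le> x ^ (2 * r - 2)" using x1 r_ge by (intro power_increasing) auto
  then have "2 * real r * c r * x \<le> 2 * real r * c r * x ^ (2 * r - 2)"
    using c_r by (intro mult_left_mono) auto
  moreover have "v \<le> 2 * real r * c r * x"
    using c_r r_ge by (simp add: x_def field_simps)
  ultimately have "0 \<le> P x" by (simp add: P_def)
  then obtain q where q: "0 \<le> q" "q \<le> x" "P q = 0"
    using IVT'[of P 0 0 x] P0 v_pos x1 continuous_on_subset[OF P_cont] by auto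
  then have "q \<noteq> 0" using P0 v_pos by auto
  then show ?thesis using that[of q] q by auto
qed

text \<open>The minimizer of \<open>V\<close> on the half-line.\<close>

definition well :: real where "well = (SOME q. 0 < q \<and> P q = 0)"

lemma well: "0 < well" "P well = 0"
  using ex_well someI_ex[of "\<lambda>q. 0 < q \<and> P q = 0"] unfolding well_def by metis+

lemma P_sign: "\<bar>q\<bar> < well \<Longrightarrow> P q < 0" "well < \<bar>q\<bar> \<Longrightarrow> 0 < P q"
proof -
  have e: "P \<bar>q\<bar> = P q" using P_even by (cases "0 \<le> q") auto
  show "\<bar>q\<bar> < well \<Longrightarrow> P q < 0" using P_strict_mono[of "\<bar>q\<bar>" well] well e by simp
  show "well < \<bar>q\<bar> \<Longrightarrow> 0 < P q" using P_strict_mono[of well "\<bar>q\<bar>"] well e by simp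
qed

text \<open>The tilt \<open>exp (\<alpha> m q / lam)\<close> of the even weight acts on the odd function \<open>V'\<close> through its odd part.
  The parameter is \<open>t = \<alpha> m / lam\<close>, see \<open>Psi_force\<close>.\<close>

definition force :: "real \<Rightarrow> real \<Rightarrow> real" where
  "force lam t = (\<integral>q. q * P q * weight lam 0 q * sinh (t * q) \<partial>lborel)"

context
  fixes lam :: real
  assumes lam: "0 < lam"
begin

lemma tilted_P_int: "integrable lborel (\<lambda>q. q ^ n * P q * weight lam 0 q * exp (t * q))"
  using weight_P_int[OF lam, of n "lam * t / \<alpha>"] lam alpha_pos
  by (simp add: weight_tilt[OF lam, of "lam * t / \<alpha>"] mult.assoc)

lemma sinh_P_int: "integrable lborel (\<lambda>q. q ^ n * P q * weight lam 0 q * sinh (t * q))"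
proof -
  have "integrable lborel (\<lambda>q. 1 / 2 * (q ^ n * P q * weight lam 0 q * exp (t * q) - q ^ n * P q * weight lam 0 q * exp (- t * q)))"
    by (intro integrable_mult_right Bochner_Integration.integrable_diff tilted_P_int)
  moreover have "1 / 2 * (q ^ n * P q * weight lam 0 q * exp (t * q) - q ^ n * P q * weight lam 0 q * exp (- t * q))
      = q ^ n * P q * weight lam 0 q * sinh (t * q)" for q
    by (simp add: sinh_field_def right_diff_distrib)
  ultimately show ?thesis by simp
qed

lemma sinh_P_int1: "integrable lborel (\<lambda>q. q * P q * weight lam 0 q * sinh (t * q))"
  using sinh_P_int[of 1 t] by simp

lemma Psi_force: "\<alpha> * Psi lam m = - force lam (\<alpha> * m / lam)"
proof -
  define t where "t = \<alpha> * m / lam"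
  let ?f = "\<lambda>q. q * P q * weight lam 0 q * exp (t * q)"
  have i: "integrable lborel ?f" using tilted_P_int[of 1 t] by simp
  then have i': "integrable lborel (\<lambda>q. ?f (- q))" by (subst integrable_reflect)
  have "(\<integral>q. q * P q * weight lam m q \<partial>lborel) = (\<integral>q. ?f q \<partial>lborel)"
    by (simp add: weight_tilt[OF lam, of m] t_def mult_ac)
  also have "\<dots> = 1 / 2 * ((\<integral>q. ?f q \<partial>lborel) + (\<integral>q. ?f (- q) \<partial>lborel))"
    using integral_reflect[of ?f] by simp
  also have "\<dots> = (\<integral>q. 1 / 2 * (?f q + ?f (- q)) \<partial>lborel)"
    using i i' by simp
  also have "\<dots> = force lam t"
    unfolding force_def by (rule Bochner_Integration.integral_cong)
      (auto simp: P_even weight_even sinh_field_def algebra_simps)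
  finally show ?thesis using Psi_eq[OF lam, of m] by (simp add: t_def)
qed

lemma force_odd: "force lam (- t) = - force lam t"
  by (simp add: force_def)

lemma force_DERIV:
  "(force lam has_real_derivative (\<integral>q. q\<^sup>2 * P q * weight lam 0 q * cosh (t * q) \<partial>lborel)) (at t)"
  unfolding force_def[abs_def]
proof (rule DERIV_integral_dominated)
  let ?T = "\<bar>t\<bar> + 1"
  let ?w = "\<lambda>q. \<bar>q\<^sup>2 * P q * weight lam 0 q * exp (?T * q)\<bar> + \<bar>q\<^sup>2 * P q * weight lam 0 q * exp (- ?T * q)\<bar>"
  show "((\<lambda>x. q * P q * weight lam 0 q * sinh (x * q)) has_real_derivative
      q\<^sup>2 * P q * weight lam 0 q * cosh (x * q)) (at x)" for x q
    by (auto intro!: derivative_eq_intros simp: power2_eq_square)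
  show "integrable lborel ?w"
    by (intro Bochner_Integration.integrable_add integrable_abs tilted_P_int)
  show "(\<lambda>q. q\<^sup>2 * P q * weight lam 0 q * cosh (t * q)) \<in> borel_measurable lborel"
    by (simp, intro borel_measurable_continuous_onI continuous_intros P_cont weight_cont)
  show "\<bar>q\<^sup>2 * P q * weight lam 0 q * cosh (x * q)\<bar> \<le> ?w q" if "\<bar>x - t\<bar> \<le> 1" for x q
  proof -
    have "\<bar>x\<bar> \<le> ?T" using that by linarith
    then have xq: "\<bar>x * q\<bar> \<le> \<bar>?T * q\<bar>" unfolding abs_mult by (intro mult_right_mono) auto
    have "exp (x * q) \<le> exp (?T * q) + exp (- ?T * q)" "exp (- (x * q)) \<le> exp (?T * q) + exp (- ?T * q)"
    proof -
      have e: "exp y \<le> exp (?T * q) + exp (- ?T * q)" if "\<bar>y\<bar> \<le> \<bar>?T * q\<bar>" for y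
      proof (cases "0 \<le> q")
        case True
        then have "exp y \<le> exp (?T * q)" using that by (simp add: abs_mult)
        then show ?thesis by (smt (verit) exp_gt_zero)
      next
        case False
        then have "?T * q \<le> 0" by (intro mult_nonneg_nonpos) auto
        then have "\<bar>?T * q\<bar> = - ?T * q" unfolding mult_minus_left by (rule abs_of_nonpos)
        then have "exp y \<le> exp (- ?T * q)" using that unfolding exp_le_cancel_iff by linarith
        then show ?thesis by (smt (verit) exp_gt_zero)
      qed
      show "exp (x * q) \<le> exp (?T * q) + exp (- ?T * q)" "exp (- (x * q)) \<le> exp (?T * q) + exp (- ?T * q)"
        by (rule e; use xq in simp)+
    qed
    then have "cosh (x * q) \<le> exp (?T * q) + exp (- ?T * q)" by (simp add: cosh_field_def)
    then have "\<bar>q\<^sup>2 * P q * weight lam 0 q\<bar> * cosh (x * q) \<le> \<bar>q\<^sup>2 * P q * weight lam 0 q\<bar> * (exp (?T * q) + exp (- ?T * q))"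
      by (rule mult_left_mono) simp
    then show ?thesis by (simp add: abs_mult distrib_left)
  qed
qed (rule sinh_P_int1)

text \<open>Two odd functions that change sign from negative to positive at the same positive point have a
  nonnegative product.\<close>

lemma cross_sign:
  assumes odd: "\<And>q. d (- q) = - d q" and pos: "\<And>q. well < q \<Longrightarrow> 0 < d q"
    and neg: "\<And>q. 0 < q \<Longrightarrow> q < well \<Longrightarrow> d q < 0"
  shows "0 \<le> q * P q * weight lam 0 q * d q"
    and "q \<notin> {0, well, - well} \<Longrightarrow> 0 < q * P q * weight lam 0 q * d q"
proof -
  have p: "0 < x * P x * weight lam 0 x * d x" if x: "0 < x" "x \<noteq> well" for x
  proof (cases "x < well")
    case True
    then have "0 < (- P x) * (- d x)" using x neg P_sign(1)[of x] by (intro mult_pos_pos) auto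
    then have "0 < (x * weight lam 0 x) * (P x * d x)" using x weight_pos[of lam 0 x] by simp
    then show ?thesis by (simp add: mult_ac)
  next
    case False
    then have "0 < P x * d x" using x pos P_sign(2)[of x] by (intro mult_pos_pos) auto
    then have "0 < (x * weight lam 0 x) * (P x * d x)" using x weight_pos[of lam 0 x] by simp
    then show ?thesis by (simp add: mult_ac)
  qed
  show s: "0 < q * P q * weight lam 0 q * d q" if "q \<notin> {0, well, - well}" for q
  proof (cases "0 < q")
    case True then show ?thesis using p that by simp
  next
    case False
    then have "0 < - q" "- q \<noteq> well" using that by auto
    from p[OF this] show ?thesis by (simp add: P_even weight_even odd)
  qed
  show "0 \<le> q * P q * weight lam 0 q * d q"
    using s[of q] well P_even[of well] by (cases "q \<in> {0, well, - well}") auto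
qed

text \<open>Variation diminishing: for \<open>q > 0\<close>, \<open>sinh (t q) / sinh (t well)\<close> increases with \<open>t\<close> exactly where
  \<open>V'(q) = q P(q)\<close> is positive, so that the normalized integral is strictly increasing.\<close>

lemma force_ratio_strict_mono:
  assumes st: "0 < s" "s < t"
  shows "force lam s / sinh (s * well) < force lam t / sinh (t * well)"
proof -
  define d where "d q = sinh (t * q) / sinh (t * well) - sinh (s * q) / sinh (s * well)" for q
  have S: "0 < sinh (s * well)" "0 < sinh (t * well)" using st well by auto
  have odd: "d (- q) = - d q" for q by (simp add: d_def)
  have pos: "0 < d q" if "well < q" for q
  proof -
    have "0 < sinh (s * q)" using st well that by simp
    then show ?thesis
      using sinh_sinh_ratio[OF st well(1) that] S by (simp add: d_def field_simps)
  qed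
  have neg: "d q < 0" if "0 < q" "q < well" for q
  proof -
    have "0 < sinh (s * q)" using st that by simp
    then show ?thesis
      using sinh_sinh_ratio[OF st that] S by (simp add: d_def field_simps)
  qed
  let ?f = "\<lambda>t q. q * P q * weight lam 0 q * sinh (t * q)"
  have eq: "q * P q * weight lam 0 q * d q = ?f t q / sinh (t * well) - ?f s q / sinh (s * well)" for q
    by (simp add: d_def right_diff_distrib)
  have i: "integrable lborel (\<lambda>q. q * P q * weight lam 0 q * d q)"
    unfolding eq by (intro Bochner_Integration.integrable_diff integrable_divide sinh_P_int1)
  have "0 < (\<integral>q. q * P q * weight lam 0 q * d q \<partial>lborel)"
    by (rule integral_pos_except_finite[OF i, of "{0, well, - well}"])
      (use cross_sign[of d, OF odd pos neg] in auto)
  also have "\<dots> = force lam t / sinh (t * well) - force lam s / sinh (s * well)"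
    unfolding eq force_def using sinh_P_int1 by simp
  finally show ?thesis by simp
qed

text \<open>The derivative of the force at \<open>t = 0\<close>, see \<open>force_DERIV\<close>.\<close>

definition slope :: real where
  "slope = (\<integral>q. q\<^sup>2 * P q * weight lam 0 q \<partial>lborel)"

text \<open>The limit case \<open>s = 0\<close> of the preceding comparison, with \<open>q / well\<close> in place of the quotient of
  hyperbolic sines.\<close>

lemma force_ratio_gt_slope:
  assumes t: "0 < t"
  shows "slope / well < force lam t / sinh (t * well)"
proof -
  define d where "d q = sinh (t * q) / sinh (t * well) - q / well" for q
  have S: "0 < sinh (t * well)" using t well by auto
  have odd: "d (- q) = - d q" for q by (simp add: d_def)
  have pos: "0 < d q" if "well < q" for q
    using sinh_linear_ratio[OF t well(1) that] S well that by (simp add: d_def field_simps)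
  have neg: "d q < 0" if "0 < q" "q < well" for q
    using sinh_linear_ratio[OF t that] S well that by (simp add: d_def field_simps)
  have i2: "integrable lborel (\<lambda>q. q\<^sup>2 * P q * weight lam 0 q)" using weight_P_int[OF lam, of 2] .
  let ?f = "\<lambda>q. q * P q * weight lam 0 q * sinh (t * q)"
  have eq: "q * P q * weight lam 0 q * d q = ?f q / sinh (t * well) - q\<^sup>2 * P q * weight lam 0 q / well" for q
    by (simp add: d_def right_diff_distrib power2_eq_square)
  have i: "integrable lborel (\<lambda>q. q * P q * weight lam 0 q * d q)"
    unfolding eq by (intro Bochner_Integration.integrable_diff integrable_divide sinh_P_int1 i2)
  have "0 < (\<integral>q. q * P q * weight lam 0 q * d q \<partial>lborel)"
    by (rule integral_pos_except_finite[OF i, of "{0, well, - well}"])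
      (use cross_sign[of d, OF odd pos neg] in auto)
  also have "\<dots> = force lam t / sinh (t * well) - slope / well"
    unfolding eq force_def slope_def using sinh_P_int1 i2 by simp
  finally show ?thesis by simp
qed

text \<open>Beyond \<open>2 well\<close> the quotient \<open>sinh (t q) / sinh (t well)\<close> is at least \<open>2 cosh (t well)\<close>, while the
  negative contribution from \<open>q < well\<close> stays bounded.\<close>

lemma force_eventually_pos: obtains t where "0 < t" "0 < force lam t"
proof -
  let ?h = "\<lambda>q. \<bar>q * P q * weight lam 0 q\<bar>"
  let ?I = "indicator {q. 2 * well < \<bar>q\<bar>} :: real \<Rightarrow> real"
  have ih: "integrable lborel ?h" using weight_P_int[OF lam, of 1 0] by (intro integrable_abs) simp
  have mI: "{q. 2 * well < \<bar>q\<bar>} \<in> sets lborel" by measurable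
  have ihI: "integrable lborel (\<lambda>q. ?h q * ?I q)"
    using integrable_mult_indicator[OF mI ih] by (simp add: mult.commute)
  define C1 where "C1 = (\<integral>q. ?h q \<partial>lborel)"
  define C2 where "C2 = (\<integral>q. ?h q * ?I q \<partial>lborel)"
  have C2: "0 < C2"
    unfolding C2_def
  proof (rule integral_pos_if_pos_on_interval[OF ihI, of "2 * well" "2 * well + 1"])
    fix q assume "2 * well < q" "q < 2 * well + 1"
    then have "0 < q" "0 < P q" "?I q = 1" using well P_sign(2)[of q] by auto
    then show "0 < ?h q * ?I q" using weight_pos[of lam 0 q] by simp
  qed auto
  \<comment> \<open>Chosen such that \<open>t well C2 = \<bar>C1\<bar> + C2\<close>.\<close>
  define t where "t = (\<bar>C1\<bar> / C2 + 1) / well"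
  have t: "0 < t" using C2 well by (simp add: t_def add_nonneg_pos)
  have S: "0 < sinh (t * well)" using t well by simp
  let ?f = "\<lambda>q. q * P q * weight lam 0 q * sinh (t * q) / sinh (t * well)"
  have pt: "- ?h q + 2 * cosh (t * well) * (?h q * ?I q) \<le> ?f q" for q
  proof -
    have p: "- ?h x + 2 * cosh (t * well) * (?h x * ?I x) \<le> ?f x" if x: "0 \<le> x" for x
    proof -
      have sx: "0 \<le> sinh (t * x)" using t x by simp
      consider "x < well" | "well \<le> x" "x \<le> 2 * well" | "2 * well < x" by linarith
      then show ?thesis
      proof cases
        case 1
        then have "sinh (t * x) \<le> sinh (t * well)" using t by simp
        then have le1: "sinh (t * x) / sinh (t * well) \<le> 1" using S by simp
        have "?h x * (sinh (t * x) / sinh (t * well)) \<le> ?h x * 1" by (rule mult_left_mono[OF le1]) simp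
        moreover have "q * P q * weight lam 0 q * sinh (t * q) / sinh (t * well) \<ge>
            - (\<bar>q * P q * weight lam 0 q\<bar> * (sinh (t * q) / sinh (t * well)))" if "0 \<le> q" for q
        proof -
          have "- \<bar>y\<bar> * z \<le> y * z" if "0 \<le> z" for y z :: real
            using that by (intro mult_right_mono) auto
          from this[of "sinh (t * q) / sinh (t * well)" "q * P q * weight lam 0 q"] show ?thesis
            using t \<open>0 \<le> q\<close> S by simp
        qed
        from this[OF x] have "- (?h x * (sinh (t * x) / sinh (t * well))) \<le> ?f x" .
        moreover have "?I x = 0" using 1 x well by simp
        ultimately show ?thesis by simp
      next
        case 2
        then have "0 \<le> P x" using P_sign(2)[of x] well by (cases "x = well") auto
        then have "0 \<le> ?f x" using x sx S weight_pos[of lam 0 x] by simp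
        moreover have "?I x = 0" using 2 x by simp
        moreover have "0 \<le> ?h x" by simp
        ultimately show ?thesis by simp
      next
        case 3
        then have P: "0 < P x" using P_sign(2)[of x] well by auto
        have "t * (2 * well) \<le> t * x" using 3 t by (intro mult_left_mono) auto
        then have "2 * (t * well) \<le> t * x" by simp
        then have "sinh (2 * (t * well)) \<le> sinh (t * x)" by (simp only: sinh_real_le_iff)
        then have "2 * sinh (t * well) * cosh (t * well) \<le> sinh (t * x)" by (simp only: sinh_double)
        then have "2 * cosh (t * well) \<le> sinh (t * x) / sinh (t * well)"
          unfolding pos_le_divide_eq[OF S] by (simp only: mult_ac)
        moreover have hx: "?h x = x * P x * weight lam 0 x" using P x weight_pos[of lam 0 x] by simp
        ultimately have "?h x * (2 * cosh (t * well)) \<le> ?h x * (sinh (t * x) / sinh (t * well))"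
          by (intro mult_left_mono) auto
        moreover have "?I x = 1" using 3 x by simp
        moreover have "0 \<le> ?h x" by simp
        ultimately show ?thesis using hx by (simp add: mult_ac)
      qed
    qed
    show ?thesis
    proof (cases "0 \<le> q")
      case False
      then show ?thesis using p[of "- q"] by (simp add: P_even weight_even indicator_def)
    qed (rule p)
  qed
  have "(\<integral>q. - ?h q + 2 * cosh (t * well) * (?h q * ?I q) \<partial>lborel) \<le> (\<integral>q. ?f q \<partial>lborel)"
  proof (rule integral_mono)
    show "integrable lborel (\<lambda>q. - ?h q + 2 * cosh (t * well) * (?h q * ?I q))"
      by (intro Bochner_Integration.integrable_add integrable_minus integrable_mult_right ih ihI)
    show "integrable lborel ?f" by (intro integrable_divide sinh_P_int1)
  qed (rule pt)
  also have "(\<integral>q. - ?h q + 2 * cosh (t * well) * (?h q * ?I q) \<partial>lborel) = - C1 + 2 * cosh (t * well) * C2"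
    unfolding C1_def C2_def
    by (subst Bochner_Integration.integral_add, intro integrable_minus ih, intro integrable_mult_right ihI)
      (simp only: Bochner_Integration.integral_minus integral_mult_right_zero)
  also have "(\<integral>q. ?f q \<partial>lborel) = force lam t / sinh (t * well)"
    by (simp add: force_def)
  finally have le: "- C1 + 2 * cosh (t * well) * C2 \<le> force lam t / sinh (t * well)" .
  have "t * well \<le> 2 * cosh (t * well)"
  proof -
    have "1 + t * well \<le> exp (t * well)" by (rule exp_ge_add_one_self)
    moreover have "2 * cosh (t * well) = exp (t * well) + exp (- (t * well))" by (simp add: cosh_field_def)
    moreover have "0 < exp (- (t * well))" by simp
    ultimately show ?thesis by linarith
  qed
  then have "t * well * C2 \<le> 2 * cosh (t * well) * C2" using C2 by (intro mult_right_mono) auto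
  moreover have "t * well * C2 = \<bar>C1\<bar> + C2" using C2 well by (simp add: t_def field_simps)
  ultimately have "0 < force lam t / sinh (t * well)" using le C2 by linarith
  then have "0 < force lam t" using S by (simp add: zero_less_divide_iff)
  then show ?thesis using that t by blast
qed

lemma force_0: "force lam 0 = 0"
  by (simp add: force_def)

lemma force_zero_set_trivial:
  assumes "0 \<le> slope" shows "force lam t = 0 \<longleftrightarrow> t = 0"
proof -
  have p: "0 < force lam t" if "0 < t" for t
  proof -
    have "0 \<le> slope / well" using assms well by simp
    then have "0 < force lam t / sinh (t * well)" using force_ratio_gt_slope[OF that] by linarith
    moreover have "0 < sinh (t * well)" using that well by simp
    ultimately show ?thesis by (simp add: zero_less_divide_iff)
  qed
  show ?thesis using p[of t] p[of "- t"] force_odd[of t] force_0 by (cases t "0 :: real" rule: linorder_cases) auto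
qed

lemma force_zero_set_triple:
  assumes "slope < 0" obtains s where "0 < s" "\<And>t. force lam t = 0 \<longleftrightarrow> t \<in> {0, s, - s}"
proof -
  have d: "(force lam has_real_derivative slope) (at 0)"
    using force_DERIV[of 0] by (simp add: slope_def)
  obtain e where e: "0 < e" "\<And>h. 0 < h \<Longrightarrow> h < e \<Longrightarrow> force lam (0 + h) < force lam 0"
    using DERIV_neg_dec_right[OF d assms] by blast
  obtain T where T: "0 < T" "0 < force lam T" using force_eventually_pos .
  define h where "h = min (e / 2) (T / 2)"
  have h: "0 < h" "h < e" "h < T" using e T by (auto simp: h_def)
  have fh: "force lam h < 0" using e(2)[OF h(1,2)] force_0 by simp
  have "continuous_on UNIV (force lam)"
    using force_DERIV by (meson DERIV_isCont continuous_at_imp_continuous_on)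
  then obtain s where s: "h \<le> s" "s \<le> T" "force lam s = 0"
    using IVT'[of "force lam" h 0 T] fh T h continuous_on_subset by (metis less_imp_le subset_UNIV)
  have s0: "0 < s" using s h by simp
  have uniq: "force lam t \<noteq> 0" if "0 < t" "t \<noteq> s" for t
  proof (cases "t < s")
    case True
    then show ?thesis using force_ratio_strict_mono[OF that(1) True] s by auto
  next
    case False
    then have "s < t" using that by simp
    then show ?thesis using force_ratio_strict_mono[OF s0, of t] s by auto
  qed
  have "force lam t = 0 \<longleftrightarrow> t \<in> {0, s, - s}" for t
    using uniq[of t] uniq[of "- t"] s(3) force_odd[of t] force_odd[of s] force_0 s0
    by (cases t "0 :: real" rule: linorder_cases) force+
  then show ?thesis using that s0 by blast
qed

lemma Psi_zero_iff: "Psi lam m = 0 \<longleftrightarrow> force lam (\<alpha> * m / lam) = 0"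
  using Psi_force[of m] alpha_pos by auto

lemma mean_unique: "0 \<le> slope \<Longrightarrow> Psi lam m = 0 \<longleftrightarrow> m = 0"
  using lam alpha_pos by (simp add: Psi_zero_iff force_zero_set_trivial)

lemma means_three: assumes "slope < 0" shows "card {m. Psi lam m = 0} = 3"
proof -
  obtain s where s: "0 < s" "\<And>t. force lam t = 0 \<longleftrightarrow> t \<in> {0, s, - s}"
    using force_zero_set_triple[OF assms] by blast
  have "{m. Psi lam m = 0} = {0, lam * s / \<alpha>, - (lam * s / \<alpha>)}"
    unfolding Psi_zero_iff s(2) using lam alpha_pos by (auto simp: field_simps)
  moreover have "card {0, x, - x} = 3" if "0 < x" for x :: real
    using that by (simp add: card_insert_if)
  moreover have "0 < lam * s / \<alpha>" using lam alpha_pos s by simp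
  ultimately show ?thesis by (simp only:)
qed

end

end

section \<open>The critical noise intensity\<close>

lemma isCont_integral_dominated:
  fixes g :: "real \<Rightarrow> 'a \<Rightarrow> real"
  assumes cont: "\<And>y. isCont (\<lambda>x. g x y) x0" and d: "0 < d"
    and bound: "\<And>x y. \<bar>x - x0\<bar> < d \<Longrightarrow> \<bar>g x y\<bar> \<le> w y" and w: "integrable M w"
    and meas: "\<And>x. g x \<in> borel_measurable M"
  shows "isCont (\<lambda>x. \<integral>y. g x y \<partial>M) x0"
  unfolding continuous_at_sequentially comp_def
proof (intro allI impI)
  fix x :: "nat \<Rightarrow> real" assume x: "x \<longlonglongrightarrow> x0"
  obtain N where N: "\<And>n. N \<le> n \<Longrightarrow> \<bar>x n - x0\<bar> < d"
    using LIMSEQ_D[OF x d] by auto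
  have "(\<lambda>n. \<integral>y. g (x (n + N)) y \<partial>M) \<longlonglongrightarrow> (\<integral>y. g x0 y \<partial>M)"
  proof (rule integral_dominated_convergence[where w=w])
    show "AE y in M. (\<lambda>n. g (x (n + N)) y) \<longlonglongrightarrow> g x0 y"
      by (intro AE_I2 isCont_tendsto_compose[OF cont] LIMSEQ_ignore_initial_segment x)
    show "AE y in M. norm (g (x (n + N)) y) \<le> w y" for n
      using bound[of "x (n + N)"] N[of "n + N"] by auto
  qed (use w meas in auto)
  then show "(\<lambda>n. \<integral>y. g (x n) y \<partial>M) \<longlonglongrightarrow> (\<integral>y. g x0 y \<partial>M)" by (rule LIMSEQ_offset)
qed

context double_well
begin

text \<open>The exponent of the critical equation in degrees above two. In these coordinates, \<open>q = 2 y sqrt z\<close>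
  with \<open>z = 2 lam\<close>, only this part of the exponent depends on \<open>z\<close>.\<close>

definition superquadratic :: "real \<Rightarrow> real \<Rightarrow> real" where
  "superquadratic z y = (\<Sum>j=2..r. 2 * z ^ (j - 1) * c j * 2 ^ (2 * j) * y ^ (2 * j))"

definition crit :: "real \<Rightarrow> real \<Rightarrow> real" where
  "crit z y = (4 * y\<^sup>2 - 1 / (2 * \<alpha>)) * exp ((v - \<alpha>) * (4 * y\<^sup>2) - superquadratic z y)"

definition J :: "real \<Rightarrow> real" where
  "J z = (\<integral>y. crit z y \<partial>lborel)"

text \<open>The positive zero of the factor \<open>4 y\<^sup>2 - 1 / (2 \<alpha>)\<close>.\<close>

definition y0 :: real where "y0 = sqrt (1 / (8 * \<alpha>))"

lemma y0: "0 < y0" "4 * y0\<^sup>2 = 1 / (2 * \<alpha>)"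
  using alpha_pos by (auto simp: y0_def)

lemma crit_eq: "crit z y = (4 * y\<^sup>2 - 4 * y0\<^sup>2) * exp ((v - \<alpha>) * (4 * y\<^sup>2) - superquadratic z y)"
  by (simp add: crit_def y0)

lemma superquadratic_nonneg: "0 \<le> z \<Longrightarrow> 0 \<le> superquadratic z y"
  unfolding superquadratic_def using c_nonneg by (intro sum_nonneg mult_nonneg_nonneg) (auto simp: power_mult)

lemma superquadratic_cont: "continuous_on UNIV (superquadratic z)"
  unfolding superquadratic_def[abs_def] by (intro continuous_intros)

lemma superquadratic_isCont: "isCont (\<lambda>z. superquadratic z y) z"
  unfolding superquadratic_def by (intro continuous_intros)

lemma superquadratic_even: "superquadratic z \<bar>y\<bar> = superquadratic z y"
  unfolding superquadratic_def by (simp add: power_mult)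

lemma superquadratic_mono_z: "0 \<le> z \<Longrightarrow> z \<le> z' \<Longrightarrow> superquadratic z y \<le> superquadratic z' y"
  unfolding superquadratic_def using c_nonneg
  by (intro sum_mono mult_right_mono mult_left_mono power_mono) (auto simp: power_mult)

text \<open>Raising \<open>z\<close> penalizes large \<open>\<bar>y\<bar>\<close> more than small \<open>\<bar>y\<bar>\<close>.\<close>

lemma superquadratic_diff_strict:
  assumes z: "0 \<le> z" "z < z'" and y: "\<bar>x\<bar> < \<bar>y\<bar>"
  shows "superquadratic z' x - superquadratic z x < superquadratic z' y - superquadratic z y"
proof -
  have d: "superquadratic z' y - superquadratic z y = (\<Sum>j=2..r. 2 * (z' ^ (j - 1) - z ^ (j - 1)) * c j * 2 ^ (2 * j) * \<bar>y\<bar> ^ (2 * j))" for y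
    unfolding superquadratic_def sum_subtractf[symmetric]
    by (rule sum.cong) (simp_all add: power_even_abs algebra_simps)
  have zz: "z ^ (j - 1) \<le> z' ^ (j - 1)" for j using z by (intro power_mono) auto
  show ?thesis
    unfolding d
  proof (rule sum_strict_mono_ex1)
    show "\<forall>j\<in>{2..r}. 2 * (z' ^ (j - 1) - z ^ (j - 1)) * c j * 2 ^ (2 * j) * \<bar>x\<bar> ^ (2 * j)
        \<le> 2 * (z' ^ (j - 1) - z ^ (j - 1)) * c j * 2 ^ (2 * j) * \<bar>y\<bar> ^ (2 * j)"
      using zz c_nonneg y by (auto intro!: mult_left_mono power_mono mult_nonneg_nonneg)
    have "z ^ (r - 1) < z' ^ (r - 1)" using z r_ge by (intro power_strict_mono) auto
    moreover have "\<bar>x\<bar> ^ (2 * r) < \<bar>y\<bar> ^ (2 * r)" using y r_ge by (intro power_strict_mono) auto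
    ultimately have "2 * (z' ^ (r - 1) - z ^ (r - 1)) * c r * 2 ^ (2 * r) * \<bar>x\<bar> ^ (2 * r)
        < 2 * (z' ^ (r - 1) - z ^ (r - 1)) * c r * 2 ^ (2 * r) * \<bar>y\<bar> ^ (2 * r)"
      using c_r by (intro mult_strict_left_mono mult_pos_pos) auto
    then show "\<exists>j\<in>{2..r}. 2 * (z' ^ (j - 1) - z ^ (j - 1)) * c j * 2 ^ (2 * j) * \<bar>x\<bar> ^ (2 * j)
        < 2 * (z' ^ (j - 1) - z ^ (j - 1)) * c j * 2 ^ (2 * j) * \<bar>y\<bar> ^ (2 * j)"
      using r_ge by (intro bexI[of _ r]) auto
  qed simp
qed

lemma superquadratic_0: "superquadratic 0 y = 0"
  unfolding superquadratic_def by (rule sum.neutral) auto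

lemma crit_cont: "continuous_on UNIV (crit z)"
  unfolding crit_def[abs_def] by (intro continuous_intros superquadratic_cont) (use alpha_pos in auto)

lemma weight_scaled:
  assumes z: "0 < z"
  shows "weight (z / 2) 0 (0 + 2 * sqrt z * y) = exp ((v - \<alpha>) * (4 * y\<^sup>2) - superquadratic z y)"
proof -
  have q2: "(2 * sqrt z * y) ^ (2 * j) = 2 ^ (2 * j) * z ^ j * y ^ (2 * j)" for j
    using z by (simp add: power_mult_distrib power_mult)
  have "(\<Sum>j=2..r. c j * (2 * sqrt z * y) ^ (2 * j)) = z / 2 * superquadratic z y"
    unfolding superquadratic_def sum_distrib_left
  proof (rule sum.cong[OF refl])
    fix j assume "j \<in> {2..r}"
    then have "z ^ j = z * z ^ (j - 1)" by (cases j) auto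
    then show "c j * (2 * sqrt z * y) ^ (2 * j) = z / 2 * (2 * z ^ (j - 1) * c j * 2 ^ (2 * j) * y ^ (2 * j))"
      unfolding q2 by simp
  qed
  moreover have "(2 * sqrt z * y)\<^sup>2 = 4 * z * y\<^sup>2" using z by (simp add: power_mult_distrib)
  ultimately have "W 0 (2 * sqrt z * y) = - v / 2 * (4 * z * y\<^sup>2) + z / 2 * superquadratic z y + \<alpha> / 2 * (4 * z * y\<^sup>2)"
    unfolding W_def V_def by simp
  then have "- (W 0 (2 * sqrt z * y) / (z / 2)) = (v - \<alpha>) * (4 * y\<^sup>2) - superquadratic z y"
    using z by (simp add: field_simps)
  then show ?thesis by (simp add: weight_def)
qed

lemma crit_scaled:
  assumes z: "0 < z"
  shows "z / 2 - \<alpha> * (0 + 2 * sqrt z * y)\<^sup>2 = - \<alpha> * z * (4 * y\<^sup>2 - 1 / (2 * \<alpha>))"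
  using z alpha_pos by (simp add: power_mult_distrib field_simps)

lemma crit_int: assumes z: "0 < z" shows "integrable lborel (crit z)"
proof -
  have lam: "0 < z / 2" using z by simp
  have "integrable lborel (\<lambda>q. (z / 2 - \<alpha> * q\<^sup>2) * weight (z / 2) 0 q)"
    using Bochner_Integration.integrable_diff[OF integrable_mult_right[OF weight_int[OF lam, of 0], of "z / 2"] integrable_mult_right[OF weight_int[OF lam, of 2], of \<alpha>]]
    by (simp add: left_diff_distrib mult.assoc)
  then have "integrable lborel (\<lambda>y. (z / 2 - \<alpha> * (0 + 2 * sqrt z * y)\<^sup>2) * weight (z / 2) 0 (0 + 2 * sqrt z * y))"
    using z by (intro lborel_integrable_real_affine) auto
  then have "integrable lborel (\<lambda>y. - \<alpha> * z * crit z y)"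
    unfolding crit_scaled[OF z] weight_scaled[OF z] crit_def by (simp only: mult.assoc)
  then have "integrable lborel (\<lambda>y. (- 1 / (\<alpha> * z)) * (- \<alpha> * z * crit z y))"
    by (rule integrable_mult_right)
  then show ?thesis using z alpha_pos by simp
qed

text \<open>The substitution \<open>q = 2 y sqrt (2 lam)\<close> in \<open>second_moment_eq\<close>.\<close>

lemma slope_J:
  assumes lam: "0 < lam"
  shows "slope lam = - (2 * sqrt (2 * lam) * \<alpha> * (2 * lam)) * J (2 * lam)"
proof -
  define z where "z = 2 * lam"
  have z: "0 < z" and lz: "lam = z / 2" using lam by (auto simp: z_def)
  have "slope lam = (\<integral>q. (z / 2 - \<alpha> * q\<^sup>2) * weight (z / 2) 0 q \<partial>lborel)"
    unfolding slope_def[OF lam] second_moment_eq[OF lam] by (simp add: lz)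
  also have "\<dots> = \<bar>2 * sqrt z\<bar> *\<^sub>R (\<integral>y. (z / 2 - \<alpha> * (0 + 2 * sqrt z * y)\<^sup>2) * weight (z / 2) 0 (0 + 2 * sqrt z * y) \<partial>lborel)"
    using z by (intro lborel_integral_real_affine) auto
  also have "(\<integral>y. (z / 2 - \<alpha> * (0 + 2 * sqrt z * y)\<^sup>2) * weight (z / 2) 0 (0 + 2 * sqrt z * y) \<partial>lborel)
      = (\<integral>y. - \<alpha> * z * crit z y \<partial>lborel)"
    unfolding crit_scaled[OF z] weight_scaled[OF z] crit_def by (simp only: mult.assoc)
  also have "\<dots> = - \<alpha> * z * J z" by (simp add: J_def)
  finally show ?thesis using z by (simp add: z_def)
qed

text \<open>Normalized by its value at \<open>y0\<close>, the weight decreases with \<open>z\<close> for \<open>\<bar>y\<bar> > y0\<close> and increases for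
  \<open>\<bar>y\<bar> < y0\<close>, opposite to the sign of the factor \<open>4 y\<^sup>2 - 4 y0\<^sup>2\<close>.\<close>

lemma J_scaled_strict_antimono:
  assumes z: "0 < z" "z < z'"
  shows "exp (superquadratic z' y0) * J z' < exp (superquadratic z y0) * J z"
proof -
  let ?f = "\<lambda>z y. exp (superquadratic z y0) * crit z y"
  let ?d = "\<lambda>y. ?f z y - ?f z' y"
  have i: "integrable lborel (?f z)" "integrable lborel (?f z')"
    using crit_int z by auto
  have eq: "?f z y = exp ((v - \<alpha>) * (4 * y\<^sup>2)) * ((4 * y\<^sup>2 - 4 * y0\<^sup>2) * exp (superquadratic z y0 - superquadratic z y))" for z y
    by (simp add: crit_eq exp_diff)
  have pos: "0 < ?d y" if y: "\<bar>y\<bar> \<noteq> y0" for y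
  proof -
    have "0 < (4 * y\<^sup>2 - 4 * y0\<^sup>2) * (exp (superquadratic z y0 - superquadratic z y) - exp (superquadratic z' y0 - superquadratic z' y))"
    proof (cases "\<bar>y\<bar> < y0")
      case True
      then have "\<bar>y\<bar> ^ 2 < y0 ^ 2" by (intro power_strict_mono) auto
      moreover have "superquadratic z y0 - superquadratic z y < superquadratic z' y0 - superquadratic z' y"
        using superquadratic_diff_strict[of z z' y y0] z True y0 by simp
      ultimately show ?thesis by (intro mult_neg_neg) auto
    next
      case False
      then have yy: "y0 < \<bar>y\<bar>" using y by simp
      then have "y0 ^ 2 < \<bar>y\<bar> ^ 2" using y0 by (intro power_strict_mono) auto
      moreover have "superquadratic z' y0 - superquadratic z' y < superquadratic z y0 - superquadratic z y"
        using superquadratic_diff_strict[of z z' y0 y] z yy y0 by simp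
      ultimately show ?thesis by (intro mult_pos_pos) auto
    qed
    then have "0 < exp ((v - \<alpha>) * (4 * y\<^sup>2)) * ((4 * y\<^sup>2 - 4 * y0\<^sup>2) * (exp (superquadratic z y0 - superquadratic z y) - exp (superquadratic z' y0 - superquadratic z' y)))"
      by (rule mult_pos_pos[OF exp_gt_zero])
    then show ?thesis unfolding eq by (simp add: right_diff_distrib)
  qed
  have "0 < (\<integral>y. ?d y \<partial>lborel)"
  proof (rule integral_pos_except_finite[where X="{y0, - y0}"])
    show "0 < ?d y" if "y \<notin> {y0, - y0}" for y using that y0 by (intro pos) auto
    show "0 \<le> ?d y" for y
    proof (cases "\<bar>y\<bar> = y0")
      case True
      then have "y\<^sup>2 = y0\<^sup>2" by (metis power2_abs)
      then show ?thesis by (simp add: crit_eq)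
    qed (use pos in \<open>auto intro: less_imp_le\<close>)
  qed (use i in auto)
  then show ?thesis unfolding J_def using i by simp
qed

lemma J_isCont: assumes z: "0 < z" shows "isCont J z"
  unfolding J_def[abs_def]
proof (rule isCont_integral_dominated)
  show "0 < z / 2" using z by simp
  show "isCont (\<lambda>z. crit z y) z" for y
    unfolding crit_def by (intro continuous_intros superquadratic_isCont)
  show "integrable lborel (\<lambda>y. \<bar>crit (z / 2) y\<bar>)" using crit_int z by simp
  show "\<bar>crit x y\<bar> \<le> \<bar>crit (z / 2) y\<bar>" if "\<bar>x - z\<bar> < z / 2" for x y
  proof -
    have "z / 2 \<le> x" using that by linarith
    then have "superquadratic (z / 2) y \<le> superquadratic x y" using z by (intro superquadratic_mono_z) auto
    then show ?thesis unfolding crit_def abs_mult by (intro mult_left_mono) auto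
  qed
  show "crit x \<in> borel_measurable lborel" for x
    using crit_cont by (simp add: borel_measurable_continuous_onI)
qed

text \<open>The total derivative of \<open>y exp (- 4 \<alpha> y\<^sup>2)\<close>, or the variance of a centred Gaussian.\<close>

lemma gaussian_variance:
  shows "integrable lborel (\<lambda>y. (4 * y\<^sup>2 - 4 * y0\<^sup>2) * exp (- \<alpha> * (4 * y\<^sup>2)))"
    and "(\<integral>y. (4 * y\<^sup>2 - 4 * y0\<^sup>2) * exp (- \<alpha> * (4 * y\<^sup>2)) \<partial>lborel) = 0"
proof -
  interpret g: confining "\<lambda>y. y\<^sup>2" "1 / (4 * \<alpha>)" 1
  proof
    show "\<bar>q\<bar> - 1 \<le> q\<^sup>2" for q :: real
    proof -
      have "0 \<le> (\<bar>q\<bar> - 1 / 2)\<^sup>2" by simp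
      then show ?thesis by (simp add: power2_diff power_divide)
    qed
  qed (use alpha_pos in \<open>auto intro: smooth_power smooth_ident\<close>)
  have e: "exp (- (y\<^sup>2 / (1 / (4 * \<alpha>)))) = exp (- \<alpha> * (4 * y\<^sup>2))" for y
    by (simp add: mult_ac)
  have i: "integrable lborel (\<lambda>y. y ^ n * exp (- \<alpha> * (4 * y\<^sup>2)))" for n
    using g.weight_moment_integrable[of n] unfolding e .
  have eq: "(\<lambda>y. (4 * y\<^sup>2 - 4 * y0\<^sup>2) * exp (- \<alpha> * (4 * y\<^sup>2)))
      = (\<lambda>y. 4 * (y ^ 2 * exp (- \<alpha> * (4 * y\<^sup>2))) - 4 * y0\<^sup>2 * (y ^ 0 * exp (- \<alpha> * (4 * y\<^sup>2))))"
    by (auto simp: algebra_simps)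
  show int: "integrable lborel (\<lambda>y. (4 * y\<^sup>2 - 4 * y0\<^sup>2) * exp (- \<alpha> * (4 * y\<^sup>2)))"
    unfolding eq by (intro Bochner_Integration.integrable_diff integrable_mult_right i)
  have "(\<integral>y. - (2 * \<alpha>) * ((4 * y\<^sup>2 - 4 * y0\<^sup>2) * exp (- \<alpha> * (4 * y\<^sup>2))) \<partial>lborel) = 0"
  proof (rule g.weight_moment_deriv_integral[where k=1], unfold e)
    show "((\<lambda>y. y ^ 1 * exp (- \<alpha> * (4 * y\<^sup>2))) has_real_derivative
        - (2 * \<alpha>) * ((4 * y\<^sup>2 - 4 * y0\<^sup>2) * exp (- \<alpha> * (4 * y\<^sup>2)))) (at y)" for y
      unfolding y0(2) using alpha_pos
      by (auto intro!: derivative_eq_intros simp: field_simps power2_eq_square)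
    show "continuous_on UNIV (\<lambda>y. - (2 * \<alpha>) * ((4 * y\<^sup>2 - 4 * y0\<^sup>2) * exp (- \<alpha> * (4 * y\<^sup>2))))"
      by (intro continuous_intros)
    show "integrable lborel (\<lambda>y. - (2 * \<alpha>) * ((4 * y\<^sup>2 - 4 * y0\<^sup>2) * exp (- \<alpha> * (4 * y\<^sup>2))))"
      using int by (rule integrable_mult_right)
  qed
  then show "(\<integral>y. (4 * y\<^sup>2 - 4 * y0\<^sup>2) * exp (- \<alpha> * (4 * y\<^sup>2)) \<partial>lborel) = 0"
    using alpha_pos by simp
qed

text \<open>For small \<open>z\<close> the factor \<open>exp (4 v y\<^sup>2)\<close>, which increases with \<open>\<bar>y\<bar>\<close>, tilts the centred Gaussian
  identity towards large \<open>\<bar>y\<bar>\<close>; truncating it from above makes dominated convergence applicable.\<close>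

lemma J_pos_somewhere: obtains z where "0 < z" "0 < J z"
proof -
  \<comment> \<open>The value of \<open>exp (4 v y\<^sup>2)\<close> at \<open>2 y0\<close>: any level above the value at \<open>y0\<close> leaves the limit positive.\<close>
  define M where "M = exp (v * (16 * y0\<^sup>2))"
  define \<kappa> where "\<kappa> z y = exp (v * (4 * y\<^sup>2) - superquadratic z y)" for z y
  let ?G = "\<lambda>y. (4 * y\<^sup>2 - 4 * y0\<^sup>2) * exp (- \<alpha> * (4 * y\<^sup>2))"
  define g where "g z y = ?G y * (min (\<kappa> z y) M - \<kappa> z y0)" for z y
  have M0: "0 < M" by (simp add: M_def)
  have \<kappa>y0: "0 < \<kappa> z y" "\<kappa> z y \<le> exp (v * (4 * y\<^sup>2))" if "0 \<le> z" for z y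
    using superquadratic_nonneg[OF that, of y] by (auto simp: \<kappa>_def)
  have eM: "exp (v * (4 * y0\<^sup>2)) \<le> M"
    unfolding M_def using v_pos by (auto intro!: mult_left_mono)
  have m0: "g z \<in> borel_measurable lborel" for z
    unfolding g_def[abs_def] \<kappa>_def
    by (simp, intro borel_measurable_continuous_onI continuous_intros superquadratic_cont)
  have bnd: "norm (g z y) \<le> \<bar>2 * M * ?G y\<bar>" if "0 \<le> z" for z y
  proof -
    have "\<bar>min (\<kappa> z y) M - \<kappa> z y0\<bar> \<le> 2 * M"
      using \<kappa>y0[of z y] \<kappa>y0[of z y0] eM that M0 by (auto simp: abs_le_iff min_def)
    then have "\<bar>?G y\<bar> * \<bar>min (\<kappa> z y) M - \<kappa> z y0\<bar> \<le> \<bar>?G y\<bar> * (2 * M)" by (rule mult_left_mono) simp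
    then show ?thesis using M0 by (simp add: g_def abs_mult mult_ac)
  qed
  have iw: "integrable lborel (\<lambda>y. \<bar>2 * M * ?G y\<bar>)"
    using gaussian_variance(1) by (intro integrable_abs integrable_mult_right)
  have ig0: "integrable lborel (g z)" if "0 \<le> z" for z
    by (rule Bochner_Integration.integrable_bound[OF iw m0], rule AE_I2,
        rule order.trans[OF bnd[OF that]], unfold real_norm_def, rule abs_ge_self)
  have J_ge: "(\<integral>y. g z y \<partial>lborel) \<le> J z" and ig: "integrable lborel (g z)" if z: "0 < z" for z
  proof -
    have split: "crit z y = ?G y * \<kappa> z y" for y
      unfolding crit_eq \<kappa>_def mult.assoc exp_add[symmetric] by (simp add: algebra_simps)
    have expand: "G * (x - x') = G * x - x' * G" for G x x' :: real
      by (simp add: algebra_simps)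
    have le: "g z y \<le> ?G y * \<kappa> z y - \<kappa> z y0 * ?G y" for y
    proof (cases "\<kappa> z y \<le> M")
      case True
      then have "min (\<kappa> z y) M = \<kappa> z y" by simp
      then show ?thesis unfolding g_def by (simp only: expand order_refl)
    next
      case False
      then have "exp (v * (4 * y0\<^sup>2)) < exp (v * (4 * y\<^sup>2))" using eM \<kappa>y0[of z y] z by linarith
      then have "0 \<le> 4 * y\<^sup>2 - 4 * y0\<^sup>2" using v_pos by simp
      then have "0 \<le> ?G y" by simp
      then have "?G y * min (\<kappa> z y) M \<le> ?G y * \<kappa> z y" by (intro mult_left_mono) auto
      then show ?thesis unfolding g_def expand by (rule diff_right_mono)
    qed
    show ig: "integrable lborel (g z)" by (rule ig0) (use z in simp)
    have ic: "integrable lborel (\<lambda>y. ?G y * \<kappa> z y)" unfolding split[symmetric] by (rule crit_int[OF z])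
    have "(\<integral>y. g z y \<partial>lborel) \<le> (\<integral>y. ?G y * \<kappa> z y - \<kappa> z y0 * ?G y \<partial>lborel)"
      by (rule integral_mono[OF ig _ le]) (intro Bochner_Integration.integrable_diff ic integrable_mult_right gaussian_variance(1))
    also have "\<dots> = J z - \<kappa> z y0 * 0"
      using ic gaussian_variance by (subst integral_diff_cmult) (auto simp: J_def split)
    finally show "(\<integral>y. g z y \<partial>lborel) \<le> J z" by simp
  qed
  define sn where "sn n = inverse (real (Suc n))" for n
  have sn: "0 < sn n" "sn \<longlonglongrightarrow> 0" for n
    using LIMSEQ_inverse_real_of_nat by (auto simp: sn_def[abs_def])
  have \<kappa>lim: "(\<lambda>n. \<kappa> (sn n) y) \<longlonglongrightarrow> \<kappa> 0 y" for y
    unfolding \<kappa>_def by (intro tendsto_intros isCont_tendsto_compose[OF superquadratic_isCont] sn)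
  have lim: "(\<lambda>n. \<integral>y. g (sn n) y \<partial>lborel) \<longlonglongrightarrow> (\<integral>y. g 0 y \<partial>lborel)"
  proof (rule integral_dominated_convergence[OF m0 m0 iw])
    show "AE y in lborel. (\<lambda>n. g (sn n) y) \<longlonglongrightarrow> g 0 y"
      unfolding g_def by (intro AE_I2 tendsto_intros tendsto_min \<kappa>lim)
    show "AE y in lborel. norm (g (sn n) y) \<le> \<bar>2 * M * ?G y\<bar>" for n
      by (rule AE_I2, rule bnd, rule less_imp_le[OF sn(1)])
  qed
  have \<kappa>0: "\<kappa> 0 y = exp (v * (4 * y\<^sup>2))" for y by (simp add: \<kappa>_def superquadratic_0)
  have g0: "0 < g 0 y" if y: "\<bar>y\<bar> \<noteq> y0" for y
  proof (cases "\<bar>y\<bar> < y0")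
    case True
    then have "\<bar>y\<bar> ^ 2 < y0 ^ 2" by (intro power_strict_mono) auto
    then have 1: "4 * y\<^sup>2 - 4 * y0\<^sup>2 < 0" by simp
    then have "exp (v * (4 * y\<^sup>2)) < exp (v * (4 * y0\<^sup>2))" using v_pos by simp
    then have "min (\<kappa> 0 y) M - \<kappa> 0 y0 < 0" unfolding \<kappa>0 by linarith
    moreover have "?G y < 0" using 1 by (intro mult_neg_pos) auto
    ultimately show ?thesis unfolding g_def by (intro mult_neg_neg)
  next
    case False
    then have "y0 ^ 2 < \<bar>y\<bar> ^ 2" using y y0 by (intro power_strict_mono) auto
    then have 1: "0 < 4 * y\<^sup>2 - 4 * y0\<^sup>2" by simp
    then have "exp (v * (4 * y0\<^sup>2)) < exp (v * (4 * y\<^sup>2))" using v_pos by simp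
    moreover have "exp (v * (4 * y0\<^sup>2)) < M"
      unfolding M_def exp_less_cancel_iff using v_pos y0(1) by (intro mult_strict_left_mono) auto
    ultimately have "0 < min (\<kappa> 0 y) M - \<kappa> 0 y0" unfolding \<kappa>0 by simp
    moreover have "0 < ?G y" using 1 by (intro mult_pos_pos) auto
    ultimately show ?thesis unfolding g_def by (rule mult_pos_pos[rotated])
  qed
  have "0 < (\<integral>y. g 0 y \<partial>lborel)"
  proof (rule integral_pos_except_finite[where X="{y0, - y0}"])
    show "integrable lborel (g 0)" by (rule ig0) simp
    show "0 < g 0 y" if "y \<notin> {y0, - y0}" for y using that y0 by (intro g0) auto
    show "0 \<le> g 0 y" for y
    proof (cases "\<bar>y\<bar> = y0")
      case True
      then have "y\<^sup>2 = y0\<^sup>2" by (metis power2_abs)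
      then show ?thesis by (simp add: g_def)
    qed (use g0 in \<open>auto intro: less_imp_le\<close>)
  qed simp
  then obtain n where "0 < (\<integral>y. g (sn n) y \<partial>lborel)"
    using order_tendstoD(1)[OF lim] by (auto simp: eventually_sequentially)
  then have "0 < J (sn n)" using J_ge[OF sn(1)[of n]] by linarith
  then show ?thesis using that sn(1) by blast
qed

text \<open>As \<open>z\<close> grows, the confinement suppresses \<open>\<bar>y\<bar> > y0\<close> relative to \<open>\<bar>y\<bar> < y0\<close>, where the integrand
  is negative.\<close>

lemma J_neg_somewhere: obtains z where "0 < z" "J z < 0"
proof -
  let ?E = "\<lambda>y. (4 * y\<^sup>2 - 4 * y0\<^sup>2) * exp ((v - \<alpha>) * (4 * y\<^sup>2))"
  define e where "e z y = exp (superquadratic z y0 - superquadratic z y)" for z y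
  define h where "h z y = ?E y * min 1 (e z y)" for z y
  have far: "e z' y \<le> e z y" "e z y \<le> 1" if "0 \<le> z" "z \<le> z'" "y0 \<le> \<bar>y\<bar>" for z z' y
  proof -
    have ord: "superquadratic z' y0 - superquadratic z y0 \<le> superquadratic z' y - superquadratic z y" if zz: "0 \<le> z" "z \<le> z'" for z z'
    proof (cases "z = z' \<or> \<bar>y\<bar> = y0")
      case True
      then show ?thesis using superquadratic_even[of z y] superquadratic_even[of z' y] by auto
    next
      case False
      then show ?thesis using superquadratic_diff_strict[of z z' y0 y] zz \<open>y0 \<le> \<bar>y\<bar>\<close> y0 by simp
    qed
    show "e z' y \<le> e z y" using ord[OF that(1,2)] by (simp add: e_def)
    show "e z y \<le> 1" using ord[of 0 z] that(1) superquadratic_0 by (simp add: e_def)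
  qed
  have near: "1 \<le> e z y" if "0 \<le> z" "\<bar>y\<bar> < y0" for z y
    using superquadratic_diff_strict[of 0 z y y0] that y0 superquadratic_0 by (cases "z = 0") (auto simp: e_def)
  have crit_e: "exp (superquadratic z y0) * crit z y = ?E y * e z y" for z y
    by (simp add: crit_eq e_def exp_diff)
  have hm: "h z \<in> borel_measurable lborel" for z
    unfolding h_def[abs_def] e_def
    by (simp, intro borel_measurable_continuous_onI continuous_intros superquadratic_cont)
  have le: "?E y * e z y \<le> h z y" and ab: "\<bar>h z y\<bar> \<le> \<bar>?E y * e z y\<bar>" if z: "0 \<le> z" for z y
  proof -
    have e0: "0 < e z y" by (simp add: e_def)
    show "?E y * e z y \<le> h z y"
    proof (cases "\<bar>y\<bar> < y0")
      case True
      then have "\<bar>y\<bar> ^ 2 \<le> y0 ^ 2" by (intro power_mono) auto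
      then have "?E y \<le> 0" by (intro mult_nonpos_nonneg) auto
      then show ?thesis unfolding h_def by (intro mult_left_mono_neg) auto
    next
      case False
      then show ?thesis using far(2)[of z z y] z by (simp add: h_def min_def)
    qed
    have "\<bar>?E y\<bar> * \<bar>min 1 (e z y)\<bar> \<le> \<bar>?E y\<bar> * \<bar>e z y\<bar>"
      using e0 by (intro mult_left_mono) auto
    then show "\<bar>h z y\<bar> \<le> \<bar>?E y * e z y\<bar>" unfolding h_def abs_mult .
  qed
  have ie: "integrable lborel (\<lambda>y. ?E y * e z y)" if "0 < z" for z
    unfolding crit_e[symmetric] using crit_int[OF that] by simp
  have ih: "integrable lborel (h z)" if "0 < z" for z
    by (rule Bochner_Integration.integrable_bound[OF ie[OF that] hm]) (use ab[of z] that in auto)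
  have J_le: "exp (superquadratic z y0) * J z \<le> (\<integral>y. h z y \<partial>lborel)" if "0 < z" for z
  proof -
    have "exp (superquadratic z y0) * J z = (\<integral>y. ?E y * e z y \<partial>lborel)"
      unfolding crit_e[symmetric] J_def by simp
    also have "\<dots> \<le> (\<integral>y. h z y \<partial>lborel)"
      by (rule integral_mono[OF ie ih]) (use le that in auto)
    finally show ?thesis .
  qed
  \<comment> \<open>The pointwise limit: outside \<open>[- y0, y0]\<close> the normalized weight tends to zero.\<close>
  let ?l = "\<lambda>y. ?E y * indicator {- y0<..<y0} y"
  have lim: "(\<lambda>n. \<integral>y. h (real (Suc n)) y \<partial>lborel) \<longlonglongrightarrow> (\<integral>y. ?l y \<partial>lborel)"
    and il: "integrable lborel ?l"
  proof -
    have lm: "?l \<in> borel_measurable lborel"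
      by (intro borel_measurable_times borel_measurable_indicator)
        (auto intro!: borel_measurable_continuous_onI continuous_intros)
    have w: "integrable lborel (\<lambda>y. \<bar>h 1 y\<bar>)" using ih[of 1] by simp
    have b: "AE y in lborel. norm (h (real (Suc n)) y) \<le> \<bar>h 1 y\<bar>" for n
    proof (rule AE_I2)
      fix y
      have "min 1 (e (real (Suc n)) y) \<le> min 1 (e 1 y)"
        using near[of 1 y] far(1)[of 1 "real (Suc n)" y] by (cases "\<bar>y\<bar> < y0") (auto simp: min_def)
      moreover have "0 < min 1 (e (real (Suc n)) y)" by (simp add: e_def)
      ultimately have "\<bar>?E y\<bar> * \<bar>min 1 (e (real (Suc n)) y)\<bar> \<le> \<bar>?E y\<bar> * \<bar>min 1 (e 1 y)\<bar>"
        by (intro mult_left_mono) auto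
      then show "norm (h (real (Suc n)) y) \<le> \<bar>h 1 y\<bar>" by (simp only: h_def abs_mult real_norm_def)
    qed
    have l: "AE y in lborel. (\<lambda>n. h (real (Suc n)) y) \<longlonglongrightarrow> ?l y"
    proof (rule AE_I2)
      fix y
      consider "\<bar>y\<bar> < y0" | "\<bar>y\<bar> = y0" | "y0 < \<bar>y\<bar>" by linarith
      then show "(\<lambda>n. h (real (Suc n)) y) \<longlonglongrightarrow> ?l y"
      proof cases
        case 1
        then have "h (real (Suc n)) y = ?l y" for n
          using near[of "real (Suc n)" y] by (simp add: h_def min_def abs_less_iff)
        then show ?thesis by simp
      next
        case 2
        then have "y\<^sup>2 = y0\<^sup>2" by (metis power2_abs)
        then show ?thesis by (simp add: h_def)
      next
        case 3
        define g where "g = superquadratic 1 y - superquadratic 1 y0"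
        have g: "0 < g" using superquadratic_diff_strict[of 0 1 y0 y] 3 y0 superquadratic_0 by (simp add: g_def)
        have "superquadratic (real (Suc n)) y - superquadratic (real (Suc n)) y0 \<ge> real (Suc n) * g" for n
        proof -
          have y_le: "y0 ^ (2 * j) \<le> y ^ (2 * j)" for j
          proof -
            have "y0 ^ (2 * j) \<le> \<bar>y\<bar> ^ (2 * j)" using 3 y0 by (intro power_mono) auto
            then show ?thesis by (simp add: power_mult)
          qed
          have "real (Suc n) * (2 * 1 ^ (j - 1) * c j * 2 ^ (2 * j) * (y ^ (2 * j) - y0 ^ (2 * j)))
              \<le> 2 * real (Suc n) ^ (j - 1) * c j * 2 ^ (2 * j) * (y ^ (2 * j) - y0 ^ (2 * j))" if "j \<in> {2..r}" for j
          proof -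
            have "real (Suc n) ^ 1 \<le> real (Suc n) ^ (j - 1)" using that by (intro power_increasing) auto
            then have "real (Suc n) * (2 * c j * 2 ^ (2 * j) * (y ^ (2 * j) - y0 ^ (2 * j)))
              \<le> real (Suc n) ^ (j - 1) * (2 * c j * 2 ^ (2 * j) * (y ^ (2 * j) - y0 ^ (2 * j)))"
              using c_nonneg[of j] y_le[of j] by (intro mult_right_mono) auto
            then show ?thesis by (simp add: mult_ac)
          qed
          then have "(\<Sum>j=2..r. real (Suc n) * (2 * 1 ^ (j - 1) * c j * 2 ^ (2 * j) * (y ^ (2 * j) - y0 ^ (2 * j))))
            \<le> (\<Sum>j=2..r. 2 * real (Suc n) ^ (j - 1) * c j * 2 ^ (2 * j) * (y ^ (2 * j) - y0 ^ (2 * j)))"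
            by (rule sum_mono)
          then show ?thesis
            by (simp add: g_def superquadratic_def right_diff_distrib sum_subtractf sum_distrib_left)
        qed
        then have eb: "e (real (Suc n)) y \<le> exp (- (real (Suc n) * g))" for n
          using le_diff_eq by (simp add: e_def) (smt (verit))
        have "(\<lambda>n. exp (- (real (Suc n) * g))) \<longlonglongrightarrow> 0"
        proof -
          have "filterlim (\<lambda>n. g * real (Suc n)) at_top sequentially"
            by (rule filterlim_tendsto_pos_mult_at_top[OF tendsto_const g])
              (rule filterlim_compose[OF filterlim_real_sequentially filterlim_Suc])
          then show ?thesis
            using filterlim_compose[OF exp_at_bot filterlim_uminus_at_bot_at_top[THEN filterlim_compose]]
            by (simp add: mult.commute)
        qed
        then have "(\<lambda>n. e (real (Suc n)) y) \<longlonglongrightarrow> 0"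
          by (rule Lim_null_comparison[rotated]) (use eb in \<open>auto simp: e_def\<close>)
        then have "(\<lambda>n. ?E y * min 1 (e (real (Suc n)) y)) \<longlonglongrightarrow> ?E y * min 1 0"
          by (intro tendsto_intros tendsto_min)
        then show ?thesis using 3 by (auto simp: h_def indicator_def abs_less_iff)
      qed
    qed
    show "(\<lambda>n. \<integral>y. h (real (Suc n)) y \<partial>lborel) \<longlonglongrightarrow> (\<integral>y. ?l y \<partial>lborel)"
      by (rule integral_dominated_convergence[OF lm hm w l b])
    show "integrable lborel ?l"
      by (rule integrable_dominated_convergence[OF lm hm w l b])
  qed
  have neg: "(\<integral>y. ?l y \<partial>lborel) < 0"
  proof -
    have En: "?E y < 0" if "\<bar>y\<bar> < y0" for y
    proof -
      have "\<bar>y\<bar> ^ 2 < y0 ^ 2" using that by (intro power_strict_mono) auto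
      then show ?thesis by (intro mult_neg_pos) auto
    qed
    have nn: "0 \<le> - ?l y" for y
      using En[of y] by (cases "\<bar>y\<bar> < y0") (auto simp: indicator_def abs_less_iff)
    have "0 < (\<integral>y. - ?l y \<partial>lborel)"
      by (rule integral_pos_if_pos_on_interval[OF integrable_minus[OF il] nn, of "- y0" y0])
        (use y0 En in \<open>auto simp: abs_less_iff\<close>)
    then show ?thesis by simp
  qed
  obtain n where "(\<integral>y. h (real (Suc n)) y \<partial>lborel) < 0"
    using order_tendstoD(2)[OF lim neg] by (auto simp: eventually_sequentially)
  then have "exp (superquadratic (real (Suc n)) y0) * J (real (Suc n)) < 0"
    using J_le[of "real (Suc n)"] by (simp del: of_nat_Suc)
  then have "J (real (Suc n)) < 0" by (simp add: mult_less_0_iff del: of_nat_Suc)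
  then show ?thesis using that[of "real (Suc n)"] by simp
qed

lemma J_sign_change:
  obtains zc where "0 < zc" "J zc = 0" "\<And>z. 0 < z \<Longrightarrow> z < zc \<Longrightarrow> 0 < J z" "\<And>z. zc < z \<Longrightarrow> J z < 0"
proof -
  obtain a where a: "0 < a" "0 < J a" using J_pos_somewhere .
  obtain b where b: "0 < b" "J b < 0" using J_neg_somewhere .
  have sgn: "0 < exp (superquadratic z y0) * J z \<longleftrightarrow> 0 < J z" "exp (superquadratic z y0) * J z < 0 \<longleftrightarrow> J z < 0" for z
    by (auto simp: zero_less_mult_iff mult_less_0_iff)
  have "a < b"
  proof (rule ccontr)
    assume "\<not> a < b"
    then have "b < a" using a b by (cases "a = b") auto
    from J_scaled_strict_antimono[OF b(1) this] show False using a b sgn by (smt (verit))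
  qed
  moreover have "continuous_on {a..b} J"
    using J_isCont a by (intro continuous_at_imp_continuous_on) auto
  ultimately obtain zc where zc: "a \<le> zc" "zc \<le> b" "J zc = 0"
    using IVT2'[of J b 0 a] a b by auto
  have zc0: "0 < zc" using zc a by simp
  show ?thesis
  proof (rule that[OF zc0 zc(3)])
    show "0 < J z" if "0 < z" "z < zc" for z
      using J_scaled_strict_antimono[OF that] zc(3) sgn by simp
    show "J z < 0" if "zc < z" for z
      using J_scaled_strict_antimono[OF zc0 that] zc(3) sgn by simp
  qed
qed

end

section \<open>Gibbs densities are stationary\<close>

lemma test_function_facts:
  assumes "test_function \<phi>"
  obtains R where "supp_box \<phi> R" "supp_box (partial_p \<phi>) R"
    "continuous_on UNIV \<phi>" "continuous_on UNIV (partial_q \<phi>)" "continuous_on UNIV (partial_p \<phi>)"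
    "continuous_on UNIV (partial_p (partial_p \<phi>))"
    "\<And>q p. ((\<lambda>q. \<phi> (q, p)) has_real_derivative partial_q \<phi> (q, p)) (at q)"
    "\<And>q p. ((\<lambda>p. \<phi> (q, p)) has_real_derivative partial_p \<phi> (q, p)) (at p)"
    "\<And>q p. ((\<lambda>p. partial_p \<phi> (q, p)) has_real_derivative partial_p (partial_p \<phi>) (q, p)) (at p)"
proof -
  have d: "(partial_q ^^ k) ((partial_p ^^ l) \<phi>) differentiable (at x)" for k l x
    using assms unfolding test_function_def by blast
  have d0: "\<phi> differentiable (at x)" and dq: "partial_q \<phi> differentiable (at x)"
    and dp: "partial_p \<phi> differentiable (at x)" and dpp: "partial_p (partial_p \<phi>) differentiable (at x)" for x
    using d[of 0 0 x] d[of 1 0 x] d[of 0 1 x] d[of 0 2 x] by (auto simp: numeral_2_eq_2)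
  have cont: "continuous_on UNIV f" if "\<And>x. f differentiable (at x)" for f :: "real \<times> real \<Rightarrow> real"
    using that by (meson continuous_at_imp_continuous_on differentiable_imp_continuous_within)
  have sq: "((\<lambda>q. f (q, p)) has_real_derivative partial_q f (q, p)) (at q)"
    and sp: "((\<lambda>p. f (q, p)) has_real_derivative partial_p f (q, p)) (at p)"
    if f: "\<And>x. f differentiable (at x)" for f q p
  proof -
    have "(\<lambda>q. (q, p)) differentiable (at q)" "(\<lambda>p. (q, p)) differentiable (at p)"
      unfolding differentiable_def by (auto intro!: exI derivative_eq_intros)
    then have "(f \<circ> (\<lambda>q. (q, p))) differentiable (at q)" "(f \<circ> (\<lambda>p. (q, p))) differentiable (at p)"
      using f by (auto intro: differentiable_chain_at)
    then show "((\<lambda>q. f (q, p)) has_real_derivative partial_q f (q, p)) (at q)"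
      "((\<lambda>p. f (q, p)) has_real_derivative partial_p f (q, p)) (at p)"
      by (auto dest!: real_differentiable_deriv simp: o_def partial_q_def partial_p_def)
  qed
  have "bounded (closure {x. \<phi> x \<noteq> 0})"
    using assms unfolding test_function_def by (blast intro: compact_imp_bounded)
  then have "bounded {x. \<phi> x \<noteq> 0}" by (rule bounded_subset) (rule closure_subset)
  then obtain R where R: "\<And>x. \<phi> x \<noteq> 0 \<Longrightarrow> norm x \<le> R" unfolding bounded_iff by blast
  have s: "\<phi> z = 0" if "R < \<bar>fst z\<bar> \<or> R < \<bar>snd z\<bar>" for z
  proof (rule ccontr)
    assume "\<phi> z \<noteq> 0"
    then have "norm z \<le> R" by (rule R)
    then show False
      using that norm_fst_le[of "fst z" "snd z"] norm_snd_le[of "snd z" "fst z"] by simp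
  qed
  have sb: "supp_box \<phi> R" using s by (simp add: supp_box_def)
  have "partial_p \<phi> (q, p) = 0" if "R < \<bar>q\<bar> \<or> R < \<bar>p\<bar>" for q p
  proof (cases "R < \<bar>q\<bar>")
    case True
    then have "(\<lambda>p. \<phi> (q, p)) = (\<lambda>p. 0)" using s by auto
    then show ?thesis by (simp add: partial_p_def)
  next
    case False
    then have "supp_in (\<lambda>p. \<phi> (q, p)) R" "R < \<bar>p\<bar>" using s that by (auto simp: supp_in_def)
    then have "deriv (\<lambda>p. \<phi> (q, p)) p = 0" 
      using supp_in_deriv[of "\<lambda>p. \<phi> (q, p)" R] by (simp add: supp_in_def)
    then show ?thesis by (simp add: partial_p_def)
  qed
  then have sbp: "supp_box (partial_p \<phi>) R" by (auto simp: supp_box_def)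
  show ?thesis
    by (rule that[OF sb sbp cont[OF d0] cont[OF dq] cont[OF dp] cont[OF dpp] sq[OF d0] sp[OF d0] sp[OF dp]])
qed

context confining
begin

text \<open>For every test function the integrand is a sum of total derivatives in \<open>q\<close> and in \<open>p\<close>.\<close>

lemma mu_stationary:
  assumes "test_function \<phi>"
  shows "(\<integral>z. mu z * (snd z * partial_q \<phi> z - (deriv W (fst z) + snd z) * partial_p \<phi> z
     + lam * partial_p (partial_p \<phi>) z) \<partial>lborel) = 0"
proof -
  obtain R where R: "supp_box \<phi> R" "supp_box (partial_p \<phi>) R"
    and c: "continuous_on UNIV \<phi>" "continuous_on UNIV (partial_q \<phi>)" "continuous_on UNIV (partial_p \<phi>)"
    "continuous_on UNIV (partial_p (partial_p \<phi>))"
    and d: "\<And>q p. ((\<lambda>q. \<phi> (q, p)) has_real_derivative partial_q \<phi> (q, p)) (at q)"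
    "\<And>q p. ((\<lambda>p. \<phi> (q, p)) has_real_derivative partial_p \<phi> (q, p)) (at p)"
    "\<And>q p. ((\<lambda>p. partial_p \<phi> (q, p)) has_real_derivative partial_p (partial_p \<phi>) (q, p)) (at p)"
    using test_function_facts[OF assms] by blast
  note cW = continuous_fst_comp[OF smooth_deriv[OF smooth_W]]
  define G1 where "G1 z = snd z * (partial_q \<phi> z * mu z + - (deriv W (fst z) * mu z / lam) * \<phi> z)" for z
  define G2 where "G2 z = lam * (partial_p (partial_p \<phi>) z * mu z + - (snd z * mu z / lam) * partial_p \<phi> z)
    - deriv W (fst z) * (partial_p \<phi> z * mu z + - (snd z * mu z / lam) * \<phi> z)" for z
  have d1: "((\<lambda>q. snd (q, p) * (\<phi> (q, p) * mu (q, p))) has_real_derivative G1 (q, p)) (at q)" for q p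
    unfolding G1_def fst_conv snd_conv by (intro DERIV_cmult DERIV_mult d mu_DERIV_q)
  have c1: "continuous_on UNIV G1" unfolding G1_def
    by (intro continuous_intros c continuous_mu cW) (use lam_pos in auto)
  have s1: "supp_box (\<lambda>z. snd z * (\<phi> z * mu z)) R" using R by (auto simp: supp_box_def)
  have d2: "((\<lambda>p. lam * (partial_p \<phi> (q, p) * mu (q, p)) - deriv W (fst (q, p)) * (\<phi> (q, p) * mu (q, p)))
      has_real_derivative G2 (q, p)) (at p)" for q p
    unfolding G2_def fst_conv snd_conv by (intro DERIV_diff DERIV_cmult DERIV_mult d mu_DERIV_p)
  have c2: "continuous_on UNIV G2" unfolding G2_def
    by (intro continuous_intros c continuous_mu cW) (use lam_pos in auto)
  have s2: "supp_box (\<lambda>z. lam * (partial_p \<phi> z * mu z) - deriv W (fst z) * (\<phi> z * mu z)) R"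
    using R by (auto simp: supp_box_def)
  note 1 = integral_partial_q[of "\<lambda>z. snd z * (\<phi> z * mu z)", OF d1 c1 s1]
    and 2 = integral_partial_p[of "\<lambda>z. lam * (partial_p \<phi> z * mu z) - deriv W (fst z) * (\<phi> z * mu z)", OF d2 c2 s2]
  have "(\<integral>z. mu z * (snd z * partial_q \<phi> z - (deriv W (fst z) + snd z) * partial_p \<phi> z
     + lam * partial_p (partial_p \<phi>) z) \<partial>lborel) = (\<integral>z. G1 z + G2 z \<partial>lborel)"
    by (rule Bochner_Integration.integral_cong)
      (use lam_pos in \<open>auto simp: G1_def G2_def algebra_simps\<close>)
  also have "\<dots> = 0" using 1 2 by simp
  finally show ?thesis .
qed

lemma moment_mu_int: "integrable lborel (\<lambda>z. fst z ^ n * mu z)"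
proof (rule Bochner_Integration.integrable_bound[OF integrable_mu_moment[of n 0]])
  show "(\<lambda>z. fst z ^ n * mu z) \<in> borel_measurable lborel"
    by (simp, intro borel_measurable_continuous_onI continuous_intros continuous_mu)
qed (auto simp: abs_mult power_abs)

definition partition :: real where
  "partition = (\<integral>z. mu z \<partial>lborel)"

lemma partition_pos: "0 < partition"
proof -
  have "partition = (\<integral>q. exp (- (W q / lam)) \<partial>lborel) * (\<integral>p. exp (- (p\<^sup>2 / (2 * lam))) \<partial>lborel)"
    unfolding partition_def mu_def[abs_def]
    using tensor_integral(2)[OF integrable_weight[of 0] integrable_gauss[of 0]] by simp
  moreover have "0 < (\<integral>q. exp (- (W q / lam)) \<partial>lborel)" "0 < (\<integral>p. exp (- (p\<^sup>2 / (2 * lam))) \<partial>lborel)"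
    using integrable_weight[of 0] integrable_gauss[of 0]
    by (auto intro!: integral_pos_except_finite[of _ "{}"])
  ultimately show ?thesis by simp
qed

lemma mu_le: "mu z \<le> exp (k0 / lam)"
proof -
  have "- (W (fst z) / lam) \<le> k0 / lam"
    using W_ge[of "fst z"] lam_pos by (simp add: field_simps)
  then have "exp (- (W (fst z) / lam)) * exp (- ((snd z)\<^sup>2 / (2 * lam))) \<le> exp (k0 / lam) * 1"
    using lam_pos by (intro mult_mono) auto
  then show ?thesis by (simp add: mu_def)
qed

end

section \<open>Invariant probabilities and fixed points of the mean\<close>

context double_well
begin

definition gibbs :: "real \<Rightarrow> real \<Rightarrow> real \<times> real \<Rightarrow> real" where
  "gibbs lam m z = confining.mu (W m) lam z / confining.partition (W m) lam"

definition gibbs_measure :: "real \<Rightarrow> real \<Rightarrow> (real \<times> real) measure" where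
  "gibbs_measure lam m = density lborel (\<lambda>z. ennreal (gibbs lam m z))"

definition \<psi> :: "real \<Rightarrow> real" where "\<psi> x = \<alpha> / 2 * x\<^sup>2"

lemma deriv_psi: "deriv \<psi> = (\<lambda>x. \<alpha> * x)"
proof (rule deriv_eqI)
  fix x show "(\<psi> has_real_derivative \<alpha> * x) (at x)"
    unfolding \<psi>_def[abs_def] using DERIV_cmult[OF DERIV_pow[of 2 x UNIV], of "\<alpha> / 2"] by simp
qed

lemma deriv_V: "deriv V q = q * P q"
  by (rule DERIV_imp_deriv[OF V_DERIV])

context
  fixes lam :: real
  assumes lam: "0 < lam"
begin

lemma gibbs_nonneg: "0 \<le> gibbs lam m z"
proof -
  obtain k0 where "confining (W m) lam k0" using W_confining[OF lam] .
  then interpret confining "W m" lam k0 .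
  show ?thesis unfolding gibbs_def using mu_pos[of z] partition_pos by simp
qed

lemma gibbs_moment_int: "integrable lborel (\<lambda>z. fst z ^ n * gibbs lam m z)"
proof -
  obtain k0 where "confining (W m) lam k0" using W_confining[OF lam] .
  then interpret confining "W m" lam k0 .
  show ?thesis unfolding gibbs_def using integrable_divide[OF moment_mu_int[of n], of partition] by simp
qed

lemma gibbs_total: "(\<integral>z. gibbs lam m z \<partial>lborel) = 1"
proof -
  obtain k0 where "confining (W m) lam k0" using W_confining[OF lam] .
  then interpret confining "W m" lam k0 .
  show ?thesis unfolding gibbs_def using partition_pos by (simp add: partition_def[symmetric])
qed

lemma gibbs_probability_density: "probability_density (gibbs lam m)"
  using gibbs_nonneg gibbs_moment_int[of 0 m] gibbs_total by (simp add: probability_density_def)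

text \<open>The density is a product, so the Gaussian factor in \<open>p\<close> cancels.\<close>

lemma gibbs_mean_iff: "(\<integral>z. fst z * gibbs lam m z \<partial>lborel) = m \<longleftrightarrow> Psi lam m = 0"
proof -
  obtain k0 where "confining (W m) lam k0" using W_confining[OF lam] .
  then interpret confining "W m" lam k0 .
  let ?g = "\<lambda>p. exp (- (p\<^sup>2 / (2 * lam)))"
  have ig: "integrable lborel ?g" using integrable_gauss[of 0] by simp
  have iw: "integrable lborel (\<lambda>q. (q - m) * weight lam m q)"
    using Bochner_Integration.integrable_diff[OF weight_int[OF lam, of 1] integrable_mult_right[OF weight_int[OF lam, of 0], of m]]
    by (simp add: algebra_simps)
  have iw0: "integrable lborel (weight lam m)" using weight_int[OF lam, of 0] by simp
  have Z: "partition = (\<integral>q. weight lam m q \<partial>lborel) * (\<integral>p. ?g p \<partial>lborel)"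
    unfolding partition_def mu_def[abs_def] using tensor_integral(2)[OF iw0 ig] by (simp add: weight_def)
  then have g0: "(\<integral>p. ?g p \<partial>lborel) \<noteq> 0" using partition_pos by auto
  have "(\<integral>z. fst z * gibbs lam m z \<partial>lborel) - m = (\<integral>z. fst z ^ 1 * gibbs lam m z - m * (fst z ^ 0 * gibbs lam m z) \<partial>lborel)"
    using gibbs_moment_int[of 1 m] gibbs_moment_int[of 0 m] gibbs_total[of m] by simp
  also have "\<dots> = (\<integral>z. ((fst z - m) * weight lam m (fst z)) * ?g (snd z) / partition \<partial>lborel)"
    by (rule Bochner_Integration.integral_cong) (auto simp: gibbs_def mu_def weight_def algebra_simps diff_divide_distrib)
  also have "\<dots> = Psi lam m * (\<integral>p. ?g p \<partial>lborel) / partition"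
    using tensor_integral(2)[OF iw ig] by (simp add: Psi_def)
  finally have "(\<integral>z. fst z * gibbs lam m z \<partial>lborel) - m = Psi lam m * (\<integral>p. ?g p \<partial>lborel) / partition" .
  then show ?thesis using g0 partition_pos by auto
qed

lemma convolution_linear_force:
  assumes int: "integrable lborel \<rho>" "(\<integral>z. \<rho> z \<partial>lborel) = 1" and int1: "integrable lborel (\<lambda>z. fst z * \<rho> z)"
  shows "convolution (deriv \<psi>) \<rho> q = \<alpha> * (q - (\<integral>z. fst z * \<rho> z \<partial>lborel))"
proof -
  have "convolution (deriv \<psi>) \<rho> q = (\<integral>z. \<alpha> * q * \<rho> z - \<alpha> * (fst z * \<rho> z) \<partial>lborel)"
    unfolding convolution_def deriv_psi by (rule Bochner_Integration.integral_cong) (auto simp: algebra_simps)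
  also have "\<dots> = \<alpha> * (q - (\<integral>z. fst z * \<rho> z \<partial>lborel))"
    using int int1 by (subst integral_diff_cmult) (auto simp: right_diff_distrib)
  finally show ?thesis .
qed

lemma gibbs_invariant:
  assumes m: "Psi lam m = 0"
  shows "invariant_density V \<psi> lam (gibbs lam m)"
  unfolding invariant_density_def
proof (intro conjI)
  obtain k0 where "confining (W m) lam k0" using W_confining[OF lam] .
  then interpret confining "W m" lam k0 .
  have i: "integrable lborel (\<lambda>z. fst z ^ n * gibbs lam m z)" for n by (rule gibbs_moment_int)
  show "probability_density (gibbs lam m)" by (rule gibbs_probability_density)
  show "\<exists>C. AE x in lborel. \<bar>gibbs lam m x\<bar> \<le> C"
    using mu_le mu_pos partition_pos
    by (intro exI[of _ "exp (k0 / lam) / partition"] AE_I2) (auto simp: gibbs_def divide_right_mono less_imp_le)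
  show "convolution_defined \<psi> (gibbs lam m)"
    unfolding convolution_defined_def
  proof
    fix q
    have "integrable lborel (\<lambda>z. \<alpha> / 2 * q\<^sup>2 * (fst z ^ 0 * gibbs lam m z) - \<alpha> * q * (fst z ^ 1 * gibbs lam m z)
        + \<alpha> / 2 * (fst z ^ 2 * gibbs lam m z))"
      by (intro Bochner_Integration.integrable_add Bochner_Integration.integrable_diff integrable_mult_right i)
    moreover have "(\<lambda>(q', p'). \<psi> (q - q') * gibbs lam m (q', p')) = (\<lambda>z. \<alpha> / 2 * q\<^sup>2 * (fst z ^ 0 * gibbs lam m z) - \<alpha> * q * (fst z ^ 1 * gibbs lam m z)
        + \<alpha> / 2 * (fst z ^ 2 * gibbs lam m z))"
      by (auto simp: \<psi>_def fun_eq_iff power2_eq_square algebra_simps)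
    ultimately show "integrable lborel (\<lambda>(q', p'). \<psi> (q - q') * gibbs lam m (q', p'))" by simp
  qed
  show "convolution_defined (deriv \<psi>) (gibbs lam m)"
    unfolding convolution_defined_def
  proof
    fix q
    have "integrable lborel (\<lambda>z. \<alpha> * q * (fst z ^ 0 * gibbs lam m z) - \<alpha> * (fst z ^ 1 * gibbs lam m z))"
      by (intro Bochner_Integration.integrable_diff integrable_mult_right i)
    moreover have "(\<lambda>(q', p'). deriv \<psi> (q - q') * gibbs lam m (q', p')) = (\<lambda>z. \<alpha> * q * (fst z ^ 0 * gibbs lam m z) - \<alpha> * (fst z ^ 1 * gibbs lam m z))"
      by (auto simp: deriv_psi fun_eq_iff algebra_simps)
    ultimately show "integrable lborel (\<lambda>(q', p'). deriv \<psi> (q - q') * gibbs lam m (q', p'))" by simp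
  qed
  have conv: "convolution (deriv \<psi>) (gibbs lam m) q = \<alpha> * (q - m)" for q
    using convolution_linear_force[of "gibbs lam m" q] i[of 0] i[of 1] gibbs_total m gibbs_mean_iff by simp
  show "stationary_vfp V \<psi> lam (gibbs lam m)"
    unfolding stationary_vfp_def
  proof (intro allI impI)
    fix \<phi> assume \<phi>: "test_function \<phi>"
    have "(\<integral>(q, p). gibbs lam m (q, p) * (p * partial_q \<phi> (q, p)
             - (deriv V q + convolution (deriv \<psi>) (gibbs lam m) q + p) * partial_p \<phi> (q, p)
             + lam * partial_p (partial_p \<phi>) (q, p)) \<partial>lborel)
      = (\<integral>z. mu z * (snd z * partial_q \<phi> z - (deriv (W m) (fst z) + snd z) * partial_p \<phi> z
         + lam * partial_p (partial_p \<phi>) z) / partition \<partial>lborel)"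
      by (rule Bochner_Integration.integral_cong) (auto simp: conv deriv_V deriv_Wm gibbs_def)
    also have "\<dots> = 0" using mu_stationary[OF \<phi>] by simp
    finally show "(\<integral>(q, p). gibbs lam m (q, p) * (p * partial_q \<phi> (q, p)
             - (deriv V q + convolution (deriv \<psi>) (gibbs lam m) q + p) * partial_p \<phi> (q, p)
             + lam * partial_p (partial_p \<phi>) (q, p)) \<partial>lborel) = 0" .
  qed
qed

text \<open>The mean \<open>m\<close> of the given density determines the linear equation that it solves, hence the density;
  that its mean is \<open>m\<close> is then the self-consistency equation.\<close>

lemma invariant_is_gibbs:
  assumes inv: "invariant_density V \<psi> lam \<rho>"
  obtains m where "Psi lam m = 0" "AE z in lborel. \<rho> z = gibbs lam m z"
proof -
  have r0: "0 \<le> \<rho> z" and ri: "integrable lborel \<rho>" and r1: "(\<integral>z. \<rho> z \<partial>lborel) = 1" for z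
    using inv unfolding invariant_density_def probability_density_def by blast+
  obtain C where C: "AE z in lborel. \<bar>\<rho> z\<bar> \<le> C" using inv by (auto simp: invariant_density_def)
  have "integrable lborel (\<lambda>(q', p'). deriv \<psi> (0 - q') * \<rho> (q', p'))"
    using inv unfolding invariant_density_def convolution_defined_def by blast
  then have "integrable lborel (\<lambda>z. (- 1 / \<alpha>) * (case z of (q', p') \<Rightarrow> deriv \<psi> (0 - q') * \<rho> (q', p')))"
    by (rule integrable_mult_right)
  then have ri1: "integrable lborel (\<lambda>z. fst z * \<rho> z)"
    using alpha_pos by (simp add: deriv_psi split_def)
  define m where "m = (\<integral>z. fst z * \<rho> z \<partial>lborel)"
  have conv: "convolution (deriv \<psi>) \<rho> q = \<alpha> * (q - m)" for q
    unfolding m_def by (rule convolution_linear_force[OF ri r1 ri1])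
  obtain k0 where k0: "confining (W m) lam k0" using W_confining[OF lam] .
  obtain \<eta> K where \<eta>: "mollifier \<eta> K" "\<And>x. x \<in> {0<..<1} \<Longrightarrow> 0 < \<eta> x" using ex_mollifier by blast
  \<comment> \<open>A representative that is bounded everywhere and not only almost everywhere.\<close>
  define \<rho>' where "\<rho>' z = min (\<rho> z) (max C 0)" for z
  have AE': "AE z in lborel. \<rho>' z = \<rho> z" using C by eventually_elim (auto simp: \<rho>'_def)
  have m': "\<rho>' \<in> borel_measurable lborel" using ri unfolding \<rho>'_def[abs_def] by measurable
  have ri': "integrable lborel \<rho>'"
    using integrable_cong_AE[OF m' borel_measurable_integrable[OF ri] AE'] ri by simp
  interpret confining "W m" lam k0 by (rule k0)
  interpret linear_stationary "W m" lam k0 \<eta> K \<rho>' "max C 0"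
  proof (intro linear_stationary.intro k0 \<eta>(1) linear_stationary_axioms.intro)
    fix a b R assume a: "bump_function a R" and b: "bump_function b R"
    have sa: "smooth a" and sb: "smooth b" using a b by (auto simp: bump_function_def)
    let ?\<phi> = "\<lambda>(q, p). a q * b p"
    have pq: "partial_q ?\<phi> = (\<lambda>(q, p). deriv a q * b p)" using funpow_partial_q[OF sa, of 1 b] by simp
    have pp: "partial_p ?\<phi> = (\<lambda>(q, p). a q * deriv b p)" using funpow_partial_p[OF sb, of 1 a] by simp
    have ppp: "partial_p (\<lambda>(q, p). a q * deriv b p) = (\<lambda>(q, p). a q * deriv (deriv b) p)"
      using funpow_partial_p[OF smooth_deriv[OF sb], of 1 a] by simp
    have "(\<integral>(q, p). \<rho> (q, p) * (p * partial_q ?\<phi> (q, p)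
             - (deriv V q + convolution (deriv \<psi>) \<rho> q + p) * partial_p ?\<phi> (q, p)
             + lam * partial_p (partial_p ?\<phi>) (q, p)) \<partial>lborel) = 0"
      using inv test_function_tensor[OF a b] unfolding invariant_density_def stationary_vfp_def by blast
    then have eq: "(\<integral>z. \<rho> z * (snd z * (deriv a (fst z) * b (snd z))
        - (deriv (W m) (fst z) + snd z) * (a (fst z) * deriv b (snd z))
        + lam * (a (fst z) * deriv (deriv b) (snd z))) \<partial>lborel) = 0"
      unfolding pq pp ppp conv deriv_V by (simp add: deriv_Wm split_def)
    have "(\<integral>z. \<rho>' z * (snd z * (deriv a (fst z) * b (snd z))
        - (deriv (W m) (fst z) + snd z) * (a (fst z) * deriv b (snd z))
        + lam * (a (fst z) * deriv (deriv b) (snd z))) \<partial>lborel)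
      = (\<integral>z. \<rho> z * (snd z * (deriv a (fst z) * b (snd z))
        - (deriv (W m) (fst z) + snd z) * (a (fst z) * deriv b (snd z))
        + lam * (a (fst z) * deriv (deriv b) (snd z))) \<partial>lborel)"
    proof (rule integral_cong_AE)
      let ?h = "\<lambda>z. snd z * (deriv a (fst z) * b (snd z))
        - (deriv (W m) (fst z) + snd z) * (a (fst z) * deriv b (snd z))
        + lam * (a (fst z) * deriv (deriv b) (snd z))"
      have snd_comp: "continuous_on UNIV (\<lambda>z :: real \<times> real. f (snd z))" if "smooth f" for f
        by (rule continuous_on_compose2[OF smooth_continuous[OF that, of UNIV]]) (auto intro!: continuous_intros)
      have "continuous_on UNIV ?h"
        by (intro continuous_intros continuous_fst_comp snd_comp smooth_deriv smooth_Wm sa sb)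
      then have h: "?h \<in> borel_measurable lborel" by (simp add: borel_measurable_continuous_onI)
      show "(\<lambda>z. \<rho>' z * ?h z) \<in> borel_measurable lborel" by (rule borel_measurable_times[OF m' h])
      show "(\<lambda>z. \<rho> z * ?h z) \<in> borel_measurable lborel"
        by (rule borel_measurable_times[OF borel_measurable_integrable[OF ri] h])
      show "AE z in lborel. \<rho>' z * ?h z = \<rho> z * ?h z" using AE' by eventually_elim simp
    qed
    then show "(\<integral>z. \<rho>' z * (snd z * (deriv a (fst z) * b (snd z))
        - (deriv (W m) (fst z) + snd z) * (a (fst z) * deriv b (snd z))
        + lam * (a (fst z) * deriv (deriv b) (snd z))) \<partial>lborel) = 0" using eq by simp
  qed (use \<eta> r0 ri' in \<open>auto simp: \<rho>'_def\<close>)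
  obtain c where "AE z in lborel. \<rho>' z = c * mu z" using stationary_density_unique by blast
  with AE' have c: "AE z in lborel. \<rho> z = c * mu z" by eventually_elim simp
  have "(\<integral>z. \<rho> z \<partial>lborel) = (\<integral>z. c * mu z \<partial>lborel)"
    by (rule integral_cong_AE[OF _ _ c]) (use ri moment_mu_int[of 0] in auto)
  then have "c * partition = 1" using r1 by (simp add: partition_def)
  then have "c * mu z = gibbs lam m z" for z
    using partition_pos by (simp add: gibbs_def field_simps)
  with c have AEg: "AE z in lborel. \<rho> z = gibbs lam m z" by simp
  have "(\<integral>z. fst z * \<rho> z \<partial>lborel) = (\<integral>z. fst z * gibbs lam m z \<partial>lborel)"
  proof (rule integral_cong_AE)
    show "AE z in lborel. fst z * \<rho> z = fst z * gibbs lam m z" using AEg by eventually_elim simp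
  qed (use ri1 gibbs_moment_int[of 1 m] in auto)
  then have "(\<integral>z. fst z * gibbs lam m z \<partial>lborel) = m" by (simp add: m_def)
  then have "Psi lam m = 0" by (simp only: gibbs_mean_iff)
  then show ?thesis using AEg by (rule that)
qed

lemma invariant_probabilities: "{M. invariant_probability V \<psi> lam M} = gibbs_measure lam ` {m. Psi lam m = 0}"
proof (intro equalityI subsetI)
  fix M assume "M \<in> {M. invariant_probability V \<psi> lam M}"
  then obtain \<rho> where \<rho>: "invariant_density V \<psi> lam \<rho>" "M = density lborel (\<lambda>z. ennreal (\<rho> z))"
    by (auto simp: invariant_probability_def)
  obtain m where m: "Psi lam m = 0" "AE z in lborel. \<rho> z = gibbs lam m z"
    using invariant_is_gibbs[OF \<rho>(1)] .
  have "M = gibbs_measure lam m"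
    unfolding \<rho>(2) gibbs_measure_def
  proof (rule density_cong)
    show "AE z in lborel. ennreal (\<rho> z) = ennreal (gibbs lam m z)" using m(2) by eventually_elim simp
  qed (use \<rho>(1) gibbs_moment_int[of 0 m] in \<open>auto simp: invariant_density_def probability_density_def\<close>)
  then show "M \<in> gibbs_measure lam ` {m. Psi lam m = 0}" using m by blast
next
  fix M assume "M \<in> gibbs_measure lam ` {m. Psi lam m = 0}"
  then show "M \<in> {M. invariant_probability V \<psi> lam M}"
    using gibbs_invariant by (auto simp: invariant_probability_def gibbs_measure_def)
qed

text \<open>The measure determines its mean, which is the parameter \<open>m\<close> at a fixed point.\<close>

lemma gibbs_measure_inj: "inj_on (gibbs_measure lam) {m. Psi lam m = 0}"
proof (rule inj_onI)
  have mean: "(\<integral>z. fst z \<partial>gibbs_measure lam m) = m" if "Psi lam m = 0" for m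
  proof -
    have "(\<integral>z. fst z \<partial>gibbs_measure lam m) = (\<integral>z. gibbs lam m z *\<^sub>R fst z \<partial>lborel)"
      unfolding gibbs_measure_def
    proof (rule integral_density)
      have "continuous_on UNIV (fst :: real \<times> real \<Rightarrow> real)" by (intro continuous_intros)
      then show "fst \<in> borel_measurable (lborel :: (real \<times> real) measure)"
        by (subst measurable_lborel2) (rule borel_measurable_continuous_onI)
      show "gibbs lam m \<in> borel_measurable lborel"
        using borel_measurable_integrable[OF gibbs_moment_int[of 0 m]] by simp
      show "AE z in lborel. 0 \<le> gibbs lam m z" by (rule AE_I2[OF gibbs_nonneg])
    qed
    also have "\<dots> = m" using gibbs_mean_iff[of m] that by (simp add: mult.commute)
    finally show ?thesis .
  qed
  fix m m' assume "m \<in> {m. Psi lam m = 0}" "m' \<in> {m. Psi lam m = 0}" "gibbs_measure lam m = gibbs_measure lam m'"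
  then show "m = m'" using mean[of m] mean[of m'] by (metis mem_Collect_eq)
qed

lemma gibbs_symmetric: "symmetric_probability (gibbs_measure lam 0)"
  unfolding symmetric_probability_def
proof (intro exI conjI allI)
  show "probability_density (gibbs lam 0)" by (rule gibbs_probability_density)
  show "gibbs_measure lam 0 = density lborel (\<lambda>x. ennreal (gibbs lam 0 x))" by (simp add: gibbs_measure_def)
  obtain k0 where "confining (W 0) lam k0" using W_confining[OF lam] .
  then interpret confining "W 0" lam k0 .
  show "gibbs lam 0 (- q, - p) = gibbs lam 0 (q, p)" for q p
    by (simp add: gibbs_def mu_def W_def V_even)
qed

lemma unique_symmetric_if_slope_nonneg:
  assumes "0 \<le> slope lam"
  shows "\<exists>!M. invariant_probability V \<psi> lam M"
    and "invariant_probability V \<psi> lam M \<Longrightarrow> symmetric_probability M"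
proof -
  have "{m. Psi lam m = 0} = {0}" using mean_unique[OF lam assms] by auto
  then have "{M. invariant_probability V \<psi> lam M} = {gibbs_measure lam 0}"
    using invariant_probabilities by simp
  then have iff: "invariant_probability V \<psi> lam M \<longleftrightarrow> M = gibbs_measure lam 0" for M by blast
  show "\<exists>!M. invariant_probability V \<psi> lam M" by (simp add: iff)
  show "invariant_probability V \<psi> lam M \<Longrightarrow> symmetric_probability M" by (simp add: iff gibbs_symmetric)
qed

lemma three_if_slope_neg:
  assumes "slope lam < 0" shows "card {M. invariant_probability V \<psi> lam M} = 3"
  unfolding invariant_probabilities using card_image[OF gibbs_measure_inj] means_three[OF lam assms] by simp

end

lemma crit_even: "crit z (- y) = crit z y"
  by (simp add: crit_def superquadratic_def power_mult)

lemma half_line_integral: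
  assumes z: "0 < z"
  shows "set_integrable lborel {0<..} (crit z)" "(LINT y:{0<..}|lborel. crit z y) = J z / 2"
proof -
  let ?f = "\<lambda>y. indicator {0<..} y *\<^sub>R crit z y"
  have i: "integrable lborel ?f"
    by (rule integrable_mult_indicator[OF _ crit_int[OF z]]) auto
  then show "set_integrable lborel {0<..} (crit z)" by (simp add: set_integrable_def)
  have i': "integrable lborel (\<lambda>y. ?f (- y))" using i by (subst integrable_reflect)
  have "J z = (\<integral>y. ?f y + ?f (- y) \<partial>lborel)"
    unfolding J_def
  proof (rule integral_cong_AE)
    show "AE y in lborel. crit z y = ?f y + ?f (- y)"
      using AE_lborel_singleton[of "0::real"]
      by eventually_elim (auto simp: indicator_def crit_even)
  qed (use i i' crit_int[OF z] in auto)
  also have "\<dots> = (\<integral>y. ?f y \<partial>lborel) + (\<integral>y. ?f (- y) \<partial>lborel)" using i i' by simp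
  also have "(\<integral>y. ?f (- y) \<partial>lborel) = (\<integral>y. ?f y \<partial>lborel)" by (rule integral_reflect)
  finally show "(LINT y:{0<..}|lborel. crit z y) = J z / 2"
    by (simp add: set_lebesgue_integral_def)
qed

end

theorem theorem3:
  fixes V \<psi> :: "real \<Rightarrow> real" and \<alpha> :: real and r :: nat
  assumes "2 \<le> r"
    and "\<And>x. V x = - \<bar>(deriv ^^ 2) V 0\<bar> / 2 * x ^ 2
               + (\<Sum>j = 2..r. \<bar>(deriv ^^ (2 * j)) V 0\<bar> / fact (2 * j) * x ^ (2 * j))"
    and "(deriv ^^ 2) V 0 < 0"
    and "(deriv ^^ (2 * r)) V 0 \<noteq> 0"
    and "0 < \<alpha>"
    and "\<And>x. \<psi> x = \<alpha> / 2 * x ^ 2"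
  shows "\<exists>lam_c>0.
           (\<forall>lam\<ge>lam_c. (\<exists>!M. invariant_probability V \<psi> lam M) \<and>
              (\<forall>M. invariant_probability V \<psi> lam M \<longrightarrow> symmetric_probability M)) \<and>
           (\<forall>lam. 0 < lam \<and> lam < lam_c \<longrightarrow> card {M. invariant_probability V \<psi> lam M} = 3) \<and>
           critical_equation V \<alpha> r (2 * lam_c) \<and>
           (\<forall>z>0. critical_equation V \<alpha> r z \<longrightarrow> z = 2 * lam_c)"
proof -
  define v where "v = \<bar>(deriv ^^ 2) V 0\<bar>"
  define c where "c j = \<bar>(deriv ^^ (2 * j)) V 0\<bar> / fact (2 * j)" for j
  interpret d: double_well v \<alpha> c r
    by unfold_locales (use assms in \<open>auto simp: v_def c_def\<close>)
  have V: "d.V = V"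
  proof
    fix x show "d.V x = V x" unfolding d.V_def unfolding v_def c_def by (rule assms(2)[symmetric])
  qed
  have \<psi>: "d.\<psi> = \<psi>"
    using assms(6) by (auto simp: d.\<psi>_def)
  have crit: "critical_integrand V \<alpha> r z = d.crit z" for z
  proof
    fix y show "critical_integrand V \<alpha> r z y = d.crit z y"
      unfolding critical_integrand_def d.crit_def d.superquadratic_def unfolding v_def c_def by simp
  qed
  have eq: "critical_equation V \<alpha> r z \<longleftrightarrow> d.J z = 0" if "0 < z" for z
    by (simp add: critical_equation_def crit d.half_line_integral[OF that])
  obtain zc where zc: "0 < zc" "d.J zc = 0" "\<And>z. 0 < z \<Longrightarrow> z < zc \<Longrightarrow> 0 < d.J z" "\<And>z. zc < z \<Longrightarrow> d.J z < 0"
    using d.J_sign_change by blast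
  show ?thesis
  proof (intro exI[of _ "zc / 2"] conjI allI impI)
    show "0 < zc / 2" using zc by simp
    show "critical_equation V \<alpha> r (2 * (zc / 2))" using eq[OF zc(1)] zc(2) by simp
    show "z = 2 * (zc / 2)" if "0 < z" "critical_equation V \<alpha> r z" for z
      using eq[OF that(1)] that(2) zc(3)[of z] zc(4)[of z] that(1) by (cases z zc rule: linorder_cases) auto
  next
    fix lam assume "zc / 2 \<le> lam"
    then have lam: "0 < lam" "zc \<le> 2 * lam" using zc by auto
    have "d.J (2 * lam) \<le> 0" using zc(2) zc(4)[of "2 * lam"] lam by (cases "zc = 2 * lam") auto
    then have s: "0 \<le> d.slope lam"
      unfolding d.slope_J[OF lam(1)] using lam assms(5) by (intro mult_nonpos_nonpos) auto
    show "\<exists>!M. invariant_probability V \<psi> lam M"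
      using d.unique_symmetric_if_slope_nonneg(1)[OF lam(1) s] by (simp add: V \<psi>)
    show "symmetric_probability M" if "invariant_probability V \<psi> lam M" for M
      using d.unique_symmetric_if_slope_nonneg(2)[OF lam(1) s] that by (simp add: V \<psi>)
  next
    fix lam assume l: "0 < lam \<and> lam < zc / 2"
    then have "0 < d.J (2 * lam)" by (intro zc) auto
    then have "d.slope lam < 0"
      unfolding d.slope_J[OF conjunct1[OF l]] using l assms(5) by (intro mult_neg_pos) auto
    then show "card {M. invariant_probability V \<psi> lam M} = 3"
      using d.three_if_slope_neg[OF conjunct1[OF l]] by (simp add: V \<psi>)
  qed
qed

end
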